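(* Let $(G,P_G,\varphi)$ and $(G,P_G',\varphi')$ be quasi-Poisson Lie groups (on the same Lie group $G$ with Lie algebra $\mathfrak g$) such that $(G,P_G',\varphi')$ is obtained by twisting by $r\in\bigwedge^2\mathfrak g$ from $(G,P_G,\varphi)$. Let $(X,P_X)$ be a homogeneous quasi-Poisson $(G,P_G,\varphi)$-space. Then $(X,P_X-r_X)$ is a homogeneous quasi-Poisson $(G,P_G',\varphi')$-space, and the map $P_X\mapsto P_X-r_X$ is a bijection between the set of all $(G,P_G,\varphi)$-quasi-Poisson structures on $X$ and the set of all $(G,P_G',\varphi')$-quasi-Poisson structures on $X$.
   Context: Conventions. $\bigwedge^k V$ is regarded as the space of skew-symmetric tensors in $V^{\otimes k}$; $v\wedge w=\frac1{m!\,n!}\mathrm{Alt}(v\otimes w)$ for $v$ of degree $m$ and $w$ of degree $n$, where $\mathrm{Alt}(x_1\otimes\cdots\otimes x_k)=\sum_{\sigma\in S_k}\mathrm{sign}(\sigma)x_{\sigma(1)}\otimes\cdots\otimes x_{\sigma(k)}$. $[\![\cdot,\cdot]\!]$ is the Schouten bracket of multivector fields, with sign convention such that for vector fields $[\![a\wedge b,c\wedge d]\!]=[a,c]\wedge b\wedge d-[a,d]\wedge b\wedge c-[b,c]\wedge a\wedge d+[b,d]\wedge a\wedge c$ (and the analogous standard formula $\sum(-1)^{i+j}[X_i,Y_j]\wedge\cdots$ in other degrees). For $v\in\bigwedge^\bullet\mathfrak g$, $v^\lambda(g)=(l_g)_*v$ and $v^\rho(g)=(r_g)_*v$ are the left and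 right invariant multivector fields, where $l_g,r_g$ are left and right translations. Quasi-Poisson Lie group: a triple $(G,P_G,\varphi)$ with $G$ a Lie group with Lie algebra $\mathfrak g$, $P_G$ a bivector field on $G$, $\varphi\in\bigwedge^3\mathfrak g$, such that $P_G(gg')=(l_g)_*P_G(g')+(r_{g'})_*P_G(g)$, $\frac12[\![P_G,P_G]\!]=\varphi^\rho-\varphi^\lambda$, and $[\![P_G,\varphi^\rho]\!]=0$. Put $\eta(g)=(r_{g^{-1}})_*P_G(g)\in\bigwedge^2\mathfrak g$ and $\delta=d_e\eta:\mathfrak g\to\bigwedge^2\mathfrak g$. Twisting: $(G,P_G',\varphi')$ is obtained by twisting by $r\in\bigwedge^2\mathfrak g$ from $(G,P_G,\varphi)$ if $P_G'=P_G+r^\lambda-r^\rho$ and $\varphi'=\varphi+\frac12\mathrm{Alt}(\delta\otimes\mathrm{id})r-\mathrm{CYB}(r)$, where $\mathrm{CYB}(r)=[r^{12},r^{13}]+[r^{12},r^{23}]+[r^{13},r^{23}]$; i.e. for $r=\sum_i r_i'\otimes r_i''$, $[r^{12},r^{13}]=\sum_{i,j}[r_i',r_j']\otimes r_i''\otimes r_j''$, $[r^{12},r^{23}]=\sum_{i,j}r_i'\otimes[r_i'',r_j']\otimes r_j''$, $[r^{13},r^{23}]=\sum_{i,j}r_i'\otimes r_j'\otimes[r_i'',r_j'']$. Quasi-Poisson action: if $G$ acts smoothly on a manifold $X$ with bivector field $P_X$, write $l_g:X\to X$, $x\mapsto gx$, and $\rho_x:G\to X$, $g\mapsto gx$; for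 $v\in\mathfrak g$, $v_X(x)=\frac{d}{dt}|_{t=0}\exp(tv)x$, extended to $v\in\bigwedge^\bullet\mathfrak g$ by $v_X(x)=(\rho_x)_*v$. The action is quasi-Poisson (with respect to $(G,P_G,\varphi)$) if $P_X(gx)=(l_g)_*P_X(x)+(\rho_x)_*P_G(g)$ for all $g,x$, and $\frac12[\![P_X,P_X]\!]=\varphi_X$. If moreover $G$ acts transitively, $(X,P_X)$ is a homogeneous quasi-Poisson $(G,P_G,\varphi)$-space. For a fixed homogeneous $G$-space $X$, a $(G,P_G,\varphi)$-quasi-Poisson structure on $X$ is a bivector field $P_X$ for which the action is quasi-Poisson. *)

theory Defs
  imports "HOL-Analysis.Analysis" "HOL-Algebra.Group_Action" "HOL-Combinatorics.Permutations"
begin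

section \<open>Smooth manifolds\<close>

text \<open>
  The model space of dimension \<open>n\<close> is \<^const>\<open>Euclidean_space\<close> \<open>n\<close>: the functions
  \<open>nat \<Rightarrow> real\<close> vanishing from index \<open>n\<close> on. The dimension is a natural number rather than a
  Euclidean type, so that zero-dimensional manifolds (such as a one-point homogeneous space)
  are included.
\<close>

text \<open>\<open>W\<close> is meant to be open in the model space; \<open>F'\<close> is then the \<open>i\<close>-th partial derivative on \<open>W\<close>.\<close>

primrec Ck_on :: "nat \<Rightarrow> (nat \<Rightarrow> real) set \<Rightarrow> nat \<Rightarrow> ((nat \<Rightarrow> real) \<Rightarrow> real) \<Rightarrow> bool" where
  "Ck_on n W 0 F \<longleftrightarrow> continuous_map (subtopology (Euclidean_space n) W) euclideanreal F"
| "Ck_on n W (Suc k) F \<longleftrightarrow>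
     continuous_map (subtopology (Euclidean_space n) W) euclideanreal F \<and>
     (\<forall>i<n. \<exists>F'. (\<forall>x\<in>W. ((\<lambda>t. F (x(i := t))) has_real_derivative F' x) (at (x i))) \<and>
                 Ck_on n W k F')"

definition smooth_on :: "nat \<Rightarrow> (nat \<Rightarrow> real) set \<Rightarrow> ((nat \<Rightarrow> real) \<Rightarrow> real) \<Rightarrow> bool" where
  "smooth_on n W F \<longleftrightarrow> (\<forall>k. Ck_on n W k F)"

record 'a smooth_structure =
  mdim :: nat
  charts :: "('a set \<times> ('a \<Rightarrow> nat \<Rightarrow> real)) set"

text \<open>The topology is the one of the type \<open>'a\<close>, whose sort says Hausdorff and second countable.
  The atlas is not required to be maximal.\<close>

definition smooth_manifold ::
  "'a::{t2_space, second_countable_topology} smooth_structure \<Rightarrow> bool" where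
  "smooth_manifold M \<longleftrightarrow>
     (\<Union>(U, \<phi>)\<in>charts M. U) = UNIV \<and>
     (\<forall>(U, \<phi>)\<in>charts M.
        open U \<and> openin (Euclidean_space (mdim M)) (\<phi> ` U) \<and>
        homeomorphic_map (top_of_set U) (subtopology (Euclidean_space (mdim M)) (\<phi> ` U)) \<phi>) \<and>
     (\<forall>(U, \<phi>)\<in>charts M. \<forall>(V, \<psi>)\<in>charts M. \<forall>i<mdim M.
        smooth_on (mdim M) (\<phi> ` (U \<inter> V)) (\<lambda>y. \<psi> (inv_into U \<phi> y) i))"

definition C_inf :: "'a smooth_structure \<Rightarrow> ('a \<Rightarrow> real) set" where
  "C_inf M = {f. \<forall>(U, \<phi>)\<in>charts M. smooth_on (mdim M) (\<phi> ` U) (\<lambda>y. f (inv_into U \<phi> y))}"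

definition smooth_map :: "'a::topological_space smooth_structure \<Rightarrow>
    'b::topological_space smooth_structure \<Rightarrow> ('a \<Rightarrow> 'b) \<Rightarrow> bool" where
  "smooth_map M N F \<longleftrightarrow> continuous_on UNIV F \<and>
     (\<forall>(U, \<phi>)\<in>charts M. \<forall>(V, \<psi>)\<in>charts N. \<forall>i<mdim N.
        smooth_on (mdim M) (\<phi> ` (U \<inter> F -` V)) (\<lambda>y. \<psi> (F (inv_into U \<phi> y)) i))"

definition prod_manifold ::
  "'a smooth_structure \<Rightarrow> 'b smooth_structure \<Rightarrow> ('a \<times> 'b) smooth_structure" where
  "prod_manifold M N =
     \<lparr>mdim = mdim M + mdim N,
      charts = {(U \<times> V, \<lambda>(x, y) i. if i < mdim M then \<phi> x i else \<psi> y (i - mdim M)) | U \<phi> V \<psi>.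
                (U, \<phi>) \<in> charts M \<and> (V, \<psi>) \<in> charts N}\<rparr>"


section \<open>Tangent vectors and skew-symmetric tensors\<close>

text \<open>
  Tangent vectors at a point are derivations of the algebra of smooth functions, made
  extensional by the value \<open>0\<close> off that algebra. As the tangent spaces are spaces of real-valued
  functionals, the \<open>k\<close>-th tensor power of such a space embeds into the functions of \<open>k\<close> arguments,
  \<open>v\<^sub>1 \<otimes> \<dots> \<otimes> v\<^sub>k\<close> being \<open>(f\<^sub>1, \<dots>, f\<^sub>k) \<mapsto> v\<^sub>1 f\<^sub>1 \<cdots> v\<^sub>k f\<^sub>k\<close>. The arguments are passed as a list, with
  value \<open>0\<close> on lists of the wrong length.
\<close>

type_synonym 'a vec = "('a \<Rightarrow> real) \<Rightarrow> real"
type_synonym 'a tensor = "('a \<Rightarrow> real) list \<Rightarrow> real"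

definition tangent :: "'a smooth_structure \<Rightarrow> 'a \<Rightarrow> 'a vec set" where
  "tangent M x = {v.
     (\<forall>f\<in>C_inf M. \<forall>g\<in>C_inf M. \<forall>a b. v (\<lambda>y. a * f y + b * g y) = a * v f + b * v g) \<and>
     (\<forall>f\<in>C_inf M. \<forall>g\<in>C_inf M. v (\<lambda>y. f y * g y) = v f * g x + f x * v g) \<and>
     (\<forall>f. f \<notin> C_inf M \<longrightarrow> v f = 0)}"

definition tensor_prod :: "'a vec list \<Rightarrow> 'a tensor" where
  "tensor_prod vs = (\<lambda>fs. if length fs = length vs then (\<Prod>i<length vs. (vs ! i) (fs ! i)) else 0)"

definition tensor_power :: "'a vec set \<Rightarrow> nat \<Rightarrow> 'a tensor set" where
  "tensor_power V k = {t. \<exists>(N::nat) c vs. (\<forall>i<N. length (vs i) = k \<and> set (vs i) \<subseteq> V) \<and>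
     t = (\<lambda>fs. \<Sum>i<N. c i * tensor_prod (vs i) fs)}"

definition ext_power :: "'a vec set \<Rightarrow> nat \<Rightarrow> 'a tensor set" where
  "ext_power V k = {t \<in> tensor_power V k. \<forall>\<sigma> fs. \<sigma> permutes {..<k} \<longrightarrow> length fs = k \<longrightarrow>
     t (permute_list \<sigma> fs) = of_int (sign \<sigma>) * t fs}"

text \<open>Permuting the factors of a tensor by \<open>\<sigma>\<close> permutes its arguments by the inverse of \<open>\<sigma>\<close>, which
  has the same sign.\<close>

definition Alt :: "nat \<Rightarrow> 'a tensor \<Rightarrow> 'a tensor" where
  "Alt k t = (\<lambda>fs. if length fs = k
     then \<Sum>\<sigma> | \<sigma> permutes {..<k}. of_int (sign \<sigma>) * t (permute_list \<sigma> fs) else 0)"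

text \<open>\<open>v\<^sub>1 \<and> \<dots> \<and> v\<^sub>k\<close>: iterating \<open>v \<and> w = Alt (v \<otimes> w) / (m! n!)\<close> on vectors cancels all the factorials.\<close>

definition wedge :: "'a vec list \<Rightarrow> 'a tensor" where
  "wedge vs = Alt (length vs) (tensor_prod vs)"

definition push_vec :: "'b smooth_structure \<Rightarrow> ('a \<Rightarrow> 'b) \<Rightarrow> 'a vec \<Rightarrow> 'b vec" where
  "push_vec N F v = (\<lambda>f. if f \<in> C_inf N then v (\<lambda>x. f (F x)) else 0)"

definition push :: "'b smooth_structure \<Rightarrow> ('a \<Rightarrow> 'b) \<Rightarrow> 'a tensor \<Rightarrow> 'b tensor" where
  "push N F t = (\<lambda>fs. if set fs \<subseteq> C_inf N then t (map (\<lambda>f x. f (F x)) fs) else 0)"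


section \<open>Multivector fields and the Schouten bracket\<close>

definition vector_field :: "'a smooth_structure \<Rightarrow> ('a \<Rightarrow> 'a vec) \<Rightarrow> bool" where
  "vector_field M X \<longleftrightarrow>
     (\<forall>x. X x \<in> tangent M x) \<and> (\<forall>f\<in>C_inf M. (\<lambda>x. X x f) \<in> C_inf M)"

definition multivector_field :: "'a smooth_structure \<Rightarrow> nat \<Rightarrow> ('a \<Rightarrow> 'a tensor) \<Rightarrow> bool" where
  "multivector_field M k P \<longleftrightarrow>
     (\<forall>x. P x \<in> ext_power (tangent M x) k) \<and>
     (\<forall>fs. length fs = k \<longrightarrow> set fs \<subseteq> C_inf M \<longrightarrow> (\<lambda>x. P x fs) \<in> C_inf M)"

definition lie_bracket :: "('a \<Rightarrow> 'a vec) \<Rightarrow> ('a \<Rightarrow> 'a vec) \<Rightarrow> 'a \<Rightarrow> 'a vec" where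
  "lie_bracket X Y = (\<lambda>x f. X x (\<lambda>y. Y y f) - Y x (\<lambda>y. X y f))"

definition drop_nth :: "nat \<Rightarrow> 'b list \<Rightarrow> 'b list" where
  "drop_nth i xs = take i xs @ drop (Suc i) xs"

text \<open>Schouten bracket of \<open>X\<^sub>1 \<and> \<dots> \<and> X\<^sub>m\<close> and \<open>Y\<^sub>1 \<and> \<dots> \<and> Y\<^sub>n\<close>.\<close>

definition schouten_wedge ::
  "('a \<Rightarrow> 'a vec) list \<Rightarrow> ('a \<Rightarrow> 'a vec) list \<Rightarrow> 'a \<Rightarrow> 'a tensor" where
  "schouten_wedge Xs Ys x = (\<lambda>fs. \<Sum>i<length Xs. \<Sum>j<length Ys. (- 1) ^ (i + j) *
     wedge (map (\<lambda>Z. Z x) (lie_bracket (Xs ! i) (Ys ! j) # drop_nth i Xs @ drop_nth j Ys)) fs)"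

lemma schouten_wedge_2_2:
  "schouten_wedge [a, b] [c, d] x fs =
     wedge [lie_bracket a c x, b x, d x] fs - wedge [lie_bracket a d x, b x, c x] fs
     - wedge [lie_bracket b c x, a x, d x] fs + wedge [lie_bracket b d x, a x, c x] fs"
  by (simp add: schouten_wedge_def drop_nth_def numeral_2_eq_2)

definition wedge_decomposition ::
  "'a::topological_space smooth_structure \<Rightarrow> nat \<Rightarrow> ('a \<Rightarrow> 'a tensor) \<Rightarrow> 'a \<Rightarrow>
   ('a \<Rightarrow> 'a vec) list list \<Rightarrow> bool" where
  "wedge_decomposition M k P x Xss \<longleftrightarrow>
     (\<forall>Xs\<in>set Xss. length Xs = k \<and> (\<forall>X\<in>set Xs. vector_field M X)) \<and>
     (\<exists>U. open U \<and> x \<in> U \<and>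
        (\<forall>y\<in>U. P y = (\<lambda>fs. \<Sum>Xs\<leftarrow>Xss. wedge (map (\<lambda>X. X y) Xs) fs)))"

text \<open>
  Every smooth multivector field is, near each point, a sum of wedge products of vector fields
  (a coordinate frame cut off by bump functions), and the bracket is bilinear and local; the
  value does not depend on the decompositions that are chosen.
\<close>

definition schouten :: "'a::topological_space smooth_structure \<Rightarrow> nat \<Rightarrow> nat \<Rightarrow>
    ('a \<Rightarrow> 'a tensor) \<Rightarrow> ('a \<Rightarrow> 'a tensor) \<Rightarrow> 'a \<Rightarrow> 'a tensor" where
  "schouten M m n P Q x = (SOME T. \<exists>Xss Yss.
     wedge_decomposition M m P x Xss \<and> wedge_decomposition M n Q x Yss \<and>
     T = (\<lambda>fs. \<Sum>Xs\<leftarrow>Xss. \<Sum>Ys\<leftarrow>Yss. schouten_wedge Xs Ys x fs))"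


section \<open>Lie groups and their Lie algebras\<close>

definition lie_group ::
  "'g::{t2_space, second_countable_topology} smooth_structure \<Rightarrow> 'g monoid \<Rightarrow> bool" where
  "lie_group M G \<longleftrightarrow> smooth_manifold M \<and> group G \<and> carrier G = UNIV \<and>
     smooth_map (prod_manifold M M) M (\<lambda>(g, h). g \<otimes>\<^bsub>G\<^esub> h) \<and>
     smooth_map M M (\<lambda>g. inv\<^bsub>G\<^esub> g)"

definition lie_algebra :: "'g smooth_structure \<Rightarrow> 'g monoid \<Rightarrow> 'g vec set" where
  "lie_algebra M G = tangent M \<one>\<^bsub>G\<^esub>"

definition left_inv :: "'g smooth_structure \<Rightarrow> 'g monoid \<Rightarrow> 'g tensor \<Rightarrow> 'g \<Rightarrow> 'g tensor" where
  "left_inv M G t g = push M (\<lambda>h. g \<otimes>\<^bsub>G\<^esub> h) t"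

definition right_inv :: "'g smooth_structure \<Rightarrow> 'g monoid \<Rightarrow> 'g tensor \<Rightarrow> 'g \<Rightarrow> 'g tensor" where
  "right_inv M G t g = push M (\<lambda>h. h \<otimes>\<^bsub>G\<^esub> g) t"

text \<open>The bracket of the Lie algebra is the one of left invariant vector fields.\<close>

definition alg_bracket :: "'g smooth_structure \<Rightarrow> 'g monoid \<Rightarrow> 'g vec \<Rightarrow> 'g vec \<Rightarrow> 'g vec" where
  "alg_bracket M G u v = lie_bracket (\<lambda>g. push_vec M (\<lambda>h. g \<otimes>\<^bsub>G\<^esub> h) u)
     (\<lambda>g. push_vec M (\<lambda>h. g \<otimes>\<^bsub>G\<^esub> h) v) \<one>\<^bsub>G\<^esub>"

text \<open>A list of pairs \<open>(r'\<^sub>i, r''\<^sub>i)\<close> with \<open>r = \<Sum>\<^sub>i r'\<^sub>i \<otimes> r''\<^sub>i\<close>. The two constructions below are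
  bilinear, so they do not depend on which of these presentations is chosen.\<close>

definition tensor_decomposition :: "'a vec set \<Rightarrow> 'a tensor \<Rightarrow> ('a vec \<times> 'a vec) list \<Rightarrow> bool" where
  "tensor_decomposition V r ps \<longleftrightarrow>
     (\<forall>(a, b)\<in>set ps. a \<in> V \<and> b \<in> V) \<and> r = (\<lambda>fs. \<Sum>(a, b)\<leftarrow>ps. tensor_prod [a, b] fs)"

definition CYB :: "'g smooth_structure \<Rightarrow> 'g monoid \<Rightarrow> 'g tensor \<Rightarrow> 'g tensor" where
  "CYB M G r = (let ps = (SOME ps. tensor_decomposition (lie_algebra M G) r ps);
                    br = alg_bracket M G in
     (\<lambda>fs. \<Sum>(a, b)\<leftarrow>ps. \<Sum>(c, d)\<leftarrow>ps.
        tensor_prod [br a c, b, d] fs + tensor_prod [a, br b c, d] fs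
        + tensor_prod [a, c, br b d] fs))"

text \<open>\<open>D \<otimes> id\<close> applied to \<open>r\<close>, for a linear map \<open>D\<close> from \<open>V\<close> to the tensors of degree \<open>m\<close>.\<close>

definition tensor_map_id ::
  "'a vec set \<Rightarrow> nat \<Rightarrow> ('a vec \<Rightarrow> 'a tensor) \<Rightarrow> 'a tensor \<Rightarrow> 'a tensor" where
  "tensor_map_id V m D r = (let ps = (SOME ps. tensor_decomposition V r ps) in
     (\<lambda>fs. if length fs = m + 1 then \<Sum>(a, b)\<leftarrow>ps. D a (take m fs) * b (fs ! m) else 0))"


section \<open>Quasi-Poisson Lie groups\<close>

definition quasi_poisson_lie_group :: "'g::{t2_space, second_countable_topology} smooth_structure \<Rightarrow>
    'g monoid \<Rightarrow> ('g \<Rightarrow> 'g tensor) \<Rightarrow> 'g tensor \<Rightarrow> bool" where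
  "quasi_poisson_lie_group M G P \<phi> \<longleftrightarrow>
     lie_group M G \<and> multivector_field M 2 P \<and> \<phi> \<in> ext_power (lie_algebra M G) 3 \<and>
     (\<forall>g h fs. P (g \<otimes>\<^bsub>G\<^esub> h) fs =
        push M (\<lambda>k. g \<otimes>\<^bsub>G\<^esub> k) (P h) fs + push M (\<lambda>k. k \<otimes>\<^bsub>G\<^esub> h) (P g) fs) \<and>
     (\<forall>g fs. 1 / 2 * schouten M 2 2 P P g fs = right_inv M G \<phi> g fs - left_inv M G \<phi> g fs) \<and>
     (\<forall>g fs. schouten M 2 3 P (right_inv M G \<phi>) g fs = 0)"

definition eta :: "'g smooth_structure \<Rightarrow> 'g monoid \<Rightarrow> ('g \<Rightarrow> 'g tensor) \<Rightarrow> 'g \<Rightarrow> 'g tensor" where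
  "eta M G P g = push M (\<lambda>h. h \<otimes>\<^bsub>G\<^esub> inv\<^bsub>G\<^esub> g) (P g)"

text \<open>The differential at the unit of \<^const>\<open>eta\<close>, a map into a fixed vector space of tensors: the
  tangent vector \<open>v\<close> differentiates each of its linear coordinates \<open>g \<mapsto> eta g fs\<close>.\<close>

definition delta ::
  "'g smooth_structure \<Rightarrow> 'g monoid \<Rightarrow> ('g \<Rightarrow> 'g tensor) \<Rightarrow> 'g vec \<Rightarrow> 'g tensor" where
  "delta M G P v = (\<lambda>fs. v (\<lambda>g. eta M G P g fs))"

definition obtained_by_twisting :: "'g smooth_structure \<Rightarrow> 'g monoid \<Rightarrow> 'g tensor \<Rightarrow>
    ('g \<Rightarrow> 'g tensor) \<Rightarrow> 'g tensor \<Rightarrow> ('g \<Rightarrow> 'g tensor) \<Rightarrow> 'g tensor \<Rightarrow> bool" where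
  "obtained_by_twisting M G r P \<phi> P' \<phi>' \<longleftrightarrow>
     (\<forall>g fs. P' g fs = P g fs + left_inv M G r g fs - right_inv M G r g fs) \<and>
     (\<forall>fs. \<phi>' fs = \<phi> fs
        + 1 / 2 * Alt 3 (tensor_map_id (lie_algebra M G) 2 (delta M G P) r) fs
        - CYB M G r fs)"


section \<open>Quasi-Poisson actions\<close>

definition smooth_action ::
  "'g::topological_space smooth_structure \<Rightarrow> 'g monoid \<Rightarrow>
   'x::{t2_space, second_countable_topology} smooth_structure \<Rightarrow> ('g \<Rightarrow> 'x \<Rightarrow> 'x) \<Rightarrow> bool" where
  "smooth_action MG G MX act \<longleftrightarrow> smooth_manifold MX \<and> group_action G UNIV act \<and>
     smooth_map (prod_manifold MG MX) MX (\<lambda>(g, x). act g x)"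

definition homogeneous_space ::
  "'g::topological_space smooth_structure \<Rightarrow> 'g monoid \<Rightarrow>
   'x::{t2_space, second_countable_topology} smooth_structure \<Rightarrow> ('g \<Rightarrow> 'x \<Rightarrow> 'x) \<Rightarrow> bool" where
  "homogeneous_space MG G MX act \<longleftrightarrow> smooth_action MG G MX act \<and> transitive_action G UNIV act"

text \<open>The tensor field \<open>v\<^sub>X\<close> on \<open>X\<close> generated by \<open>v\<close>; for \<open>v\<close> in the Lie algebra this is the velocity
  of \<open>t \<mapsto> exp (t v) x\<close> at \<open>t = 0\<close>, by the chain rule.\<close>

definition fundamental :: "'x smooth_structure \<Rightarrow> ('g \<Rightarrow> 'x \<Rightarrow> 'x) \<Rightarrow> 'g tensor \<Rightarrow> 'x \<Rightarrow> 'x tensor" where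
  "fundamental MX act v x = push MX (\<lambda>g. act g x) v"

definition quasi_poisson_action ::
  "'g::topological_space smooth_structure \<Rightarrow> 'g monoid \<Rightarrow> ('g \<Rightarrow> 'g tensor) \<Rightarrow> 'g tensor \<Rightarrow>
   'x::{t2_space, second_countable_topology} smooth_structure \<Rightarrow> ('g \<Rightarrow> 'x \<Rightarrow> 'x) \<Rightarrow>
   ('x \<Rightarrow> 'x tensor) \<Rightarrow> bool" where
  "quasi_poisson_action MG G PG \<phi> MX act PX \<longleftrightarrow>
     smooth_action MG G MX act \<and> multivector_field MX 2 PX \<and>
     (\<forall>g x fs. PX (act g x) fs = push MX (act g) (PX x) fs + push MX (\<lambda>h. act h x) (PG g) fs) \<and>
     (\<forall>x fs. 1 / 2 * schouten MX 2 2 PX PX x fs = fundamental MX act \<phi> x fs)"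

definition homogeneous_quasi_poisson_space ::
  "'g::topological_space smooth_structure \<Rightarrow> 'g monoid \<Rightarrow> ('g \<Rightarrow> 'g tensor) \<Rightarrow> 'g tensor \<Rightarrow>
   'x::{t2_space, second_countable_topology} smooth_structure \<Rightarrow> ('g \<Rightarrow> 'x \<Rightarrow> 'x) \<Rightarrow>
   ('x \<Rightarrow> 'x tensor) \<Rightarrow> bool" where
  "homogeneous_quasi_poisson_space MG G PG \<phi> MX act PX \<longleftrightarrow>
     quasi_poisson_action MG G PG \<phi> MX act PX \<and> homogeneous_space MG G MX act"

definition quasi_poisson_structures ::
  "'g::topological_space smooth_structure \<Rightarrow> 'g monoid \<Rightarrow> ('g \<Rightarrow> 'g tensor) \<Rightarrow> 'g tensor \<Rightarrow>
   'x::{t2_space, second_countable_topology} smooth_structure \<Rightarrow> ('g \<Rightarrow> 'x \<Rightarrow> 'x) \<Rightarrow>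
   ('x \<Rightarrow> 'x tensor) set" where
  "quasi_poisson_structures MG G PG \<phi> MX act = {PX. quasi_poisson_action MG G PG \<phi> MX act PX}"

end

theory Submission
  imports Defs
begin

text \<open>
  On functions, half the Schouten square of a bivector field \<open>P\<close> is the Jacobiator of the bracket
  \<open>{f, g} = P(df, dg)\<close>. Replacing \<open>P\<close> by \<open>P - r\<^sub>X\<close> splits it into the Jacobiator of \<open>P\<close>, that of
  \<open>r\<^sub>X\<close>, and a mixed term. The Jacobiator of \<open>r\<^sub>X\<close> is \<open>- CYB(r)\<^sub>X\<close>, because \<open>a \<mapsto> a\<^sub>X\<close> reverses brackets.
  The mixed term only involves the Lie derivatives of \<open>P\<close> along the fields \<open>a\<^sub>X\<close>; differentiating
  \<open>P(gx) = g\<^sub>* P(x) + (\<rho>\<^sub>x)\<^sub>* P\<^sub>G(g)\<close> at the unit identifies them with \<open>\<delta>(a)\<^sub>X\<close>, so that the mixed term is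
  \<open>(Alt (\<delta> \<otimes> id) r)\<^sub>X / 2\<close>. Only the compatibility of \<open>P\<close> with \<open>P\<^sub>G\<close> is used, not its Schouten
  identity, so the same computation gives both directions of the bijection.
  The Jacobiator describes the chosen value of the Schouten bracket only if decompositions
  exist, which is why local frames, hence Hadamard's lemma and bump functions, are needed.
\<close>


section \<open>Smooth functions on open subsets of the model space\<close>

text \<open>Tangent vectors are algebraic derivations and \<open>C_inf\<close> is defined through
  iterated partial derivatives, so neither coordinates nor a chain rule come with the definitions.
  One device supplies both: the quotient of a function by a coordinate increment, written as an
  integral, loses only one order of differentiability. It yields the chain rule, the symmetry of
  second derivatives and the expansion of a derivation in coordinates. The recurrent obstacle in the
  final computation is to move a Lie algebra element past a tangent vector of \<open>X\<close>. The
  two differentiate one function of a group element and a point, each in its own variable, so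
  symmetric second derivatives on the product manifold allow the exchange. The same exchange on two
  copies of the group gives the reversed bracket. Tensors are functions of lists and their
  identities are claimed for every list. Lists of wrong length or with nonsmooth entries are
  therefore treated separately, by means of the default value 0.\<close>

abbreviation openE :: "nat \<Rightarrow> (nat \<Rightarrow> real) set \<Rightarrow> bool" where
  "openE n W \<equiv> openin (Euclidean_space n) W"

section \<open>Cubes as a neighbourhood base of the model space\<close>

definition cube :: "nat \<Rightarrow> (nat \<Rightarrow> real) \<Rightarrow> real \<Rightarrow> (nat \<Rightarrow> real) set" where
  "cube n p e = {y. (\<forall>i\<ge>n. y i = 0) \<and> (\<forall>i<n. \<bar>y i - p i\<bar> < e)}"

lemma Euclidean_space_eq: "Euclidean_space n = top_of_set {x. \<forall>i\<ge>n. x i = 0}"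
  by (simp add: Euclidean_space_def euclidean_product_topology)

lemma openE_zero: "openE n W \<Longrightarrow> x \<in> W \<Longrightarrow> n \<le> i \<Longrightarrow> x i = 0"
  using openin_subset[of "Euclidean_space n" W] by (auto simp: topspace_Euclidean_space)

lemma openE_open: "openE n W \<longleftrightarrow> (\<exists>T. open T \<and> W = {x. \<forall>i\<ge>n. x i = 0} \<inter> T)"
  by (auto simp: Euclidean_space_eq openin_open)

lemma openE_cube: "openE n (cube n p e)"
proof -
  have "open ((\<lambda>y::nat\<Rightarrow>real. y i) -` {t. \<bar>t - p i\<bar> < e})" for i
    by (intro open_vimage open_Collect_less continuous_intros continuous_on_product_coordinates)
  then have "open (\<Inter>i<n. (\<lambda>y::nat\<Rightarrow>real. y i) -` {t. \<bar>t - p i\<bar> < e})"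
    by (intro open_INT) auto
  moreover have "cube n p e = {x. \<forall>i\<ge>n. x i = 0} \<inter> (\<Inter>i<n. (\<lambda>y. y i) -` {t. \<bar>t - p i\<bar> < e})"
    by (auto simp: cube_def)
  ultimately show ?thesis unfolding openE_open by blast
qed

lemma cube_self: "(\<And>i. n \<le> i \<Longrightarrow> p i = 0) \<Longrightarrow> e > 0 \<Longrightarrow> p \<in> cube n p e"
  by (simp add: cube_def)

text \<open>A basic open set of the product topology restricts finitely many coordinates, possibly
  beyond \<open>n\<close>. Those cost nothing, since all points of the model space vanish there, so
  the first \<open>n\<close> radii suffice.\<close>

lemma openE_contains_cube:
  assumes "openE n W" "p \<in> W"
  obtains e where "e > 0" "cube n p e \<subseteq> W"
proof -
  obtain T where T: "open T" "W = {x. \<forall>i\<ge>n. x i = 0} \<inter> T"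
    using assms(1) unfolding openE_open by blast
  have "openin (product_topology (\<lambda>i::nat. euclideanreal) UNIV) T"
    using T by (simp add: euclidean_product_topology)
  from product_topology_open_contains_basis[OF this] T assms(2)
  obtain X where X: "p \<in> (\<Pi>\<^sub>E i\<in>UNIV. X i)" "\<And>i. open (X i)" "finite {i. X i \<noteq> UNIV}"
      "(\<Pi>\<^sub>E i\<in>UNIV. X i) \<subseteq> T" by simp blast
  have "\<exists>e>0. \<forall>t. \<bar>t - p i\<bar> < e \<longrightarrow> t \<in> X i" for i
    using X(1) X(2)[of i] unfolding open_dist dist_real_def by (auto simp: PiE_iff)
  then obtain d where d: "\<And>i. d i > 0" "\<And>i t. \<bar>t - p i\<bar> < d i \<Longrightarrow> t \<in> X i" by metis
  \<comment> \<open>The element 1 keeps the minimum meaningful when \<open>n = 0\<close>.\<close>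
  define e where "e = Min (insert 1 (d ` {..<n}))"
  have e: "e > 0" "\<And>i. i < n \<Longrightarrow> e \<le> d i" unfolding e_def using d(1) by auto
  have "cube n p e \<subseteq> W"
  proof
    fix y assume y: "y \<in> cube n p e"
    have "y i \<in> X i" for i
    proof (cases "i < n")
      case True then show ?thesis using y e(2)[of i] by (intro d(2)) (auto simp: cube_def)
    next
      case False
      then have "y i = p i" using y openE_zero[OF assms] by (auto simp: cube_def)
      then show ?thesis using d(1)[of i] d(2)[of "p i" i] by simp
    qed
    then have "y \<in> T" using X(4) by (auto simp: PiE_iff)
    then show "y \<in> W" using y T(2) by (auto simp: cube_def)
  qed
  then show ?thesis using e that by blast
qed

section \<open>Partial derivatives\<close>

lemma eventually_upd_openE:
  assumes "openE n W" "x \<in> W" "i < n"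
  shows "\<forall>\<^sub>F t in nhds (x i). x(i := t) \<in> W"
proof -
  obtain e where e: "e > 0" "cube n x e \<subseteq> W" using openE_contains_cube[OF assms(1,2)] .
  have "\<forall>\<^sub>F t in nhds (x i). \<bar>t - x i\<bar> < e"
    using e(1) unfolding eventually_nhds_metric dist_real_def by blast
  then show ?thesis
  proof (rule eventually_mono)
    fix t assume "\<bar>t - x i\<bar> < e"
    then have "x(i := t) \<in> cube n x e"
      using openE_zero[OF assms(1,2)] assms(3) e(1) by (auto simp: cube_def)
    then show "x(i := t) \<in> W" using e by auto
  qed
qed

text \<open>Being built on \<open>deriv\<close>, this is a total function that can be named and
  iterated; its value is meaningful only where the one-variable derivative exists.\<close>

definition pd :: "nat \<Rightarrow> ((nat \<Rightarrow> real) \<Rightarrow> real) \<Rightarrow> (nat \<Rightarrow> real) \<Rightarrow> real" where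
  "pd i F x = deriv (\<lambda>t. F (x(i := t))) (x i)"

lemma pd_eqI: "((\<lambda>t. F (x(i := t))) has_real_derivative D) (at (x i)) \<Longrightarrow> pd i F x = D"
  unfolding pd_def by (rule DERIV_imp_deriv)

lemma has_pd_cong:
  assumes "openE n W" "x \<in> W" "i < n" "\<And>y. y \<in> W \<Longrightarrow> F y = G y"
  shows "((\<lambda>t. F (x(i := t))) has_real_derivative D) (at (x i)) \<longleftrightarrow>
         ((\<lambda>t. G (x(i := t))) has_real_derivative D) (at (x i))"
  by (rule DERIV_cong_ev[OF refl _ refl])
     (rule eventually_mono[OF eventually_upd_openE[OF assms(1-3)]], simp add: assms(4))

lemma pd_cong:
  assumes "openE n W" "x \<in> W" "i < n" "\<And>y. y \<in> W \<Longrightarrow> F y = G y"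
  shows "pd i F x = pd i G x"
  unfolding pd_def deriv_def using has_pd_cong[OF assms(1-3), of F G, OF assms(4)] by simp

lemma Ck_on_continuous:
  assumes "openE n W" shows "continuous_map (subtopology (Euclidean_space n) W) euclideanreal F \<longleftrightarrow> continuous_on W F"
proof -
  have "W \<subseteq> {x. \<forall>i\<ge>n. x i = 0}" using openE_zero[OF assms] by auto
  then have "{x. \<forall>i\<ge>n. x i = 0} \<inter> W = W" by auto
  then show ?thesis by (simp add: Euclidean_space_eq subtopology_subtopology)
qed

lemma Ck_on_cong:
  assumes "openE n W" "\<And>y. y \<in> W \<Longrightarrow> F y = G y" "Ck_on n W k F"
  shows "Ck_on n W k G"
proof (cases k)
  case 0
  then show ?thesis using assms by (simp add: Ck_on_continuous cong: continuous_on_cong)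
next
  case (Suc k')
  have "continuous_on W F \<longleftrightarrow> continuous_on W G" using assms(2) by (rule continuous_on_cong[OF refl])
  moreover have "((\<lambda>t. F (x(i := t))) has_real_derivative D) (at (x i)) \<longleftrightarrow>
         ((\<lambda>t. G (x(i := t))) has_real_derivative D) (at (x i))" if "i < n" "x \<in> W" for i x D
    using assms(1) that(2,1) assms(2) by (rule has_pd_cong)
  ultimately show ?thesis using assms(3)
    unfolding Suc Ck_on.simps(2) Ck_on_continuous[OF assms(1)] by simp
qed

lemma Ck_on_SucI:
  assumes "openE n W" "continuous_on W F"
    and "\<And>i x. i < n \<Longrightarrow> x \<in> W \<Longrightarrow> ((\<lambda>t. F (x(i := t))) has_real_derivative D i x) (at (x i))"
    and "\<And>i. i < n \<Longrightarrow> Ck_on n W k (D i)"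
  shows "Ck_on n W (Suc k) F"
  unfolding Ck_on.simps(2) Ck_on_continuous[OF assms(1)] using assms(2-4) by blast

text \<open>Derivatives are unique, so the existential witness in \<open>Ck_on\<close> can be taken
  to be \<open>pd i F\<close>. Inductions on \<open>k\<close> then have a definite function to
  descend to.\<close>

lemma Ck_on_Suc_iff:
  assumes "openE n W"
  shows "Ck_on n W (Suc k) F \<longleftrightarrow> continuous_on W F \<and>
    (\<forall>i<n. (\<forall>x\<in>W. ((\<lambda>t. F (x(i := t))) has_real_derivative pd i F x) (at (x i))) \<and> Ck_on n W k (pd i F))"
    (is "?L \<longleftrightarrow> ?R")
proof
  assume L: ?L
  have "(\<forall>x\<in>W. ((\<lambda>t. F (x(i := t))) has_real_derivative pd i F x) (at (x i))) \<and> Ck_on n W k (pd i F)"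
    if i: "i < n" for i
  proof -
    obtain F' where F': "\<And>x. x\<in>W \<Longrightarrow> ((\<lambda>t. F (x(i := t))) has_real_derivative F' x) (at (x i))"
        "Ck_on n W k F'" using L i unfolding Ck_on.simps(2) by blast
    have eq: "pd i F x = F' x" if "x \<in> W" for x using F'(1)[OF that] by (rule pd_eqI)
    show ?thesis using F' eq Ck_on_cong[OF assms _ F'(2), of "pd i F"] by auto
  qed
  then show ?R using L by (auto simp: Ck_on_continuous[OF assms])
next
  assume ?R then show ?L by (auto simp: Ck_on_continuous[OF assms])
qed

lemma Ck_on_0_iff: "openE n W \<Longrightarrow> Ck_on n W 0 F \<longleftrightarrow> continuous_on W F"
  by (simp add: Ck_on_continuous)

declare Ck_on.simps[simp del]

lemma Ck_on_imp_continuous_on: "openE n W \<Longrightarrow> Ck_on n W k F \<Longrightarrow> continuous_on W F"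
  by (cases k) (auto simp: Ck_on_0_iff Ck_on_Suc_iff)

text \<open>In product and chain rules the undifferentiated factor has one order more than the
  differentiated one; this brings both to the same class.\<close>

lemma Ck_on_Suc_D:
  assumes "openE n W" shows "Ck_on n W (Suc k) F \<Longrightarrow> Ck_on n W k F"
proof (induction k arbitrary: F)
  case 0
  then show ?case unfolding Ck_on_Suc_iff[OF assms] Ck_on_0_iff[OF assms] by blast
next
  case (Suc k)
  then show ?case unfolding Ck_on_Suc_iff[OF assms, of "Suc k"] Ck_on_Suc_iff[OF assms, of k F] by blast
qed

lemma has_pd:
  "openE n W \<Longrightarrow> Ck_on n W (Suc k) F \<Longrightarrow> i < n \<Longrightarrow> x \<in> W \<Longrightarrow>
    ((\<lambda>t. F (x(i := t))) has_real_derivative pd i F x) (at (x i))"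
  by (simp add: Ck_on_Suc_iff)

lemma Ck_on_pd: "openE n W \<Longrightarrow> Ck_on n W (Suc k) F \<Longrightarrow> i < n \<Longrightarrow> Ck_on n W k (pd i F)"
  by (simp add: Ck_on_Suc_iff)

section \<open>Locality of the C^k classes\<close>

lemma continuous_on_openE_local:
  assumes "openE n W" "\<And>x. x \<in> W \<Longrightarrow> \<exists>W'. openE n W' \<and> x \<in> W' \<and> continuous_on W' F"
  shows "continuous_on W F"
  unfolding continuous_on_def
proof
  fix x assume x: "x \<in> W"
  then obtain W' where W': "openE n W'" "x \<in> W'" "continuous_on W' F" using assms(2)[OF x] by blast
  obtain T where T: "open T" "W = {x. \<forall>i\<ge>n. x i = 0} \<inter> T" using assms(1) unfolding openE_open by blast
  obtain T' where T': "open T'" "W' = {x. \<forall>i\<ge>n. x i = 0} \<inter> T'" using W'(1) unfolding openE_open by blast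
  have "at x within W = at x within W'"
    by (rule at_within_nhd[of x "T \<inter> T'"]) (use T T' x W' in auto)
  then show "(F \<longlongrightarrow> F x) (at x within W)" using W'(2,3) by (simp add: continuous_on_def)
qed

lemma Ck_on_local:
  assumes "openE n W" "\<And>x. x \<in> W \<Longrightarrow> \<exists>W'. openE n W' \<and> x \<in> W' \<and> Ck_on n W' k F"
  shows "Ck_on n W k F"
  using assms(2)
proof (induction k arbitrary: F)
  case 0
  have "continuous_on W F"
    by (rule continuous_on_openE_local[OF assms(1)]) (meson 0 Ck_on_imp_continuous_on)
  then show ?case using Ck_on_0_iff[OF assms(1)] by blast
next
  case (Suc k)
  have "Ck_on n W k (pd i F)" if i: "i < n" for i
  proof (rule Suc.IH)
    fix x assume "x \<in> W"
    from Suc.prems[OF this] obtain W' where "openE n W'" "x \<in> W'" "Ck_on n W' (Suc k) F" by blast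
    then show "\<exists>W'. openE n W' \<and> x \<in> W' \<and> Ck_on n W' k (pd i F)" using Ck_on_pd i by meson
  qed
  moreover have "continuous_on W F"
    by (rule continuous_on_openE_local[OF assms(1)]) (meson Suc.prems Ck_on_imp_continuous_on)
  moreover have "((\<lambda>t. F (x(i := t))) has_real_derivative pd i F x) (at (x i))" if "i < n" "x \<in> W" for i x
    using Suc.prems[OF that(2)] has_pd[OF _ _ that(1)] by meson
  ultimately show ?case by (intro Ck_on_SucI[OF assms(1)])
qed

text \<open>Restriction is a case of locality: the larger set serves as the neighbourhood of each
  point.\<close>

lemma Ck_on_subset:
  "openE n W \<Longrightarrow> openE n V \<Longrightarrow> V \<subseteq> W \<Longrightarrow> Ck_on n W k F \<Longrightarrow> Ck_on n V k F"
  by (rule Ck_on_local) auto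

section \<open>Algebraic operations on C^k functions and composition with functions of one
  variable\<close>

lemma Ck_on_const: "openE n W \<Longrightarrow> Ck_on n W k (\<lambda>x. c)"
proof (induction k arbitrary: c)
  case (Suc k)
  then show ?case by (intro Ck_on_SucI[where D="\<lambda>i x. 0"]) auto
qed (simp add: Ck_on_0_iff)

lemma Ck_on_coord:
  assumes "openE n W" shows "Ck_on n W k (\<lambda>x. x i)"
proof (cases k)
  case 0
  then show ?thesis using assms using continuous_on_subset[OF continuous_on_product_coordinates] by (simp add: Ck_on_0_iff)
next
  case (Suc k')
  have *: "((\<lambda>t. (x(j := t)) i) has_real_derivative (if i = j then 1 else 0)) (at (x j))" for j and x :: "nat\<Rightarrow>real"
    by (cases "i = j") auto
  show ?thesis unfolding Suc
    by (rule Ck_on_SucI[OF assms _ *])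
       (use assms continuous_on_subset[OF continuous_on_product_coordinates[of i] subset_UNIV] Ck_on_const in auto)
qed

lemma Ck_on_add:
  assumes W: "openE n W"
  shows "Ck_on n W k F \<Longrightarrow> Ck_on n W k G \<Longrightarrow> Ck_on n W k (\<lambda>x. F x + G x)"
proof (induction k arbitrary: F G)
  case 0
  then show ?case using W by (auto simp: Ck_on_0_iff intro: continuous_intros)
next
  case (Suc k)
  have *: "((\<lambda>t. F (x(i := t)) + G (x(i := t))) has_real_derivative (pd i F x + pd i G x)) (at (x i))"
    if "i < n" "x \<in> W" for i x
    using has_pd[OF W Suc.prems(1) that] has_pd[OF W Suc.prems(2) that] by (rule DERIV_add)
  show ?case
    by (rule Ck_on_SucI[OF W _ *])
      (use Suc W in \<open>auto intro!: continuous_intros intro: Ck_on_imp_continuous_on Ck_on_pd\<close>)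
qed

lemma Ck_on_mult:
  assumes W: "openE n W"
  shows "Ck_on n W k F \<Longrightarrow> Ck_on n W k G \<Longrightarrow> Ck_on n W k (\<lambda>x. F x * G x)"
proof (induction k arbitrary: F G)
  case 0
  then show ?case using W by (auto simp: Ck_on_0_iff intro: continuous_intros)
next
  case (Suc k)
  have *: "((\<lambda>t. F (x(i := t)) * G (x(i := t))) has_real_derivative (pd i F x * G x + pd i G x * F x)) (at (x i))"
    if "i < n" "x \<in> W" for i x
    using DERIV_mult[OF has_pd[OF W Suc.prems(1) that] has_pd[OF W Suc.prems(2) that]]
    by (simp only: fun_upd_triv)
  show ?case
    by (rule Ck_on_SucI[OF W _ *])
      (use Suc W in \<open>auto intro!: continuous_intros Ck_on_add intro: Ck_on_imp_continuous_on Ck_on_pd Ck_on_Suc_D\<close>)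
qed

lemma Ck_on_sum:
  assumes W: "openE n W"
  shows "finite A \<Longrightarrow> (\<And>j. j \<in> A \<Longrightarrow> Ck_on n W k (F j)) \<Longrightarrow> Ck_on n W k (\<lambda>x. \<Sum>j\<in>A. F j x)"
  by (induction A rule: finite_induct) (auto intro: Ck_on_const Ck_on_add assms)

text \<open>The sequence \<open>\<sigma>\<close> lists a smooth function of one variable and its derivatives.\<close>

lemma Ck_on_real_compose:
  assumes W: "openE n W" and s: "\<And>m t. (\<sigma> m has_real_derivative \<sigma> (Suc m) t) (at t)"
  shows "Ck_on n W k F \<Longrightarrow> Ck_on n W k (\<lambda>x. \<sigma> m (F x))"
proof (induction k arbitrary: F m)
  case 0
  have "continuous_on UNIV (\<sigma> m)" using s by (meson DERIV_isCont continuous_at_imp_continuous_on)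
  then show ?case using 0 W by (auto simp: Ck_on_0_iff intro: continuous_on_compose2)
next
  case (Suc k)
  have *: "((\<lambda>t. \<sigma> m (F (x(i := t)))) has_real_derivative (\<sigma> (Suc m) (F x) * pd i F x)) (at (x i))"
    if "i < n" "x \<in> W" for i x
  proof -
    have "(\<sigma> m has_real_derivative \<sigma> (Suc m) (F x)) (at (F (x(i := x i))))" using s by simp
    from DERIV_chain2[OF this has_pd[OF W Suc.prems that]] show ?thesis by (simp only: fun_upd_triv)
  qed
  have "continuous_on UNIV (\<sigma> m)" using s by (meson DERIV_isCont continuous_at_imp_continuous_on)
  moreover have "continuous_on W F" using Suc.prems W by (rule Ck_on_imp_continuous_on[rotated])
  ultimately have "continuous_on W (\<lambda>x. \<sigma> m (F x))" by (auto intro: continuous_on_compose2)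
  then show ?case
    by (rule Ck_on_SucI[OF W _ *])
      (use Suc W in \<open>auto intro!: Ck_on_mult intro: Ck_on_pd Ck_on_Suc_D\<close>)
qed

section \<open>Hadamard quotients, the chain rule and the symmetry of second derivatives\<close>

text \<open>With \<open>K = {..<j}\<close> and \<open>i = j\<close> these segments telescope from \<open>p\<close> to \<open>y\<close> and give Hadamard's lemma;
  \<open>K = - {i}\<close> gives the symmetry of second derivatives.\<close>

definition seg :: "nat set \<Rightarrow> nat \<Rightarrow> (nat \<Rightarrow> real) \<Rightarrow> (nat \<Rightarrow> real) \<Rightarrow> real \<Rightarrow> nat \<Rightarrow> real" where
  "seg K i p y t = (\<lambda>l. if l \<in> K then y l else if l = i then p i + t * (y i - p i) else p l)"

text \<open>The weight \<open>t ^ m\<close> makes the family closed under differentiation: by the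
  chain rule a derivative in direction \<open>i\<close> brings out one more factor \<open>t\<close>.
  Hadamard's quotients use \<open>m = 0\<close>.\<close>

definition seg_int :: "nat set \<Rightarrow> nat \<Rightarrow> (nat \<Rightarrow> real) \<Rightarrow> nat \<Rightarrow> ((nat \<Rightarrow> real) \<Rightarrow> real) \<Rightarrow> (nat \<Rightarrow> real) \<Rightarrow> real" where
  "seg_int K i p m h y = integral (cbox 0 1) (\<lambda>t. t ^ m * h (seg K i p y t))"

lemma seg_in_cube:
  assumes p: "\<And>i. n \<le> i \<Longrightarrow> p i = 0" and e: "e > 0" and y: "y \<in> cube n p e" and t: "0 \<le> t" "t \<le> 1"
  shows "seg K i p y t \<in> cube n p e"
proof -
  have "\<bar>t * (y i - p i)\<bar> < e" if "i < n"
  proof -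
    have "\<bar>t * (y i - p i)\<bar> \<le> 1 * \<bar>y i - p i\<bar>" unfolding abs_mult using t by (intro mult_right_mono) auto
    also have "\<dots> < e" using y that by (simp add: cube_def)
    finally show ?thesis .
  qed
  moreover have "y j = 0" "p j = 0" if "n \<le> j" for j using p y that by (auto simp: cube_def)
  ultimately show ?thesis using y e by (auto simp: cube_def seg_def)
qed

lemma continuous_on_seg: "continuous_on S (\<lambda>(y, t). seg K i p y t)"
proof -
  have c: "continuous_on S (\<lambda>x. fst x l)" for l and S :: "((nat \<Rightarrow> real) \<times> real) set"
    by (rule continuous_on_product_then_coordinatewise) (intro continuous_intros)
  have "continuous_on S (\<lambda>x. seg K i p (fst x) (snd x) l)" for l
    unfolding seg_def by (cases "l \<in> K"; cases "l = i") (simp_all, (intro continuous_intros c)+)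
  then have "continuous_on S (\<lambda>x. seg K i p (fst x) (snd x))"
    by (rule continuous_on_coordinatewise_then_product)
  then show ?thesis by (simp add: case_prod_beta)
qed

lemma continuous_on_seg_compose:
  assumes p: "\<And>i. n \<le> i \<Longrightarrow> p i = 0" and e: "e > 0" and h: "continuous_on (cube n p e) h"
  shows "continuous_on (cube n p e \<times> cbox 0 1) (\<lambda>(y, t). h (seg K i p y t))"
proof -
  have "continuous_on (cube n p e \<times> cbox 0 1) (\<lambda>x. h ((\<lambda>(y, t). seg K i p y t) x))"
    by (rule continuous_on_compose2[OF h continuous_on_seg]) (auto intro: seg_in_cube[OF p e])
  then show ?thesis by (simp add: case_prod_beta)
qed

lemma seg_upd:
  assumes "i \<notin> K"
  shows "seg K i p (y(l := s)) t =
    (if l \<in> K then (seg K i p y t)(l := s)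
     else if l = i then (seg K i p y t)(i := p i + t * (s - p i)) else seg K i p y t)"
  using assms by (auto simp: seg_def fun_eq_iff)

text \<open>Differentiation under the integral sign. A direction in \<open>K\<close> keeps the
  exponent \<open>m\<close>, direction \<open>i\<close> raises it by one, and every other direction
  gives 0; hence the induction leaves both \<open>h\<close> and \<open>m\<close> free.\<close>

lemma Ck_on_seg_int:
  assumes p: "\<And>i. n \<le> i \<Longrightarrow> p i = 0" and e: "e > 0" and i: "i < n" "i \<notin> K"
  shows "Ck_on n (cube n p e) k h \<Longrightarrow> Ck_on n (cube n p e) k (seg_int K i p m h)"
proof (induction k arbitrary: h m)
  case 0
  have "continuous_on (cube n p e) (\<lambda>y. integral (cbox 0 1) (\<lambda>t. t ^ m * h (seg K i p y t)))"
  proof (rule integral_continuous_on_param)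
    have "continuous_on (cube n p e \<times> cbox 0 1) (\<lambda>x. snd x ^ m * (\<lambda>(y, t). h (seg K i p y t)) x)"
      by (intro continuous_intros continuous_on_seg_compose p e Ck_on_imp_continuous_on[OF openE_cube 0])
    then show "continuous_on (cube n p e \<times> cbox 0 1) (\<lambda>(y, t). t ^ m * h (seg K i p y t))"
      by (simp add: case_prod_beta)
  qed
  then show ?case unfolding Ck_on_0_iff[OF openE_cube] seg_int_def[abs_def] .
next
  case (Suc k)
  note h = has_pd[OF openE_cube Suc.prems]
  have hc: "continuous_on (cube n p e) h" using Suc.prems openE_cube by (rule Ck_on_imp_continuous_on[rotated])
  have hl: "continuous_on (cube n p e) (pd l h)" if "l < n" for l
    using Ck_on_imp_continuous_on[OF openE_cube Ck_on_pd[OF openE_cube Suc.prems that]] .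
  \<comment> \<open>The derivative of coordinate \<open>l\<close> of \<open>seg K i p y t\<close>
    with respect to \<open>y l\<close>.\<close>
  define c where "c l t = (if l \<in> K then 1 else if l = i then t else 0)" for l and t :: real
  define D where "D l y = integral (cbox 0 1) (\<lambda>t. t ^ m * (c l t * pd l h (seg K i p y t)))" for l y
  have ch: "Ck_on n (cube n p e) k (seg_int K i p m h)"
    by (rule Suc.IH) (rule Ck_on_Suc_D[OF openE_cube Suc.prems])
  have "((\<lambda>s. seg_int K i p m h (y(l := s))) has_real_derivative D l y) (at (y l))"
    if l: "l < n" and y: "y \<in> cube n p e" for l y
  proof -
    \<comment> \<open>The values that coordinate \<open>l\<close> may take inside the cube. The
      interval is convex, as differentiation under the integral requires, and open, so that the
      derivative within it is the full one.\<close>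
    let ?U = "ball (p l) e"
    have upd: "y(l := s) \<in> cube n p e" if "s \<in> ?U" for s
      using that y l by (auto simp: cube_def dist_real_def abs_minus_commute)
    have sg: "seg K i p (y(l := s)) t \<in> cube n p e" if "s \<in> ?U" "t \<in> cbox 0 1" for s t
      using that upd by (intro seg_in_cube p e) auto
    have cu: "continuous_on (?U \<times> cbox 0 1) (\<lambda>(s, t). g (seg K i p (y(l := s)) t))"
      if g: "continuous_on (cube n p e) g" for g :: "_ \<Rightarrow> real"
    proof -
      have "continuous_on (?U \<times> cbox 0 1) (\<lambda>x. (\<lambda>(y, t). g (seg K i p y t)) (y(l := fst x), snd x))"
      proof (rule continuous_on_compose2[OF continuous_on_seg_compose[OF p e g]])
        have "continuous_on (?U \<times> cbox (0::real) 1) (\<lambda>x. (y(l := fst x)) j)" for j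
          by (cases "j = l") (simp_all add: continuous_on_fst continuous_on_const)
        then have "continuous_on (?U \<times> cbox (0::real) 1) (\<lambda>x. y(l := fst x))"
          by (rule continuous_on_coordinatewise_then_product)
        then show "continuous_on (?U \<times> cbox (0::real) 1) (\<lambda>x. (y(l := fst x), snd x))"
          by (rule continuous_on_Pair) (rule continuous_on_snd, rule continuous_on_id)
      qed (use upd in auto)
      then show ?thesis by (simp add: case_prod_beta)
    qed
    have "((\<lambda>s. integral (cbox 0 1) (\<lambda>t. t ^ m * h (seg K i p (y(l := s)) t))) has_real_derivative
        integral (cbox 0 1) (\<lambda>t. t ^ m * (c l t * pd l h (seg K i p (y(l := y l)) t)))) (at (y l) within ?U)"
    proof (rule leibniz_rule_field_derivative)
      fix s t assume s: "s \<in> ?U" and t: "t \<in> cbox (0::real) 1"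
      let ?q = "seg K i p (y(l := s)) t"
      note hs = h[OF l sg[OF s t]]
      have "((\<lambda>s. h (seg K i p (y(l := s)) t)) has_real_derivative (c l t * pd l h ?q)) (at s)"
      proof -
        consider "l \<in> K" | "l \<notin> K" "l = i" | "l \<notin> K" "l \<noteq> i" by blast
        then show ?thesis
        proof cases
          case 1
          have eq: "(\<lambda>r. h (seg K i p (y(l := r)) t)) = (\<lambda>r. h (?q(l := r)))" using 1 by (simp add: seg_upd[OF i(2)])
          have "?q l = s" "c l t = 1" using 1 by (simp_all add: seg_def c_def)
          then show ?thesis using hs unfolding eq by (simp only: mult_1_left)
        next
          case 2
          have eq: "(\<lambda>r. h (seg K i p (y(l := r)) t)) = (\<lambda>r. (\<lambda>r. h (?q(l := r))) (p i + t * (r - p i)))"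
            using 2 i by (simp add: seg_upd[OF i(2)])
          have "?q l = p i + t * (s - p i)" using 2 by (simp add: seg_def)
          then have "((\<lambda>r. h (?q(l := r))) has_real_derivative pd l h ?q) (at (p i + t * (s - p i)))" using hs by (simp only:)
          moreover have "((\<lambda>r. p i + t * (r - p i)) has_real_derivative t) (at s)"
            by (auto intro!: derivative_eq_intros)
          ultimately have "((\<lambda>r. (\<lambda>r. h (?q(l := r))) (p i + t * (r - p i))) has_real_derivative pd l h ?q * t) (at s)"
            by (rule DERIV_chain2)
          moreover have "c l t = t" using 2 by (simp add: c_def)
          ultimately show ?thesis unfolding eq by (simp only: mult.commute)
        next
          case 3
          then show ?thesis by (simp add: seg_upd[OF i(2)] c_def)
        qed
      qed
      then show "((\<lambda>s. t ^ m * h (seg K i p (y(l := s)) t)) has_real_derivative t ^ m * (c l t * pd l h ?q)) (at s within ?U)"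
        by (intro DERIV_cmult) (rule DERIV_subset, auto)
    next
      fix s assume s: "s \<in> ?U"
      have "continuous_on (cbox 0 1) (\<lambda>t. (\<lambda>(s, t). h (seg K i p (y(l := s)) t)) (s, t))"
        by (rule continuous_on_compose2[OF cu[OF hc]]) (use s in \<open>auto intro!: continuous_intros\<close>)
      then show "(\<lambda>t. t ^ m * h (seg K i p (y(l := s)) t)) integrable_on cbox 0 1"
        by (intro integrable_continuous continuous_intros) simp
    next
      have "continuous_on (?U \<times> cbox 0 1) (\<lambda>x. c l (snd x))"
        unfolding c_def by (cases "l \<in> K"; cases "l = i") (simp_all add: continuous_on_snd continuous_on_const)
      then have "continuous_on (?U \<times> cbox 0 1) (\<lambda>x. snd x ^ m * (c l (snd x) * (\<lambda>(s, t). pd l h (seg K i p (y(l := s)) t)) x))"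
        using cu[OF hl[OF l]] by (intro continuous_intros)
      then show "continuous_on (?U \<times> cbox 0 1) (\<lambda>(s, t). t ^ m * (c l t * pd l h (seg K i p (y(l := s)) t)))"
        by (simp add: case_prod_beta)
    qed (use y l in \<open>auto simp: cube_def dist_real_def abs_minus_commute\<close>)
    moreover have "at (y l) within ?U = at (y l)"
      by (rule at_within_open) (use y l in \<open>auto simp: cube_def dist_real_def abs_minus_commute\<close>)
    ultimately show ?thesis by (simp add: seg_int_def D_def)
  qed
  moreover have "Ck_on n (cube n p e) k (D l)" if l: "l < n" for l
  proof -
    note pl = Ck_on_pd[OF openE_cube Suc.prems l]
    consider "l \<in> K" | "l \<notin> K" "l = i" | "l \<notin> K" "l \<noteq> i" by blast
    then show ?thesis
    proof cases
      case 1
      then have "D l = seg_int K i p m (pd l h)" by (simp add: D_def[abs_def] c_def seg_int_def[abs_def])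
      then show ?thesis using Suc.IH[OF pl] by simp
    next
      case 2
      then have "D l = seg_int K i p (Suc m) (pd l h)" by (simp add: D_def[abs_def] c_def seg_int_def[abs_def] mult_ac)
      then show ?thesis using Suc.IH[OF pl] by simp
    next
      case 3
      then have "D l = (\<lambda>y. 0)" by (simp add: D_def[abs_def] c_def)
      then show ?thesis by (simp add: Ck_on_const openE_cube)
    qed
  qed
  ultimately show ?case
    by (intro Ck_on_SucI[where D = D] openE_cube Ck_on_imp_continuous_on[OF openE_cube ch])
qed

text \<open>The fundamental theorem of calculus along the segment, whose velocity is
  \<open>y i - p i\<close> in direction \<open>i\<close> and zero in all others.\<close>

lemma seg_ftc:
  assumes p: "\<And>i. n \<le> i \<Longrightarrow> p i = 0" and e: "e > 0" and i: "i < n" "i \<notin> K"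
    and F: "Ck_on n (cube n p e) (Suc k) F" and y: "y \<in> cube n p e"
  shows "F (seg K i p y 1) - F (seg K i p y 0) = (y i - p i) * seg_int K i p 0 (pd i F) y"
proof -
  have "((\<lambda>t. pd i F (seg K i p y t) * (y i - p i)) has_integral F (seg K i p y 1) - F (seg K i p y 0)) {0..1}"
  proof (rule fundamental_theorem_of_calculus)
    fix t assume t: "t \<in> {0..1::real}"
    let ?q = "seg K i p y t"
    have q: "?q \<in> cube n p e" using t y by (intro seg_in_cube p e) auto
    have eq: "(\<lambda>t. F (seg K i p y t)) = (\<lambda>t. (\<lambda>s. F (?q(i := s))) (p i + t * (y i - p i)))"
      using i by (auto simp: seg_def fun_eq_iff intro!: arg_cong[where f=F])
    have "?q i = p i + t * (y i - p i)" using i by (simp add: seg_def)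
    then have "((\<lambda>s. F (?q(i := s))) has_real_derivative pd i F ?q) (at (p i + t * (y i - p i)))"
      using has_pd[OF openE_cube F i(1) q] by simp
    moreover have "((\<lambda>t. p i + t * (y i - p i)) has_real_derivative (y i - p i)) (at t)"
      by (auto intro!: derivative_eq_intros)
    ultimately have "((\<lambda>t. F (seg K i p y t)) has_real_derivative (pd i F ?q * (y i - p i))) (at t)"
      unfolding eq by (rule DERIV_chain2)
    then show "((\<lambda>t. F (seg K i p y t)) has_vector_derivative pd i F ?q * (y i - p i)) (at t within {0..1})"
      by (simp add: has_real_derivative_iff_has_vector_derivative has_vector_derivative_at_within)
  qed simp
  then have "integral {0..1} (\<lambda>t. pd i F (seg K i p y t) * (y i - p i)) = F (seg K i p y 1) - F (seg K i p y 0)"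
    by (rule integral_unique)
  then show ?thesis by (simp add: seg_int_def mult.commute)
qed

section \<open>Hadamard's lemma and the chain rule\<close>

definition hadamard_quot :: "(nat \<Rightarrow> real) \<Rightarrow> nat \<Rightarrow> ((nat \<Rightarrow> real) \<Rightarrow> real) \<Rightarrow> (nat \<Rightarrow> real) \<Rightarrow> real" where
  "hadamard_quot p j F = seg_int {..<j} j p 0 (pd j F)"

lemma Ck_on_hadamard_quot:
  assumes "\<And>i. n \<le> i \<Longrightarrow> p i = 0" "e > 0" "j < n" "Ck_on n (cube n p e) (Suc k) F"
  shows "Ck_on n (cube n p e) k (hadamard_quot p j F)"
  unfolding hadamard_quot_def
  by (rule Ck_on_seg_int) (use assms Ck_on_pd[OF openE_cube] in auto)

lemma hadamard_quot_self: "hadamard_quot p j F p = pd j F p"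
proof -
  have "seg {..<j} j p p t = p" for t by (auto simp: seg_def)
  then show ?thesis by (simp add: hadamard_quot_def seg_int_def)
qed

lemma hadamard:
  assumes p: "\<And>i. n \<le> i \<Longrightarrow> p i = 0" and e: "e > 0" and F: "Ck_on n (cube n p e) (Suc k) F"
    and y: "y \<in> cube n p e"
  shows "F y = F p + (\<Sum>j<n. (y j - p j) * hadamard_quot p j F y)"
proof -
  \<comment> \<open>A staircase from \<open>p\<close> to \<open>y\<close> that replaces one
    coordinate at a time. It reaches \<open>y\<close> at step \<open>n\<close> because both points
    vanish from index \<open>n\<close> on.\<close>
  define T where "T j = (\<lambda>l. if l < j then y l else p l)" for j :: nat
  have "(y j - p j) * hadamard_quot p j F y = F (T (Suc j)) - F (T j)" if "j < n" for j
  proof -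
    have "seg {..<j} j p y 1 = T (Suc j)" "seg {..<j} j p y 0 = T j"
      by (auto simp: seg_def T_def fun_eq_iff less_Suc_eq)
    then show ?thesis using seg_ftc[OF p e that _ F y, of "{..<j}"] by (simp add: hadamard_quot_def)
  qed
  then have "(\<Sum>j<n. (y j - p j) * hadamard_quot p j F y) = (\<Sum>j<n. F (T (Suc j)) - F (T j))" by simp
  also have "\<dots> = F (T n) - F (T 0)" by (rule sum_lessThan_telescope)
  also have "T n = y" using p y by (auto simp: T_def cube_def)
  also have "T 0 = p" by (simp add: T_def)
  finally show ?thesis by simp
qed

text \<open>At a zero of \<open>f\<close> Caratheodory's form of the derivative makes continuity of
  \<open>g\<close> enough for the product rule. Hadamard quotients have one order less than the
  function, so this is what keeps the chain rule valid for C^1 functions.\<close>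

lemma DERIV_vanish_mult:
  fixes f g :: "real \<Rightarrow> real"
  assumes "(f has_real_derivative D) (at s)" "f s = 0" "isCont g s"
  shows "((\<lambda>z. f z * g z) has_real_derivative D * g s) (at s)"
proof -
  obtain h where h: "\<And>z. f z - f s = h z * (z - s)" "isCont h s" "h s = D"
    using assms(1) CARAT_DERIV by blast
  show ?thesis unfolding CARAT_DERIV
    by (rule exI[where x="\<lambda>z. h z * g z"]) (use h assms in \<open>auto simp: mult_ac\<close>)
qed

lemma tendsto_coordinatewise:
  fixes f :: "'b \<Rightarrow> 'a \<Rightarrow> real"
  assumes "\<And>i. ((\<lambda>s. f s i) \<longlongrightarrow> l i) F"
  shows "(f \<longlongrightarrow> l) F"
proof -
  have "limitin (product_topology (\<lambda>i. euclideanreal) UNIV) f l F"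
    using assms by (simp add: limitin_componentwise)
  then show ?thesis by (simp add: euclidean_product_topology)
qed

text \<open>Hadamard's lemma centred at \<open>\<gamma> s\<close> writes \<open>F\<close> along the
  curve as a constant plus products, each with a factor that vanishes at \<open>s\<close>;
  \<open>DERIV_vanish_mult\<close> differentiates these.\<close>

lemma DERIV_compose_curve:
  assumes V: "openE m V" and F: "Ck_on m V (Suc k) F" and s: "\<gamma> s \<in> V"
    and ev: "\<forall>\<^sub>F t in nhds s. \<gamma> t \<in> V"
    and d: "\<And>j. j < m \<Longrightarrow> ((\<lambda>t. \<gamma> t j) has_real_derivative D j) (at s)"
  shows "((\<lambda>t. F (\<gamma> t)) has_real_derivative (\<Sum>j<m. D j * pd j F (\<gamma> s))) (at s)"
proof -
  define p where "p = \<gamma> s"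
  have p: "\<And>i. m \<le> i \<Longrightarrow> p i = 0" using openE_zero[OF V s] by (simp add: p_def)
  obtain e where e: "e > 0" "cube m p e \<subseteq> V" using openE_contains_cube[OF V s] unfolding p_def by blast
  have Fc: "Ck_on m (cube m p e) (Suc k) F" using Ck_on_subset[OF V openE_cube e(2) F] .
  have "\<forall>\<^sub>F t in nhds s. \<forall>j\<in>{..<m}. \<bar>\<gamma> t j - p j\<bar> < e"
  proof (rule eventually_ball_finite)
    show "\<forall>j\<in>{..<m}. \<forall>\<^sub>F t in nhds s. \<bar>\<gamma> t j - p j\<bar> < e"
    proof
      fix j assume "j \<in> {..<m}"
      then have "((\<lambda>t. \<gamma> t j) \<longlongrightarrow> p j) (nhds s)"
        using DERIV_isCont[OF d] tendsto_at_iff_tendsto_nhds[of "\<lambda>t. \<gamma> t j" s] by (simp add: p_def isCont_def)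
      then show "\<forall>\<^sub>F t in nhds s. \<bar>\<gamma> t j - p j\<bar> < e"
        using tendstoD[OF _ e(1)] by (fastforce simp: dist_real_def)
    qed
  qed simp
  with ev have evc: "\<forall>\<^sub>F t in nhds s. \<gamma> t \<in> cube m p e"
    by eventually_elim (use openE_zero[OF V] in \<open>auto simp: cube_def\<close>)
  have lim: "(\<gamma> \<longlongrightarrow> p) (at s)"
  proof (rule tendsto_coordinatewise)
    fix j
    show "((\<lambda>t. \<gamma> t j) \<longlongrightarrow> p j) (at s)"
    proof (cases "j < m")
      case True then show ?thesis using DERIV_isCont[OF d] by (simp add: p_def isCont_def)
    next
      \<comment> \<open>Coordinates from \<open>m\<close> on are 0 as long as the curve stays in
        \<open>V\<close>, so they converge although no derivative is given for them.\<close>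
      case False
      have "\<forall>\<^sub>F t in at s. \<gamma> t j = p j"
        using ev unfolding eventually_at_filter
        by eventually_elim (use False openE_zero[OF V] p in auto)
      then show ?thesis by (rule tendsto_eventually)
    qed
  qed
  have "isCont (\<lambda>t. hadamard_quot p j F (\<gamma> t)) s" if "j < m" for j
    unfolding isCont_def p_def[symmetric]
  proof (rule continuous_on_tendsto_compose[OF _ lim])
    show "continuous_on (cube m p e) (hadamard_quot p j F)"
      using Ck_on_imp_continuous_on[OF openE_cube Ck_on_hadamard_quot[OF p e(1) that Fc]] .
    show "p \<in> cube m p e" using p e by (intro cube_self)
    show "\<forall>\<^sub>F t in at s. \<gamma> t \<in> cube m p e" using evc by (simp add: eventually_at_filter eventually_mono)
  qed
  then have "((\<lambda>t. (\<gamma> t j - p j) * hadamard_quot p j F (\<gamma> t)) has_real_derivative D j * pd j F p) (at s)"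
    if "j < m" for j
    using DERIV_vanish_mult[of "\<lambda>t. \<gamma> t j - p j" "D j" s "\<lambda>t. hadamard_quot p j F (\<gamma> t)"] d[OF that] that
    by (simp add: p_def[symmetric] hadamard_quot_self DERIV_diff[where E=0, simplified])
  then have "((\<lambda>t. F p + (\<Sum>j<m. (\<gamma> t j - p j) * hadamard_quot p j F (\<gamma> t))) has_real_derivative
      (0 + (\<Sum>j<m. D j * pd j F p))) (at s)"
    by (intro DERIV_add DERIV_const DERIV_sum) auto
  moreover have "\<forall>\<^sub>F t in nhds s. F (\<gamma> t) = F p + (\<Sum>j<m. (\<gamma> t j - p j) * hadamard_quot p j F (\<gamma> t))"
    using evc by eventually_elim (rule hadamard[OF p e(1) Fc])
  ultimately show ?thesis unfolding p_def[symmetric] by (subst DERIV_cong_ev[OF refl _ refl]) auto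
qed

lemma Ck_on_compose:
  assumes W: "openE n W" and V: "openE m V" and sub: "\<And>x. x \<in> W \<Longrightarrow> \<Phi> x \<in> V"
  shows "Ck_on m V k F \<Longrightarrow> (\<And>j. j < m \<Longrightarrow> Ck_on n W k (\<lambda>x. \<Phi> x j)) \<Longrightarrow> Ck_on n W k (\<lambda>x. F (\<Phi> x))"
proof -
  \<comment> \<open>Stated for every order, since both the base and the step of the induction below
    use it.\<close>
  have cont: "continuous_on W (\<lambda>x. F (\<Phi> x))"
    if F: "Ck_on m V k F" and P: "\<And>j. j < m \<Longrightarrow> Ck_on n W k (\<lambda>x. \<Phi> x j)" for k and F :: "_ \<Rightarrow> real"
  proof -
    have "continuous_on W (\<lambda>x. \<Phi> x j)" for j
    proof (cases "j < m")
      case True then show ?thesis using Ck_on_imp_continuous_on[OF W P] by blast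
    next
      case False
      then have "\<And>x. x \<in> W \<Longrightarrow> \<Phi> x j = 0" using openE_zero[OF V sub] by auto
      then show ?thesis by (simp cong: continuous_on_cong)
    qed
    then have "continuous_on W \<Phi>" by (rule continuous_on_coordinatewise_then_product)
    then show ?thesis by (rule continuous_on_compose2[OF Ck_on_imp_continuous_on[OF V F]]) (auto intro: sub)
  qed
  show "Ck_on m V k F \<Longrightarrow> (\<And>j. j < m \<Longrightarrow> Ck_on n W k (\<lambda>x. \<Phi> x j)) \<Longrightarrow> Ck_on n W k (\<lambda>x. F (\<Phi> x))"
  proof (induction k arbitrary: F)
    case 0
    then show ?case using cont[OF 0] by (simp add: Ck_on_0_iff[OF W])
  next
    case (Suc k)
    show ?case
    proof (rule Ck_on_SucI[OF W cont[OF Suc.prems]])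
      fix i x assume ix: "i < n" "x \<in> W"
      have "((\<lambda>t. F (\<Phi> (x(i := t)))) has_real_derivative
          (\<Sum>j<m. pd i (\<lambda>x. \<Phi> x j) x * pd j F (\<Phi> (x(i := x i))))) (at (x i))"
      proof (rule DERIV_compose_curve[OF V Suc.prems(1)])
        show "\<forall>\<^sub>F t in nhds (x i). \<Phi> (x(i := t)) \<in> V"
          using eventually_upd_openE[OF W ix(2,1)] by eventually_elim (rule sub)
        show "((\<lambda>t. \<Phi> (x(i := t)) j) has_real_derivative pd i (\<lambda>x. \<Phi> x j) x) (at (x i))" if "j < m" for j
          using has_pd[OF W Suc.prems(2)[OF that] ix] .
      qed (use sub ix in auto)
      then show "((\<lambda>t. F (\<Phi> (x(i := t)))) has_real_derivative
          (\<Sum>j<m. pd i (\<lambda>x. \<Phi> x j) x * pd j F (\<Phi> x))) (at (x i))" by (simp only: fun_upd_triv)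
    next
      fix i assume i: "i < n"
      show "Ck_on n W k (\<lambda>x. \<Sum>j<m. pd i (\<lambda>x. \<Phi> x j) x * pd j F (\<Phi> x))"
      proof (intro Ck_on_sum[OF W] Ck_on_mult[OF W])
        fix j assume j: "j \<in> {..<m}"
        show "Ck_on n W k (pd i (\<lambda>x. \<Phi> x j))" using Ck_on_pd[OF W Suc.prems(2) i] j by auto
        show "Ck_on n W k (\<lambda>x. pd j F (\<Phi> x))"
          by (rule Suc.IH[OF Ck_on_pd[OF V Suc.prems(1)]]) (use j in \<open>auto intro: Ck_on_Suc_D[OF W Suc.prems(2)]\<close>)
      qed simp
    qed
  qed
qed

text \<open>Write \<open>F y - F (y(i := x i)) = (y i - x i) * G y\<close> with \<open>G\<close> an
  integral along direction \<open>i\<close>. Differentiating first in \<open>j\<close>, then in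
  \<open>i\<close> at \<open>x\<close>, leaves \<open>pd j G x\<close>, because the other factor
  vanishes there. On the slice \<open>y i = x i\<close> the function \<open>G\<close> is
  \<open>pd i F\<close>, so this equals \<open>pd j (pd i F) x\<close>.\<close>

lemma pd_commute:
  assumes W: "openE n W" and F: "Ck_on n W (Suc (Suc k)) F" and ij: "i < n" "j < n" and x: "x \<in> W"
  shows "pd i (pd j F) x = pd j (pd i F) x"
proof (cases "i = j")
  case False
  note p = openE_zero[OF W x]
  obtain e where e: "e > 0" "cube n x e \<subseteq> W" using openE_contains_cube[OF W x] .
  note Fc = Ck_on_subset[OF W openE_cube e(2) F]
  let ?C = "cube n x e"
  define G where "G = seg_int (- {i}) i x 0 (pd i F)"
  have G1: "Ck_on n ?C (Suc k) G"
    unfolding G_def by (rule Ck_on_seg_int) (use p e ij Ck_on_pd[OF openE_cube Fc] in auto)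
  have seg: "seg (- {i}) i x y 1 = y" "seg (- {i}) i x y 0 = y(i := x i)" for y
    by (auto simp: seg_def fun_eq_iff)
  have FG: "F y - F (y(i := x i)) = (y i - x i) * G y" if "y \<in> ?C" for y
    using seg_ftc[OF p e(1) ij(1) _ Fc that, of "- {i}"] unfolding G_def seg by simp
  have Gi: "G y = pd i F y" if "y i = x i" for y
  proof -
    have "seg (- {i}) i x y t = y" for t using that by (auto simp: seg_def fun_eq_iff)
    then show ?thesis by (simp add: G_def seg_int_def)
  qed
  have xC: "x \<in> ?C" using p e by (intro cube_self)
  have upd: "x(i := s) \<in> ?C" if "\<bar>s - x i\<bar> < e" for s
    using that xC ij by (auto simp: cube_def)
  have key: "pd j F (x(i := s)) = pd j F x + (s - x i) * pd j G (x(i := s))" if s: "\<bar>s - x i\<bar> < e" for s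
  proof -
    let ?y = "x(i := s)"
    have yC: "?y \<in> ?C" using upd[OF s] .
    have "((\<lambda>t. F (?y(j := t)) - (s - x i) * G (?y(j := t))) has_real_derivative
        (pd j F ?y - (s - x i) * pd j G ?y)) (at (?y j))"
      by (intro DERIV_diff DERIV_cmult has_pd[OF openE_cube Fc ij(2) yC] has_pd[OF openE_cube G1 ij(2) yC])
    moreover have "\<forall>\<^sub>F t in nhds (?y j). F (?y(j := t)) - (s - x i) * G (?y(j := t)) = F (x(j := t))"
      using eventually_upd_openE[OF openE_cube yC ij(2)]
    proof eventually_elim
      case (elim t)
      have "?y(j := t, i := x i) = x(j := t)" using False by (auto simp: fun_eq_iff)
      moreover have "(?y(j := t)) i = s" using False by simp
      ultimately show ?case using FG[OF elim] by simp
    qed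
    ultimately have "((\<lambda>t. F (x(j := t))) has_real_derivative (pd j F ?y - (s - x i) * pd j G ?y)) (at (?y j))"
      by (subst (asm) DERIV_cong_ev[OF refl _ refl]) auto
    then show ?thesis using False pd_eqI[of F x j] by simp
  qed
  have "((\<lambda>s. pd j F (x(i := s))) has_real_derivative pd j G x) (at (x i))"
  proof -
    have "continuous_on ?C (pd j G)" using Ck_on_imp_continuous_on[OF openE_cube Ck_on_pd[OF openE_cube G1 ij(2)]] .
    moreover have "(\<lambda>s. x(i := s)) \<midarrow>x i\<rightarrow> x"
    proof (rule tendsto_coordinatewise)
      show "(\<lambda>s. (x(i := s)) l) \<midarrow>x i\<rightarrow> x l" for l by (cases "l = i") auto
    qed
    moreover have "\<forall>\<^sub>F s in at (x i). x(i := s) \<in> ?C"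
      using eventually_upd_openE[OF openE_cube xC ij(1)] by (simp add: eventually_at_filter eventually_mono)
    ultimately have "(\<lambda>s. pd j G (x(i := s))) \<midarrow>x i\<rightarrow> pd j G x"
      using xC by (intro continuous_on_tendsto_compose[of ?C "pd j G" "\<lambda>s. x(i := s)" x])
    then have "isCont (\<lambda>s. pd j G (x(i := s))) (x i)" by (simp add: isCont_def)
    moreover have "((\<lambda>s. s - x i) has_real_derivative 1) (at (x i))" by (auto intro!: derivative_eq_intros)
    ultimately have "((\<lambda>s. (s - x i) * pd j G (x(i := s))) has_real_derivative 1 * pd j G (x(i := x i))) (at (x i))"
      by (intro DERIV_vanish_mult) auto
    then have "((\<lambda>s. pd j F x + (s - x i) * pd j G (x(i := s))) has_real_derivative pd j G x) (at (x i))"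
      using DERIV_add[OF DERIV_const[of "pd j F x"]] by (simp only: fun_upd_triv mult_1_left add_0_left)
    moreover have "\<forall>\<^sub>F s in nhds (x i). pd j F (x(i := s)) = pd j F x + (s - x i) * pd j G (x(i := s))"
      unfolding eventually_nhds_metric dist_real_def using key e(1) by blast
    ultimately show ?thesis by (subst DERIV_cong_ev[OF refl _ refl]) auto
  qed
  then have "pd i (pd j F) x = pd j G x" by (rule pd_eqI)
  also have "\<dots> = pd j (pd i F) x"
  proof -
    have "(\<lambda>t. G (x(j := t))) = (\<lambda>t. pd i F (x(j := t)))" using False by (intro ext Gi) auto
    then show ?thesis by (simp add: pd_def)
  qed
  finally show ?thesis .
qed simp

section \<open>Bump functions\<close>

text \<open>With \<open>u = 1 / t\<close> and \<open>du/dt = - u^2\<close>, the derivative of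
  \<open>q(u) exp (- u)\<close> in \<open>t\<close> is \<open>u^2 (q(u) - q'(u)) exp (- u)\<close>;
  the polynomial \<open>[:0, 0, 1:]\<close> is \<open>u^2\<close>.\<close>

primrec flat_poly :: "nat \<Rightarrow> real poly" where
  "flat_poly 0 = 1"
| "flat_poly (Suc m) = [:0, 0, 1:] * (flat_poly m - pderiv (flat_poly m))"

text \<open>\<open>flat m\<close> is the \<open>m\<close>-th derivative of the function \<open>exp (- 1 / t)\<close> for \<open>t > 0\<close>, extended by \<open>0\<close>.\<close>

definition flat :: "nat \<Rightarrow> real \<Rightarrow> real" where
  "flat m t = (if t > 0 then poly (flat_poly m) (1 / t) * exp (- (1 / t)) else 0)"

lemma poly_exp_tendsto_0: "((\<lambda>u::real. poly q u / exp u) \<longlongrightarrow> 0) at_top"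
proof -
  have "((\<lambda>u::real. \<Sum>i\<le>degree q. coeff q i * (u ^ i / exp u)) \<longlongrightarrow> (\<Sum>i\<le>degree q. coeff q i * 0)) at_top"
    by (intro tendsto_intros tendsto_power_div_exp_0)
  then show ?thesis by (simp add: poly_altdef sum_divide_distrib)
qed

text \<open>For \<open>t > 0\<close> and \<open>u = 1 / t\<close> the difference quotient is
  \<open>u q(u) / exp u\<close>, that is \<open>pCons 0 q\<close> over the exponential, which tends
  to 0 at infinity. A general polynomial \<open>q\<close> covers all derivatives at once.\<close>

lemma flat_at_0:
  "((\<lambda>t::real. if t > 0 then poly q (1 / t) * exp (- (1 / t)) else 0) has_real_derivative 0) (at 0)"
proof -
  let ?f = "\<lambda>t::real. if t > 0 then poly q (1 / t) * exp (- (1 / t)) else 0"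
  have r: "((\<lambda>t. ?f t / t) \<longlongrightarrow> 0) (at_right 0)"
  proof -
    have "((\<lambda>u::real. poly (pCons 0 q) u / exp u) \<longlongrightarrow> 0) at_top" by (rule poly_exp_tendsto_0)
    then have "((\<lambda>t. poly (pCons 0 q) (inverse t) / exp (inverse t)) \<longlongrightarrow> 0) (at_right (0::real))"
      by (rule filterlim_compose) (rule filterlim_inverse_at_top_right)
    moreover have "\<forall>\<^sub>F t in at_right (0::real). poly (pCons 0 q) (inverse t) / exp (inverse t) = ?f t / t"
      unfolding eventually_at_filter by (intro always_eventually) (auto simp: exp_minus field_simps)
    ultimately show ?thesis by (rule Lim_transform_eventually)
  qed
  have l: "((\<lambda>t. ?f t / t) \<longlongrightarrow> 0) (at_left 0)"
    by (rule tendsto_eventually) (auto simp: eventually_at_filter)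
  have "((\<lambda>t. ?f t / t) \<longlongrightarrow> 0) (at 0)"
    using l r by (rule filterlim_split_at)
  then show ?thesis unfolding DERIV_def add_0_left by simp
qed

lemma DERIV_flat: "(flat m has_real_derivative flat (Suc m) t) (at t)"
proof -
  define q where "q = flat_poly m"
  have f: "flat m = (\<lambda>t. if t > 0 then poly q (1 / t) * exp (- (1 / t)) else 0)"
    unfolding flat_def[abs_def] q_def by (rule refl)
  have f': "flat (Suc m) t = (if t > 0 then (1 / t)\<^sup>2 * (poly q (1 / t) - poly (pderiv q) (1 / t)) * exp (- (1 / t)) else 0)"
    by (simp add: flat_def q_def power2_eq_square algebra_simps)
  consider "t > 0" | "t < 0" | "t = 0" by linarith
  then show ?thesis
  proof cases
    case 1
    have "((\<lambda>t. poly q (1 / t) * exp (- (1 / t))) has_real_derivative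
        (1 / t)\<^sup>2 * (poly q (1 / t) - poly (pderiv q) (1 / t)) * exp (- (1 / t))) (at t)"
      using 1 by (auto intro!: derivative_eq_intros DERIV_chain2[OF poly_DERIV] simp: power2_eq_square field_simps)
    moreover have "\<forall>\<^sub>F s in nhds t. s > 0" using 1 eventually_nhds_in_open[of "{0<..}" t] by simp
    then have "\<forall>\<^sub>F s in nhds t. flat m s = poly q (1 / s) * exp (- (1 / s))"
      by eventually_elim (simp add: f)
    ultimately show ?thesis using 1 f' by (subst DERIV_cong_ev[OF refl _ refl]) auto
  next
    case 2
    have "\<forall>\<^sub>F s in nhds t. s < 0" using 2 eventually_nhds_in_open[of "{..<0}" t] by simp
    then have "\<forall>\<^sub>F s in nhds t. flat m s = 0"
      by eventually_elim (simp add: f)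
    then show ?thesis using 2 f' by (subst DERIV_cong_ev[OF refl _ refl]) auto
  next
    case 3
    then show ?thesis using flat_at_0[of q] f' by (simp add: f)
  qed
qed

lemma flat_0: "flat 0 t = (if t > 0 then exp (- (1 / t)) else 0)"
  by (simp add: flat_def)

lemma smooth_bump:
  assumes p: "\<And>i. n \<le> i \<Longrightarrow> p i = 0" and e: "e > 0"
  obtains \<beta> d where "0 < d" "\<And>W k. openE n W \<Longrightarrow> Ck_on n W k \<beta>"
    "\<And>y. y \<in> cube n p d \<Longrightarrow> \<beta> y = 1" "\<And>y. \<forall>i\<ge>n. y i = 0 \<Longrightarrow> y \<notin> cube n p e \<Longrightarrow> \<beta> y = 0"
proof -
  define c where "c = flat 0 (1 / 2)"
  define C where "C = flat 0 c"
  have c: "c > 0" "C > 0" by (simp_all add: c_def C_def flat_0)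
  \<comment> \<open>The factor is chosen so that a sum of squares \<open>e^2\<close>, the least
    possible outside the cube, gives \<open>u = 1 / 2\<close>, while \<open>u \<le> 0\<close> as
    long as the sum is at most \<open>2 e^2 / 3\<close>.\<close>
  define u where "u y = 3 / (2 * e\<^sup>2) * (\<Sum>i<n. (y i - p i)\<^sup>2) - 1" for y :: "nat \<Rightarrow> real"
  txt \<open>\<open>flat 0 (c - flat 0 u)\<close> is constant where \<open>u \<le> 0\<close> and vanishes where \<open>u \<ge> 1 / 2\<close>.\<close>
  define \<beta> where "\<beta> y = (1 / C) * flat 0 (c + (-1) * flat 0 (u y))" for y
  \<comment> \<open>Small enough for \<open>n d^2 \<le> 2 e^2 / 3\<close>; the \<open>+ 1\<close>
    keeps \<open>d\<close> positive when \<open>n = 0\<close>.\<close>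
  define d where "d = e / (2 * (real n + 1))"
  have "Ck_on n W k \<beta>" if W: "openE n W" for W k
  proof -
    have "Ck_on n W k (\<lambda>y. 3 / (2 * e\<^sup>2) * (\<Sum>i<n. (y i + (- p i)) * (y i + (- p i))) + (- 1))"
      by (intro Ck_on_add[OF W] Ck_on_mult[OF W] Ck_on_const[OF W] Ck_on_sum[OF W] Ck_on_coord[OF W]) simp
    moreover have "(\<lambda>y. 3 / (2 * e\<^sup>2) * (\<Sum>i<n. (y i + (- p i)) * (y i + (- p i))) + (- 1)) = u"
      by (simp add: fun_eq_iff u_def power2_eq_square)
    ultimately have "Ck_on n W k u" by simp
    then show ?thesis unfolding \<beta>_def[abs_def]
      by (intro Ck_on_add[OF W] Ck_on_mult[OF W] Ck_on_const[OF W] Ck_on_real_compose[where \<sigma> = flat, OF W DERIV_flat])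
  qed
  moreover have "\<beta> y = 1" if y: "y \<in> cube n p d" for y
  proof -
    have "(y i - p i)\<^sup>2 \<le> d\<^sup>2" if "i < n" for i
      using y that abs_le_square_iff[of "y i - p i" d] by (auto simp: cube_def)
    then have "(\<Sum>i<n. (y i - p i)\<^sup>2) \<le> real n * d\<^sup>2" using sum_mono[of "{..<n}" "\<lambda>i. (y i - p i)\<^sup>2" "\<lambda>i. d\<^sup>2"] by simp
    also have "\<dots> \<le> 2 * e\<^sup>2 / 3"
    proof -
      have a: "real n * d\<^sup>2 = e\<^sup>2 * (real n / (4 * (real n + 1)\<^sup>2))"
        unfolding d_def power_divide power_mult_distrib by simp
      have "real n * 3 \<le> 8 * (real n + 1)\<^sup>2" by (simp add: power2_eq_square algebra_simps)
      then have "real n / (4 * (real n + 1)\<^sup>2) \<le> 2 / 3" by (simp add: divide_simps)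
      from mult_left_mono[OF this, of "e\<^sup>2"] show ?thesis unfolding a by simp
    qed
    finally have "3 / (2 * e\<^sup>2) * (\<Sum>i<n. (y i - p i)\<^sup>2) \<le> 3 / (2 * e\<^sup>2) * (2 * e\<^sup>2 / 3)"
      using e by (intro mult_left_mono) auto
    also have "\<dots> = 1" using e by simp
    finally have "u y \<le> 0" by (simp add: u_def)
    then show ?thesis using c by (simp add: \<beta>_def flat_0[of "u y"] C_def[symmetric])
  qed
  moreover have "\<beta> y = 0" if y: "\<forall>i\<ge>n. y i = 0" "y \<notin> cube n p e" for y
  proof -
    obtain i where i: "i < n" "e \<le> \<bar>y i - p i\<bar>" using y by (fastforce simp: cube_def)
    have "e\<^sup>2 \<le> (y i - p i)\<^sup>2" using i e abs_le_square_iff[of e "y i - p i"] by simp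
    also have "\<dots> \<le> (\<Sum>i<n. (y i - p i)\<^sup>2)" using i by (intro member_le_sum) auto
    finally have "3 / (2 * e\<^sup>2) * e\<^sup>2 \<le> 3 / (2 * e\<^sup>2) * (\<Sum>i<n. (y i - p i)\<^sup>2)" using e by (intro mult_left_mono) auto
    moreover have "3 / (2 * e\<^sup>2) * e\<^sup>2 = 3 / 2" using e by simp
    ultimately have uy: "u y \<ge> 1 / 2" by (simp add: u_def)
    then have "1 / u y \<le> 1 / (1 / 2)" by (intro divide_left_mono) auto
    then have "c \<le> flat 0 (u y)" using uy by (simp add: c_def flat_0)
    then show ?thesis by (simp add: \<beta>_def flat_0[of "c - flat 0 (u y)"])
  qed
  ultimately show ?thesis using that[of d \<beta>] e by (simp add: d_def)
qed

section \<open>Infinitely differentiable functions in coordinates\<close>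

lemma smooth_onD: "smooth_on n W F \<Longrightarrow> Ck_on n W k F"
  by (simp add: smooth_on_def)

lemma smooth_on_cong:
  "openE n W \<Longrightarrow> (\<And>y. y \<in> W \<Longrightarrow> F y = G y) \<Longrightarrow> smooth_on n W F \<Longrightarrow> smooth_on n W G"
  unfolding smooth_on_def using Ck_on_cong by metis

lemma smooth_on_local:
  assumes "openE n W" "\<And>x. x \<in> W \<Longrightarrow> \<exists>W'. openE n W' \<and> x \<in> W' \<and> smooth_on n W' F"
  shows "smooth_on n W F"
  unfolding smooth_on_def
proof
  fix k
  show "Ck_on n W k F" by (rule Ck_on_local[OF assms(1)]) (meson assms(2) smooth_onD)
qed

lemma smooth_on_subset:
  "openE n W \<Longrightarrow> openE n V \<Longrightarrow> V \<subseteq> W \<Longrightarrow> smooth_on n W F \<Longrightarrow> smooth_on n V F"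
  unfolding smooth_on_def using Ck_on_subset by metis

lemma smooth_on_const: "openE n W \<Longrightarrow> smooth_on n W (\<lambda>x. c)"
  and smooth_on_coord: "openE n W \<Longrightarrow> smooth_on n W (\<lambda>x. x i)"
  and smooth_on_add: "openE n W \<Longrightarrow> smooth_on n W F \<Longrightarrow> smooth_on n W G \<Longrightarrow> smooth_on n W (\<lambda>x. F x + G x)"
  and smooth_on_mult: "openE n W \<Longrightarrow> smooth_on n W F \<Longrightarrow> smooth_on n W G \<Longrightarrow> smooth_on n W (\<lambda>x. F x * G x)"
  unfolding smooth_on_def by (simp_all add: Ck_on_const Ck_on_coord Ck_on_add Ck_on_mult)

lemma smooth_on_sum:
  "openE n W \<Longrightarrow> finite A \<Longrightarrow> (\<And>j. j \<in> A \<Longrightarrow> smooth_on n W (F j)) \<Longrightarrow> smooth_on n W (\<lambda>x. \<Sum>j\<in>A. F j x)"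
  unfolding smooth_on_def by (simp add: Ck_on_sum)

lemma smooth_on_pd: "openE n W \<Longrightarrow> smooth_on n W F \<Longrightarrow> i < n \<Longrightarrow> smooth_on n W (pd i F)"
  unfolding smooth_on_def using Ck_on_pd by metis

lemma smooth_on_has_pd:
  "openE n W \<Longrightarrow> smooth_on n W F \<Longrightarrow> i < n \<Longrightarrow> x \<in> W \<Longrightarrow>
    ((\<lambda>t. F (x(i := t))) has_real_derivative pd i F x) (at (x i))"
  using has_pd smooth_onD by metis

lemma pd_add:
  assumes "openE n W" "smooth_on n W F" "smooth_on n W G" "i < n" "x \<in> W"
  shows "pd i (\<lambda>y. F y + G y) x = pd i F x + pd i G x"
  by (rule pd_eqI) (intro DERIV_add smooth_on_has_pd[OF assms(1) _ assms(4,5)] assms(2,3))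

lemma pd_mult:
  assumes "openE n W" "smooth_on n W F" "smooth_on n W G" "i < n" "x \<in> W"
  shows "pd i (\<lambda>y. F y * G y) x = pd i F x * G x + F x * pd i G x"
proof (rule pd_eqI)
  show "((\<lambda>t. F (x(i := t)) * G (x(i := t))) has_real_derivative pd i F x * G x + F x * pd i G x) (at (x i))"
    using DERIV_mult[OF smooth_on_has_pd[OF assms(1,2,4,5)] smooth_on_has_pd[OF assms(1,3,4,5)]]
    by (simp only: fun_upd_triv mult.commute[of "pd i G x"])
qed

lemma pd_const: "pd i (\<lambda>y. c) x = 0"
  by (rule pd_eqI) simp

lemma smooth_on_compose:
  assumes "openE n W" "openE m V" "\<And>x. x \<in> W \<Longrightarrow> \<Phi> x \<in> V" "smooth_on m V F"
    "\<And>j. j < m \<Longrightarrow> smooth_on n W (\<lambda>x. \<Phi> x j)"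
  shows "smooth_on n W (\<lambda>x. F (\<Phi> x))"
  unfolding smooth_on_def
proof
  fix k
  show "Ck_on n W k (\<lambda>x. F (\<Phi> x))"
    by (rule Ck_on_compose[OF assms(1,2,3) smooth_onD[OF assms(4)] smooth_onD[OF assms(5)]])
qed

section \<open>Charts and smooth functions\<close>

abbreviation rep :: "'a set \<Rightarrow> ('a \<Rightarrow> nat \<Rightarrow> real) \<Rightarrow> ('a \<Rightarrow> real) \<Rightarrow> (nat \<Rightarrow> real) \<Rightarrow> real" where
  "rep U \<phi> f \<equiv> \<lambda>y. f (inv_into U \<phi> y)"

lemma chart_cover: assumes "smooth_manifold M" shows "\<exists>U \<phi>. (U, \<phi>) \<in> charts M \<and> x \<in> U"
proof -
  have "x \<in> (\<Union>(U, \<phi>)\<in>charts M. U)" using conjunct1[OF assms[unfolded smooth_manifold_def]] by (simp only: UNIV_I)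
  then show ?thesis by auto
qed

lemma
  assumes M: "smooth_manifold M" and c: "(U, \<phi>) \<in> charts M"
  shows chart_open: "open U" and chart_image: "openE (mdim M) (\<phi> ` U)"
    and chart_homeo: "homeomorphic_map (top_of_set U) (subtopology (Euclidean_space (mdim M)) (\<phi> ` U)) \<phi>"
    and transition_smooth: "(V, \<psi>) \<in> charts M \<Longrightarrow> i < mdim M \<Longrightarrow>
      smooth_on (mdim M) (\<phi> ` (U \<inter> V)) (\<lambda>y. \<psi> (inv_into U \<phi> y) i)"
proof -
  note 1 = conjunct2[OF M[unfolded smooth_manifold_def]]
  from bspec[OF conjunct1[OF 1] c] show "open U" "openE (mdim M) (\<phi> ` U)"
    "homeomorphic_map (top_of_set U) (subtopology (Euclidean_space (mdim M)) (\<phi> ` U)) \<phi>" by simp_all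
  assume V: "(V, \<psi>) \<in> charts M" "i < mdim M"
  from bspec[OF bspec[OF conjunct2[OF 1] c, simplified] V(1)] V(2)
  show "smooth_on (mdim M) (\<phi> ` (U \<inter> V)) (\<lambda>y. \<psi> (inv_into U \<phi> y) i)" by simp
qed

lemma subtopology_openE: "openE n W \<Longrightarrow> subtopology (Euclidean_space n) W = top_of_set W"
proof -
  assume W: "openE n W"
  then have "{x. \<forall>i\<ge>n. x i = 0} \<inter> W = W" using openE_zero by blast
  then show ?thesis by (simp add: Euclidean_space_eq subtopology_subtopology)
qed

lemma chart_inj: "smooth_manifold M \<Longrightarrow> (U, \<phi>) \<in> charts M \<Longrightarrow> inj_on \<phi> U"
  using homeomorphic_imp_injective_map[OF chart_homeo] by simp

lemma chart_inv: "smooth_manifold M \<Longrightarrow> (U, \<phi>) \<in> charts M \<Longrightarrow> x \<in> U \<Longrightarrow> inv_into U \<phi> (\<phi> x) = x"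
  by (rule inv_into_f_f[OF chart_inj])

lemma chart_homeomorphism:
  assumes M: "smooth_manifold M" and c: "(U, \<phi>) \<in> charts M"
  shows "homeomorphism U (\<phi> ` U) \<phi> (inv_into U \<phi>)"
proof -
  obtain g where g: "homeomorphic_maps (top_of_set U) (top_of_set (\<phi> ` U)) \<phi> g"
    using chart_homeo[OF M c] unfolding homeomorphic_map_maps subtopology_openE[OF chart_image[OF M c]] by blast
  then have c: "continuous_on U \<phi>" "continuous_on (\<phi> ` U) g" and inv: "\<And>x. x \<in> U \<Longrightarrow> g (\<phi> x) = x"
    unfolding homeomorphic_maps_def by (auto simp: continuous_map_in_subtopology)
  have "g y = inv_into U \<phi> y" if "y \<in> \<phi> ` U" for y
    using that inv chart_inv[OF M assms(2)] by auto
  then have "continuous_on (\<phi> ` U) (inv_into U \<phi>)" using c by (simp cong: continuous_on_cong)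
  then show ?thesis using c chart_inv[OF M assms(2)] by (simp add: homeomorphism_def image_image cong: image_cong_simp)
qed

lemma chart_openE:
  assumes M: "smooth_manifold M" and c: "(U, \<phi>) \<in> charts M" and W: "open W" "W \<subseteq> U"
  shows "openE (mdim M) (\<phi> ` W)"
proof -
  have "openin (top_of_set U) W" using W by (auto simp: openin_open)
  then have "openin (subtopology (Euclidean_space (mdim M)) (\<phi> ` U)) (\<phi> ` W)"
    using homeomorphic_map_openness[OF chart_homeo[OF M c], of W] W by simp
  then show ?thesis using chart_image[OF M c] openin_trans_full by blast
qed

lemma chart_preimage_open:
  assumes M: "smooth_manifold M" and c: "(U, \<phi>) \<in> charts M" and V: "openE (mdim M) V"
  shows "open (U \<inter> \<phi> -` V)"
proof -
  obtain T where T: "open T" "V = {x. \<forall>i\<ge>mdim M. x i = 0} \<inter> T" using V unfolding openE_open by blast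
  have "\<phi> x \<in> {x. \<forall>i\<ge>mdim M. x i = 0}" if "x \<in> U" for x
    using openE_zero[OF chart_image[OF M c]] that by auto
  then have "U \<inter> \<phi> -` V = U \<inter> \<phi> -` T" using T by auto
  moreover have "continuous_on U \<phi>" using chart_homeomorphism[OF M c] by (simp add: homeomorphism_def)
  then have "open (U \<inter> \<phi> -` T)" using chart_open[OF M c] T(1) continuous_on_open_vimage[of U \<phi>] by (auto simp: Int_commute)
  ultimately show ?thesis by simp
qed

lemma chart_zero: "smooth_manifold M \<Longrightarrow> (U, \<phi>) \<in> charts M \<Longrightarrow> x \<in> U \<Longrightarrow> mdim M \<le> i \<Longrightarrow> \<phi> x i = 0"
  using openE_zero[OF chart_image] by blast

section \<open>The algebra of smooth functions on a manifold\<close>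

lemma C_infD: "f \<in> C_inf M \<Longrightarrow> (U, \<phi>) \<in> charts M \<Longrightarrow> smooth_on (mdim M) (\<phi> ` U) (rep U \<phi> f)"
  unfolding C_inf_def by blast

lemma C_infI: "(\<And>U \<phi>. (U, \<phi>) \<in> charts M \<Longrightarrow> smooth_on (mdim M) (\<phi> ` U) (rep U \<phi> f)) \<Longrightarrow> f \<in> C_inf M"
  unfolding C_inf_def by blast

lemma C_inf_const: "smooth_manifold M \<Longrightarrow> (\<lambda>x. c) \<in> C_inf M"
  by (rule C_infI) (rule smooth_on_const[OF chart_image])

lemma C_inf_add: "smooth_manifold M \<Longrightarrow> f \<in> C_inf M \<Longrightarrow> g \<in> C_inf M \<Longrightarrow> (\<lambda>x. f x + g x) \<in> C_inf M"
  by (rule C_infI) (rule smooth_on_add[OF chart_image C_infD C_infD])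

lemma C_inf_mult: "smooth_manifold M \<Longrightarrow> f \<in> C_inf M \<Longrightarrow> g \<in> C_inf M \<Longrightarrow> (\<lambda>x. f x * g x) \<in> C_inf M"
  by (rule C_infI) (rule smooth_on_mult[OF chart_image C_infD C_infD])

lemma C_inf_sum: "smooth_manifold M \<Longrightarrow> finite A \<Longrightarrow> (\<And>j. j \<in> A \<Longrightarrow> f j \<in> C_inf M) \<Longrightarrow> (\<lambda>x. \<Sum>j\<in>A. f j x) \<in> C_inf M"
  by (rule C_infI) (rule smooth_on_sum[OF chart_image _ C_infD])

lemma C_inf_cmult: "smooth_manifold M \<Longrightarrow> f \<in> C_inf M \<Longrightarrow> (\<lambda>x. c * f x) \<in> C_inf M"
  by (rule C_inf_mult[OF _ C_inf_const])

lemma C_inf_uminus: "smooth_manifold M \<Longrightarrow> f \<in> C_inf M \<Longrightarrow> (\<lambda>x. - f x) \<in> C_inf M"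
  using C_inf_cmult[of M f "-1"] by simp

lemma C_inf_diff: "smooth_manifold M \<Longrightarrow> f \<in> C_inf M \<Longrightarrow> g \<in> C_inf M \<Longrightarrow> (\<lambda>x. f x - g x) \<in> C_inf M"
  using C_inf_add[of M f "\<lambda>x. - g x"] C_inf_uminus[of M g] by simp

text \<open>Membership in \<open>C_inf M\<close> speaks of every chart of the atlas. Composition
  with the smooth transition maps reduces it to one chart around each point.\<close>

lemma C_inf_chartI:
  assumes M: "smooth_manifold M"
    and loc: "\<And>x. \<exists>U \<phi> W. (U, \<phi>) \<in> charts M \<and> open W \<and> x \<in> W \<and> W \<subseteq> U \<and> smooth_on (mdim M) (\<phi> ` W) (rep U \<phi> f)"
  shows "f \<in> C_inf M"
proof (rule C_infI)
  fix V \<psi> assume c: "(V, \<psi>) \<in> charts M"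
  show "smooth_on (mdim M) (\<psi> ` V) (rep V \<psi> f)"
  proof (rule smooth_on_local[OF chart_image[OF M c]])
    fix y assume "y \<in> \<psi> ` V"
    then obtain x where x: "x \<in> V" "y = \<psi> x" by blast
    obtain U \<phi> W where U: "(U, \<phi>) \<in> charts M" and W: "open W" "x \<in> W" "W \<subseteq> U"
      and f: "smooth_on (mdim M) (\<phi> ` W) (rep U \<phi> f)" using loc[of x] by blast
    have oW: "open (V \<inter> W)" using W chart_open[OF M c] by auto
    note o1 = chart_openE[OF M c oW Int_lower1]
    have inv: "inv_into V \<psi> z \<in> V \<inter> W" if "z \<in> \<psi> ` (V \<inter> W)" for z
      using that chart_inv[OF M c] by auto
    have "smooth_on (mdim M) (\<psi> ` (V \<inter> W)) (\<lambda>z. rep U \<phi> f (\<phi> (inv_into V \<psi> z)))"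
    proof (rule smooth_on_compose[OF o1 chart_openE[OF M U W(1,3)] _ f])
      show "\<phi> (inv_into V \<psi> z) \<in> \<phi> ` W" if "z \<in> \<psi> ` (V \<inter> W)" for z using inv[OF that] by blast
      fix j assume j: "j < mdim M"
      have "open (V \<inter> U)" using chart_open[OF M c] chart_open[OF M U] by auto
      from chart_openE[OF M c this Int_lower1] o1 _ transition_smooth[OF M c U j]
      show "smooth_on (mdim M) (\<psi> ` (V \<inter> W)) (\<lambda>z. \<phi> (inv_into V \<psi> z) j)"
        by (rule smooth_on_subset) (use W(3) in blast)
    qed
    then have "smooth_on (mdim M) (\<psi> ` (V \<inter> W)) (rep V \<psi> f)"
    proof (rule smooth_on_cong[OF o1, rotated])
      fix z assume "z \<in> \<psi> ` (V \<inter> W)"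
      then have "inv_into V \<psi> z \<in> U" using inv W(3) by blast
      then show "rep U \<phi> f (\<phi> (inv_into V \<psi> z)) = rep V \<psi> f z" by (simp add: chart_inv[OF M U])
    qed
    moreover have "y \<in> \<psi> ` (V \<inter> W)" using x W by blast
    ultimately show "\<exists>W'. openE (mdim M) W' \<and> y \<in> W' \<and> smooth_on (mdim M) W' (rep V \<psi> f)"
      using o1 by (intro exI conjI)
  qed
qed

lemma C_inf_rep_subset:
  assumes M: "smooth_manifold M" and c: "(U, \<phi>) \<in> charts M" and W: "open W" "W \<subseteq> U" and f: "f \<in> C_inf M"
  shows "smooth_on (mdim M) (\<phi> ` W) (rep U \<phi> f)"
  by (rule smooth_on_subset[OF chart_image[OF M c] chart_openE[OF M c W] image_mono[OF W(2)] C_infD[OF f c]])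

lemma C_inf_local:
  assumes M: "smooth_manifold M"
    and loc: "\<And>x. \<exists>W h. open W \<and> x \<in> W \<and> h \<in> C_inf M \<and> (\<forall>y\<in>W. f y = h y)"
  shows "f \<in> C_inf M"
proof (rule C_inf_chartI[OF M])
  fix x
  obtain W h where W: "open W" "x \<in> W" and h: "h \<in> C_inf M" and eq: "\<And>y. y \<in> W \<Longrightarrow> f y = h y"
    using loc[of x] by blast
  obtain U \<phi> where U: "(U, \<phi>) \<in> charts M" "x \<in> U" using chart_cover[OF M] by blast
  have o: "open (U \<inter> W)" using W chart_open[OF M U(1)] by auto
  have "smooth_on (mdim M) (\<phi> ` (U \<inter> W)) (rep U \<phi> f)"
    by (rule smooth_on_cong[OF chart_openE[OF M U(1) o Int_lower1] _ C_inf_rep_subset[OF M U(1) o Int_lower1 h]])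
      (auto simp: eq chart_inv[OF M U(1)])
  then show "\<exists>U \<phi> W. (U, \<phi>) \<in> charts M \<and> open W \<and> x \<in> W \<and> W \<subseteq> U \<and> smooth_on (mdim M) (\<phi> ` W) (rep U \<phi> f)"
    using U W o by (intro exI[of _ U] exI[of _ \<phi>] exI[of _ "U \<inter> W"]) auto
qed

text \<open>The set \<open>C\<close> and the open complement of \<open>K\<close> cover the manifold,
  and on the latter \<open>h\<close> is zero. This is how functions known only in one chart become
  global.\<close>

lemma C_inf_extend:
  assumes M: "smooth_manifold M" and c: "(U, \<phi>) \<in> charts M" and C: "open C" "C \<subseteq> U" and K: "closed K" "K \<subseteq> C"
    and h: "smooth_on (mdim M) (\<phi> ` C) (rep U \<phi> h)" and z: "\<And>y. y \<notin> K \<Longrightarrow> h y = 0"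
  shows "h \<in> C_inf M"
proof (rule C_inf_chartI[OF M])
  fix x
  show "\<exists>U \<phi> W. (U, \<phi>) \<in> charts M \<and> open W \<and> x \<in> W \<and> W \<subseteq> U \<and> smooth_on (mdim M) (\<phi> ` W) (rep U \<phi> h)"
  proof (cases "x \<in> C")
    case True
    then show ?thesis using c C h by blast
  next
    case False
    obtain V \<psi> where V: "(V, \<psi>) \<in> charts M" "x \<in> V" using chart_cover[OF M] by blast
    have o: "open (V - K)" using chart_open[OF M V(1)] K by auto
    have "smooth_on (mdim M) (\<psi> ` (V - K)) (rep V \<psi> h)"
      by (rule smooth_on_cong[OF chart_openE[OF M V(1) o Diff_subset] _ smooth_on_const[OF chart_openE[OF M V(1) o Diff_subset], of 0]])
        (auto simp: z chart_inv[OF M V(1)])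
    then show ?thesis using V o False K by (intro exI[of _ V] exI[of _ \<psi>] exI[of _ "V - K"]) auto
  qed
qed

text \<open>Tychonoff's theorem for closed intervals in the first \<open>n\<close> coordinates and
  singletons \<open>{0}\<close> in all others.\<close>

lemma compact_closed_cube:
  fixes p :: "nat \<Rightarrow> real"
  shows "compact {y. (\<forall>i\<ge>n. y i = 0) \<and> (\<forall>i<n. \<bar>y i - p i\<bar> \<le> e)}"
proof -
  have "compactin (product_topology (\<lambda>i::nat. euclideanreal) UNIV) (\<Pi>\<^sub>E i\<in>UNIV. if i < n then {p i - e .. p i + e} else {0})"
    by (subst compactin_PiE) auto
  moreover have "(\<Pi>\<^sub>E i\<in>UNIV. if i < n then {p i - e .. p i + e} else {0::real})
      = {y. (\<forall>i\<ge>n. y i = 0) \<and> (\<forall>i<n. \<bar>y i - p i\<bar> \<le> e)}" (is "?A = ?B")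
  proof -
    have i: "y i \<in> (if i < n then {p i - e .. p i + e} else {0::real}) \<longleftrightarrow>
        (n \<le> i \<longrightarrow> y i = 0) \<and> (i < n \<longrightarrow> \<bar>y i - p i\<bar> \<le> e)" for i y
      by (cases "i < n") (simp_all, linarith)
    have "y \<in> ?A \<longleftrightarrow> y \<in> ?B" for y
      unfolding PiE_UNIV_domain Pi_iff mem_Collect_eq i by blast
    then show ?thesis by blast
  qed
  ultimately show ?thesis by (simp add: euclidean_product_topology)
qed

text \<open>The support lies in the image of a closed cube under the inverse chart: it is compact,
  hence closed by the Hausdorff property, as extension by zero demands. The radius
  \<open>e / 2\<close> keeps the closed cube inside the open one of radius \<open>e\<close>.\<close>

lemma manifold_bump:
  assumes M: "smooth_manifold M" and c: "(U, \<phi>) \<in> charts M" and p: "p \<in> U" and W: "open W" "p \<in> W"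
  obtains \<kappa> N K where "\<kappa> \<in> C_inf M" "open N" "p \<in> N" "N \<subseteq> K" "closed K" "K \<subseteq> U \<inter> W"
    "\<And>y. y \<in> N \<Longrightarrow> \<kappa> y = 1" "\<And>y. y \<notin> K \<Longrightarrow> \<kappa> y = 0"
proof -
  let ?n = "mdim M"
  have o: "open (U \<inter> W)" using W chart_open[OF M c] by auto
  note oE = chart_openE[OF M c o Int_lower1]
  note z = chart_zero[OF M c p]
  have "\<phi> p \<in> \<phi> ` (U \<inter> W)" using p W by blast
  from openE_contains_cube[OF oE this] obtain e where e: "e > 0" "cube ?n (\<phi> p) e \<subseteq> \<phi> ` (U \<inter> W)" .
  obtain \<beta> d where d: "0 < d" and \<beta>: "\<And>W k. openE ?n W \<Longrightarrow> Ck_on ?n W k \<beta>"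
      "\<And>y. y \<in> cube ?n (\<phi> p) d \<Longrightarrow> \<beta> y = 1"
      "\<And>y. \<forall>i\<ge>?n. y i = 0 \<Longrightarrow> y \<notin> cube ?n (\<phi> p) (e / 2) \<Longrightarrow> \<beta> y = 0"
    by (rule smooth_bump[of ?n "\<phi> p" "e / 2", OF z half_gt_zero[OF e(1)]]) (assumption, rule that)
  define B where "B = {y. (\<forall>i\<ge>?n. y i = 0) \<and> (\<forall>i<?n. \<bar>y i - \<phi> p i\<bar> \<le> e / 2)}"
  have B: "B \<subseteq> \<phi> ` (U \<inter> W)" using e by (force simp: B_def cube_def)
  define K where "K = inv_into U \<phi> ` B"
  have "continuous_on B (inv_into U \<phi>)"
    by (rule continuous_on_subset[OF homeomorphism_cont2[OF chart_homeomorphism[OF M c]]]) (use B in blast)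
  then have "compact K" unfolding K_def B_def by (intro compact_continuous_image compact_closed_cube)
  then have K: "closed K" by (rule compact_imp_closed)
  have KU: "K \<subseteq> U \<inter> W" unfolding K_def using B chart_inv[OF M c] by auto
  define \<kappa> where "\<kappa> y = (if y \<in> U then \<beta> (\<phi> y) else 0)" for y
  have \<kappa>0: "\<kappa> y = 0" if "y \<notin> K" for y
  proof (cases "y \<in> U")
    case True
    have "\<phi> y \<notin> B" using that chart_inv[OF M c True] by (metis K_def image_eqI)
    then have "\<phi> y \<notin> cube ?n (\<phi> p) (e / 2)" by (force simp: B_def cube_def)
    then show ?thesis using \<beta>(3) chart_zero[OF M c True] True by (simp add: \<kappa>_def)
  qed (simp add: \<kappa>_def)
  have "smooth_on ?n (\<phi> ` U) \<beta>" unfolding smooth_on_def using \<beta>(1)[OF chart_image[OF M c]] by blast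
  then have "smooth_on ?n (\<phi> ` U) (rep U \<phi> \<kappa>)"
    by (rule smooth_on_cong[OF chart_image[OF M c], rotated]) (auto simp: \<kappa>_def chart_inv[OF M c])
  then have "\<kappa> \<in> C_inf M"
    using \<kappa>0 KU by (intro C_inf_extend[OF M c chart_open[OF M c] order_refl K]) auto
  \<comment> \<open>The bound \<open>d\<close> gives the value 1 on \<open>N\<close>, and
    \<open>e / 2\<close> gives \<open>N \<subseteq> K\<close>.\<close>
  moreover define N where "N = U \<inter> \<phi> -` cube ?n (\<phi> p) (min d (e / 2))"
  have "open N" unfolding N_def by (rule chart_preimage_open[OF M c openE_cube])
  moreover have "p \<in> N" unfolding N_def using p cube_self[OF z] d e by auto
  moreover have "N \<subseteq> K"
  proof
    fix y assume y: "y \<in> N"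
    then have "\<phi> y \<in> B" by (auto simp: N_def B_def cube_def)
    then show "y \<in> K" unfolding K_def using y chart_inv[OF M c, of y] by (auto simp: N_def image_iff intro!: bexI[of _ "\<phi> y"])
  qed
  moreover have "\<kappa> y = 1" if "y \<in> N" for y
    using that \<beta>(2)[of "\<phi> y"] by (auto simp: N_def \<kappa>_def cube_def)
  ultimately show ?thesis using K KU \<kappa>0 by (intro that)
qed

section \<open>Tangent vectors and local frames\<close>

lemma tangent_linear:
  "v \<in> tangent M x \<Longrightarrow> f \<in> C_inf M \<Longrightarrow> g \<in> C_inf M \<Longrightarrow> v (\<lambda>y. a * f y + b * g y) = a * v f + b * v g"
  unfolding tangent_def by blast

lemma tangent_mult:
  "v \<in> tangent M x \<Longrightarrow> f \<in> C_inf M \<Longrightarrow> g \<in> C_inf M \<Longrightarrow> v (\<lambda>y. f y * g y) = v f * g x + f x * v g"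
  unfolding tangent_def by blast

lemma tangent_outside: "v \<in> tangent M x \<Longrightarrow> f \<notin> C_inf M \<Longrightarrow> v f = 0"
  unfolding tangent_def by blast

lemma tangentI:
  assumes "\<And>f g a b. f \<in> C_inf M \<Longrightarrow> g \<in> C_inf M \<Longrightarrow> v (\<lambda>y. a * f y + b * g y) = a * v f + b * v g"
    and "\<And>f g. f \<in> C_inf M \<Longrightarrow> g \<in> C_inf M \<Longrightarrow> v (\<lambda>y. f y * g y) = v f * g x + f x * v g"
    and "\<And>f. f \<notin> C_inf M \<Longrightarrow> v f = 0"
  shows "v \<in> tangent M x"
  unfolding tangent_def using assms by blast

lemma tangent_add: "v \<in> tangent M x \<Longrightarrow> f \<in> C_inf M \<Longrightarrow> g \<in> C_inf M \<Longrightarrow> v (\<lambda>y. f y + g y) = v f + v g"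
  using tangent_linear[of v M x f g 1 1] by simp

lemma tangent_diff: "v \<in> tangent M x \<Longrightarrow> f \<in> C_inf M \<Longrightarrow> g \<in> C_inf M \<Longrightarrow> v (\<lambda>y. f y - g y) = v f - v g"
  using tangent_linear[of v M x f g 1 "-1"] by simp

lemma tangent_cmult: "v \<in> tangent M x \<Longrightarrow> f \<in> C_inf M \<Longrightarrow> v (\<lambda>y. c * f y) = c * v f"
  using tangent_linear[of v M x f f c 0] by simp

lemma tangent_zero: assumes M: "smooth_manifold M" and v: "v \<in> tangent M x" shows "v (\<lambda>y. 0) = 0"
  using tangent_linear[OF v C_inf_const[OF M, of 0] C_inf_const[OF M, of 0], of 0 0] by simp

lemma tangent_const: assumes M: "smooth_manifold M" and v: "v \<in> tangent M x" shows "v (\<lambda>y. c) = 0"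
proof -
  have "v (\<lambda>y. 1) = 0" using tangent_mult[OF v C_inf_const[OF M, of 1] C_inf_const[OF M, of 1]] by simp
  then show ?thesis using tangent_cmult[OF v C_inf_const[OF M, of 1], of c] by simp
qed

lemma tangent_sum:
  assumes M: "smooth_manifold M" and v: "v \<in> tangent M x"
  shows "finite A \<Longrightarrow> (\<And>j. j \<in> A \<Longrightarrow> f j \<in> C_inf M) \<Longrightarrow> v (\<lambda>y. \<Sum>j\<in>A. f j y) = (\<Sum>j\<in>A. v (f j))"
proof (induction A rule: finite_induct)
  case empty then show ?case using tangent_zero[OF M v] by simp
next
  case (insert a A)
  have "v (\<lambda>y. f a y + (\<Sum>j\<in>A. f j y)) = v (f a) + v (\<lambda>y. \<Sum>j\<in>A. f j y)"
    using insert by (intro tangent_add[OF v] C_inf_sum[OF M]) auto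
  then show ?case using insert by simp
qed

text \<open>For a bump \<open>\<kappa>\<close> at \<open>x\<close> supported in \<open>W\<close> the
  function \<open>\<kappa> (f - g)\<close> is zero. The product rule at \<open>x\<close>, where
  \<open>\<kappa>\<close> is 1 and \<open>f - g\<close> is 0, turns this into
  \<open>v f - v g = 0\<close>.\<close>

lemma tangent_local:
  assumes M: "smooth_manifold M" and v: "v \<in> tangent M x" and f: "f \<in> C_inf M" and g: "g \<in> C_inf M"
    and W: "open W" "x \<in> W" and eq: "\<And>y. y \<in> W \<Longrightarrow> f y = g y"
  shows "v f = v g"
proof -
  obtain U \<phi> where U: "(U, \<phi>) \<in> charts M" "x \<in> U" using chart_cover[OF M] by blast
  obtain \<kappa> N K where k: "\<kappa> \<in> C_inf M" "x \<in> N" "K \<subseteq> U \<inter> W" "\<And>y. y \<in> N \<Longrightarrow> \<kappa> y = 1" "\<And>y. y \<notin> K \<Longrightarrow> \<kappa> y = 0"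
    by (rule manifold_bump[OF M U W]) (rule that)
  have "(\<lambda>y. \<kappa> y * (f y - g y)) = (\<lambda>y. 0)" using k(3,5) eq by (fastforce simp: fun_eq_iff)
  then have "0 = v \<kappa> * (f x - g x) + \<kappa> x * (v f - v g)"
    using tangent_mult[OF v k(1) C_inf_diff[OF M f g]] tangent_zero[OF M v] tangent_diff[OF v f g] by simp
  then show ?thesis using k(2,4) eq W by simp
qed

lemma tangent_lincomb:
  assumes "u \<in> tangent M x" "v \<in> tangent M x"
  shows "(\<lambda>f. a * u f + b * v f) \<in> tangent M x"
  by (rule tangentI)
    (simp_all add: tangent_linear[OF assms(1)] tangent_linear[OF assms(2)] tangent_mult[OF assms(1)]
      tangent_mult[OF assms(2)] tangent_outside[OF assms(1)] tangent_outside[OF assms(2)] algebra_simps)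

lemma zero_in_tangent: "(\<lambda>f. 0) \<in> tangent M x"
  by (rule tangentI) simp_all

lemma tangent_sum_vectors:
  "finite A \<Longrightarrow> (\<And>i. i \<in> A \<Longrightarrow> u i \<in> tangent M x) \<Longrightarrow> (\<lambda>f. \<Sum>i\<in>A. c i * u i f) \<in> tangent M x"
proof (induction A rule: finite_induct)
  case empty then show ?case by (simp add: zero_in_tangent)
next
  case (insert a A)
  then show ?case using tangent_lincomb[of "u a" M x "\<lambda>f. \<Sum>i\<in>A. c i * u i f" "c a" 1] by simp
qed

section \<open>Vector fields and local frames\<close>

lemma vector_field_tangent: "vector_field M X \<Longrightarrow> X x \<in> tangent M x"
  and vector_field_smooth: "vector_field M X \<Longrightarrow> f \<in> C_inf M \<Longrightarrow> (\<lambda>x. X x f) \<in> C_inf M"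
  unfolding vector_field_def by blast+

lemma vector_field_scale:
  assumes M: "smooth_manifold M" and h: "h \<in> C_inf M" and X: "vector_field M X"
  shows "vector_field M (\<lambda>y f. h y * X y f)"
  unfolding vector_field_def
proof (intro conjI allI ballI)
  fix y show "(\<lambda>f. h y * X y f) \<in> tangent M y"
    using tangent_lincomb[OF vector_field_tangent[OF X, of y] vector_field_tangent[OF X, of y], of "h y" 0] by simp
next
  fix f assume "f \<in> C_inf M"
  then show "(\<lambda>y. h y * X y f) \<in> C_inf M" using C_inf_mult[OF M h] vector_field_smooth[OF X] by blast
qed

text \<open>Coordinates and coordinate fields are cut off by one and the same bump to become global.
  The expansion of \<open>v\<close> comes from Hadamard's lemma centred at \<open>q\<close> rather
  than \<open>p\<close>: near \<open>q\<close>, \<open>f\<close> is \<open>f q\<close> plus a sum of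
  \<open>(\<xi> j - \<xi> j q) * g j\<close>, and of each product a derivation at \<open>q\<close>
  sees only \<open>v (\<xi> j) * g j q\<close>.\<close>

lemma chart_frame:
  assumes M: "smooth_manifold M" and c: "(U, \<phi>) \<in> charts M" and p: "p \<in> U"
  obtains \<xi> E N where "open N" "p \<in> N" "N \<subseteq> U"
    "\<And>i. i < mdim M \<Longrightarrow> \<xi> i \<in> C_inf M" "\<And>i. i < mdim M \<Longrightarrow> vector_field M (E i)"
    "\<And>i q f. i < mdim M \<Longrightarrow> q \<in> N \<Longrightarrow> f \<in> C_inf M \<Longrightarrow> E i q f = pd i (rep U \<phi> f) (\<phi> q)"
    "\<And>q v f. q \<in> N \<Longrightarrow> v \<in> tangent M q \<Longrightarrow> v f = (\<Sum>i<mdim M. v (\<xi> i) * E i q f)"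
proof -
  let ?n = "mdim M"
  note oU = chart_image[OF M c]
  obtain \<kappa> N K where k: "\<kappa> \<in> C_inf M" "open N" "p \<in> N" "N \<subseteq> K" "closed K" "K \<subseteq> U \<inter> U"
      "\<And>y. y \<in> N \<Longrightarrow> \<kappa> y = 1" "\<And>y. y \<notin> K \<Longrightarrow> \<kappa> y = 0"
    by (rule manifold_bump[OF M c p chart_open[OF M c] p]) (rule that)
  have KU: "K \<subseteq> U" and NU: "N \<subseteq> U" using k by auto
  have cut: "(\<lambda>y. \<kappa> y * h y) \<in> C_inf M" if h: "smooth_on ?n (\<phi> ` U) (rep U \<phi> h)" for h
    by (rule C_inf_extend[OF M c chart_open[OF M c] order_refl k(5) KU])
      (use k(8) in \<open>auto intro: smooth_on_mult[OF oU C_infD[OF k(1) c] h]\<close>)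
  define \<xi> where "\<xi> i y = \<kappa> y * \<phi> y i" for i y
  have \<xi>: "\<xi> i \<in> C_inf M" for i
    unfolding \<xi>_def[abs_def]
    by (rule cut, rule smooth_on_cong[OF oU _ smooth_on_coord[OF oU, of i]]) (auto simp: chart_inv[OF M c])
  \<comment> \<open>The value 0 off \<open>C_inf M\<close> is the extensionality that
    \<open>tangent\<close> demands; it also makes the expansion below hold for nonsmooth
    \<open>f\<close>.\<close>
  define E where "E i y f = (if f \<in> C_inf M \<and> y \<in> U then \<kappa> y * pd i (rep U \<phi> f) (\<phi> y) else 0)" for i y f
  have E: "vector_field M (E i)" if i: "i < ?n" for i
    unfolding vector_field_def
  proof (intro conjI allI ballI)
    fix y
    show "E i y \<in> tangent M y"
    proof (cases "y \<in> U")
      case True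
      then have y: "\<phi> y \<in> \<phi> ` U" by blast
      show ?thesis
      proof (rule tangentI)
        fix f g a b assume f: "f \<in> C_inf M" and g: "g \<in> C_inf M"
        note sf = C_infD[OF f c] and sg = C_infD[OF g c]
        have cm: "pd i (\<lambda>y. a * rep U \<phi> h y) (\<phi> y) = a * pd i (rep U \<phi> h) (\<phi> y)" if "smooth_on ?n (\<phi> ` U) (rep U \<phi> h)" for a h
          using pd_mult[OF oU smooth_on_const[OF oU] that i y] by (simp add: pd_const)
        have "pd i (\<lambda>y. a * rep U \<phi> f y + b * rep U \<phi> g y) (\<phi> y) = a * pd i (rep U \<phi> f) (\<phi> y) + b * pd i (rep U \<phi> g) (\<phi> y)"
          using pd_add[OF oU smooth_on_mult[OF oU smooth_on_const[OF oU] sf] smooth_on_mult[OF oU smooth_on_const[OF oU] sg] i y]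
          unfolding cm[OF sf] cm[OF sg] .
        then show "E i y (\<lambda>y. a * f y + b * g y) = a * E i y f + b * E i y g"
          using f g C_inf_add[OF M C_inf_cmult[OF M f] C_inf_cmult[OF M g]] True by (simp add: E_def algebra_simps)
        show "E i y (\<lambda>y. f y * g y) = E i y f * g y + f y * E i y g"
          using pd_mult[OF oU sf sg i y] f g C_inf_mult[OF M f g] True by (simp add: E_def chart_inv[OF M c] algebra_simps)
      qed (simp add: E_def)
    next
      case False
      then have "E i y = (\<lambda>f. 0)" by (simp add: E_def fun_eq_iff)
      then show ?thesis by (simp add: zero_in_tangent)
    qed
  next
    fix f assume f: "f \<in> C_inf M"
    have "(\<lambda>y. \<kappa> y * pd i (rep U \<phi> f) (\<phi> y)) \<in> C_inf M"
      by (rule cut, rule smooth_on_cong[OF oU _ smooth_on_pd[OF oU C_infD[OF f c] i]]) (auto simp: chart_inv[OF M c])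
    moreover have "(\<lambda>y. \<kappa> y * pd i (rep U \<phi> f) (\<phi> y)) = (\<lambda>y. E i y f)"
      using f k(8) KU by (auto simp: E_def fun_eq_iff)
    ultimately show "(\<lambda>y. E i y f) \<in> C_inf M" by simp
  qed
  have Eq: "E i q f = pd i (rep U \<phi> f) (\<phi> q)" if "q \<in> N" "f \<in> C_inf M" for i q f
    using that k(7) NU by (auto simp: E_def)
  have exp: "v f = (\<Sum>i<?n. v (\<xi> i) * E i q f)" if q: "q \<in> N" and v: "v \<in> tangent M q" for q v f
  proof (cases "f \<in> C_inf M")
    case False
    then show ?thesis using tangent_outside[OF v] by (simp add: E_def)
  next
    case f: True
    have qU: "q \<in> U" using q NU by blast
    note oN = chart_openE[OF M c k(2) NU]
    note z = chart_zero[OF M c qU]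
    obtain e where e: "e > 0" "cube ?n (\<phi> q) e \<subseteq> \<phi> ` N"
      by (rule openE_contains_cube[OF oN imageI[OF q]])
    let ?C = "cube ?n (\<phi> q) e"
    define C where "C = U \<inter> \<phi> -` ?C"
    have C: "open C" "C \<subseteq> U" "q \<in> C" unfolding C_def
      using chart_preimage_open[OF M c openE_cube] qU cube_self[OF z e(1)] by auto
    have CN: "C \<subseteq> N"
    proof
      fix y assume y: "y \<in> C"
      then obtain y' where "y' \<in> N" "\<phi> y = \<phi> y'" using e by (auto simp: C_def)
      then show "y \<in> N" using chart_inj[OF M c] y NU by (auto simp: C_def inj_on_def)
    qed
    have imC: "\<phi> ` C = ?C" using e NU by (auto simp: C_def) blast
    define F where "F = rep U \<phi> f"
    have sF: "smooth_on ?n ?C F"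
      unfolding F_def using smooth_on_subset[OF oU openE_cube _ C_infD[OF f c], of "\<phi> q" e] imC C by blast
    define G where "G j = hadamard_quot (\<phi> q) j F" for j
    have sG: "smooth_on ?n ?C (G j)" if "j < ?n" for j
      unfolding smooth_on_def G_def using Ck_on_hadamard_quot[OF z e(1) that smooth_onD[OF sF]] by blast
    \<comment> \<open>The Hadamard quotients are smooth only on a cube around
      \<open>\<phi> q\<close>, which varies with \<open>q\<close>; hence a second bump.\<close>
    obtain \<mu> N' K' where m: "\<mu> \<in> C_inf M" "open N'" "q \<in> N'" "N' \<subseteq> K'" "closed K'" "K' \<subseteq> U \<inter> C"
      "\<And>y. y \<in> N' \<Longrightarrow> \<mu> y = 1" "\<And>y. y \<notin> K' \<Longrightarrow> \<mu> y = 0"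
      by (rule manifold_bump[OF M c qU C(1,3)]) (rule that)
    define g where "g j y = \<mu> y * G j (\<phi> y)" for j y
    have g: "g j \<in> C_inf M" if j: "j < ?n" for j
    proof (rule C_inf_extend[OF M c C(1,2) m(5)])
      show "K' \<subseteq> C" using m(6) by blast
      show "g j y = 0" if "y \<notin> K'" for y using m(8)[OF that] by (simp add: g_def)
      have "smooth_on ?n (\<phi> ` C) (\<lambda>y. rep U \<phi> \<mu> y * G j y)" unfolding imC
        using smooth_on_mult[OF openE_cube _ sG[OF j]] C_inf_rep_subset[OF M c C(1,2) m(1)] unfolding imC by blast
      then show "smooth_on ?n (\<phi> ` C) (rep U \<phi> (g j))"
        by (rule smooth_on_cong[OF chart_openE[OF M c C(1,2)], rotated])
          (use C(2) in \<open>auto simp: g_def chart_inv[OF M c] subset_eq\<close>)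
    qed
    have gq: "g j q = pd j F (\<phi> q)" for j
      using m(3,7) by (simp add: g_def G_def hadamard_quot_self)
    define f' where "f' y = (\<Sum>j<?n. (\<xi> j y - \<xi> j q) * g j y) + f q" for y
    have tm: "(\<lambda>y. (\<xi> j y - \<xi> j q) * g j y) \<in> C_inf M" if "j \<in> {..<?n}" for j
      using that by (intro C_inf_mult[OF M] C_inf_diff[OF M] C_inf_const[OF M] \<xi> g) simp
    have f': "f' \<in> C_inf M" unfolding f'_def[abs_def]
      by (intro C_inf_add[OF M C_inf_sum[OF M] C_inf_const[OF M]] tm) auto
    have "v f = v f'"
    proof (rule tangent_local[OF M v f f' m(2,3)])
      fix y assume y: "y \<in> N'"
      then have yC: "y \<in> C" "y \<in> U" "y \<in> N" using m CN by auto
      have yc: "\<phi> y \<in> ?C" using yC(1) unfolding C_def by blast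
      have "f y = F (\<phi> y)" using yC by (simp add: F_def chart_inv[OF M c])
      also have "\<dots> = F (\<phi> q) + (\<Sum>j<?n. (\<phi> y j - \<phi> q j) * hadamard_quot (\<phi> q) j F (\<phi> y))"
        by (rule hadamard[OF z e(1) smooth_onD[OF sF] yc])
      also have "\<dots> = f' y"
        using m(7)[OF y] k(7)[OF q] k(7)[OF yC(3)] by (simp add: f'_def \<xi>_def g_def G_def F_def chart_inv[OF M c qU])
      finally show "f y = f' y" .
    qed
    also have "v f' = v (\<lambda>y. \<Sum>j<?n. (\<xi> j y - \<xi> j q) * g j y) + v (\<lambda>y. f q)"
      unfolding f'_def[abs_def] by (rule tangent_add[OF v C_inf_sum[OF M finite_lessThan] C_inf_const[OF M]]) (rule tm)
    also have "\<dots> = v (\<lambda>y. \<Sum>j<?n. (\<xi> j y - \<xi> j q) * g j y)" by (simp add: tangent_const[OF M v])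
    also have "\<dots> = (\<Sum>j<?n. v (\<lambda>y. (\<xi> j y - \<xi> j q) * g j y))"
      by (rule tangent_sum[OF M v finite_lessThan]) (rule tm)
    also have "\<dots> = (\<Sum>j<?n. v (\<xi> j) * E j q f)"
    proof -
      have "v (\<lambda>y. (\<xi> j y - \<xi> j q) * g j y) = v (\<xi> j) * E j q f" if "j < ?n" for j
        using tangent_mult[OF v C_inf_diff[OF M \<xi> C_inf_const[OF M]] g[OF that], of j "\<xi> j q"]
          tangent_diff[OF v \<xi> C_inf_const[OF M], of j "\<xi> j q"] Eq[OF q f, of j]
        by (simp add: tangent_const[OF M v] gq F_def)
      then show ?thesis by simp
    qed
    finally show ?thesis .
  qed
  show ?thesis by (rule that[OF k(2,3) NU \<xi> E Eq exp])
qed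

lemma tangent_chart:
  assumes M: "smooth_manifold M" and U: "(U, \<phi>) \<in> charts M" "p \<in> U" and v: "v \<in> tangent M p"
  obtains c where "\<And>f. f \<in> C_inf M \<Longrightarrow> v f = (\<Sum>i<mdim M. c i * pd i (rep U \<phi> f) (\<phi> p))"
proof -
  obtain \<xi> E N where f: "p \<in> N"
    "\<And>i q f. i < mdim M \<Longrightarrow> q \<in> N \<Longrightarrow> f \<in> C_inf M \<Longrightarrow> E i q f = pd i (rep U \<phi> f) (\<phi> q)"
    "\<And>q v f. q \<in> N \<Longrightarrow> v \<in> tangent M q \<Longrightarrow> v f = (\<Sum>i<mdim M. v (\<xi> i) * E i q f)"
    by (rule chart_frame[OF M U]) (rule that)
  have "v f = (\<Sum>i<mdim M. v (\<xi> i) * pd i (rep U \<phi> f) (\<phi> p))" if "f \<in> C_inf M" for f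
    unfolding f(3)[OF f(1) v, of f] by (rule sum.cong[OF refl]) (simp add: f(2)[OF _ f(1) that])
  then show ?thesis by (rule that)
qed

text \<open>Constant coefficients \<open>v (\<xi> i)\<close> in a local frame. Questions of smooth
  dependence on a parameter can then be settled for vector fields and specialised to one
  vector.\<close>

lemma tangent_extend:
  assumes M: "smooth_manifold M" and v: "v \<in> tangent M p"
  obtains X where "vector_field M X" "X p = v"
proof -
  obtain U \<phi> where U: "(U, \<phi>) \<in> charts M" "p \<in> U" using chart_cover[OF M] by blast
  obtain \<xi> E N where f: "p \<in> N" "\<And>i. i < mdim M \<Longrightarrow> vector_field M (E i)"
    "\<And>q v f. q \<in> N \<Longrightarrow> v \<in> tangent M q \<Longrightarrow> v f = (\<Sum>i<mdim M. v (\<xi> i) * E i q f)"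
    by (rule chart_frame[OF M U]) (rule that)
  define X where "X y f = (\<Sum>i<mdim M. v (\<xi> i) * E i y f)" for y f
  have "vector_field M X"
    unfolding vector_field_def
  proof (intro conjI allI ballI)
    fix y show "X y \<in> tangent M y"
      using tangent_sum_vectors[OF finite_lessThan, of "mdim M" "\<lambda>i. E i y" M y "\<lambda>i. v (\<xi> i)"] vector_field_tangent[OF f(2)]
      by (simp add: X_def[abs_def])
  next
    fix f assume "f \<in> C_inf M"
    then show "(\<lambda>y. X y f) \<in> C_inf M"
      using C_inf_sum[OF M finite_lessThan, of "mdim M" "\<lambda>i y. v (\<xi> i) * E i y f"] C_inf_cmult[OF M vector_field_smooth[OF f(2)]]
      by (simp add: X_def)
  qed
  moreover have "X p = v" by (rule ext) (simp only: X_def f(3)[OF f(1) v, symmetric])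
  ultimately show ?thesis by (rule that)
qed

section \<open>Product manifolds and smooth maps\<close>

definition pair_coord :: "nat \<Rightarrow> (nat \<Rightarrow> real) \<Rightarrow> (nat \<Rightarrow> real) \<Rightarrow> nat \<Rightarrow> real" where
  "pair_coord m z w = (\<lambda>i. if i < m then z i else w (i - m))"

text \<open>Padding with 0 from \<open>m\<close> on keeps the first component in its own model
  space.\<close>

definition fst_coord :: "nat \<Rightarrow> (nat \<Rightarrow> real) \<Rightarrow> nat \<Rightarrow> real" where
  "fst_coord m z = (\<lambda>i. if i < m then z i else 0)"

definition snd_coord :: "nat \<Rightarrow> (nat \<Rightarrow> real) \<Rightarrow> nat \<Rightarrow> real" where
  "snd_coord m z = (\<lambda>i. z (i + m))"

definition prod_chart :: "nat \<Rightarrow> ('a \<Rightarrow> nat \<Rightarrow> real) \<Rightarrow> ('b \<Rightarrow> nat \<Rightarrow> real) \<Rightarrow> 'a \<times> 'b \<Rightarrow> nat \<Rightarrow> real" where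
  "prod_chart m \<phi> \<psi> = (\<lambda>(x, y). pair_coord m (\<phi> x) (\<psi> y))"

lemma mdim_prod [simp]: "mdim (prod_manifold M N) = mdim M + mdim N"
  by (simp add: prod_manifold_def)

lemma charts_prod:
  "charts (prod_manifold M N) = {(U \<times> V, prod_chart (mdim M) \<phi> \<psi>) | U \<phi> V \<psi>. (U, \<phi>) \<in> charts M \<and> (V, \<psi>) \<in> charts N}"
  by (simp add: prod_manifold_def prod_chart_def pair_coord_def)

lemma prod_chartI:
  "(U, \<phi>) \<in> charts M \<Longrightarrow> (V, \<psi>) \<in> charts N \<Longrightarrow> (U \<times> V, prod_chart (mdim M) \<phi> \<psi>) \<in> charts (prod_manifold M N)"
  unfolding charts_prod by blast

lemma prod_chartE:
  assumes "(W, \<theta>) \<in> charts (prod_manifold M N)"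
  obtains U \<phi> V \<psi> where "(U, \<phi>) \<in> charts M" "(V, \<psi>) \<in> charts N" "W = U \<times> V" "\<theta> = prod_chart (mdim M) \<phi> \<psi>"
  using assms unfolding charts_prod by blast

lemma snd_pair_coord [simp]: "snd_coord m (pair_coord m z w) = w"
  by (simp add: snd_coord_def pair_coord_def)

lemma fst_pair_coord: "(\<And>i. m \<le> i \<Longrightarrow> z i = 0) \<Longrightarrow> fst_coord m (pair_coord m z w) = z"
  by (auto simp: fst_coord_def pair_coord_def)

lemma pair_fst_snd_coord [simp]: "pair_coord m (fst_coord m z) (snd_coord m z) = z"
  by (auto simp: fst_coord_def pair_coord_def snd_coord_def)

lemma smooth_on_fst_coord: "openE k W \<Longrightarrow> smooth_on k W (\<lambda>z. fst_coord m z j)"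
  by (cases "j < m") (simp_all add: fst_coord_def smooth_on_coord smooth_on_const)

lemma smooth_on_snd_coord: "openE k W \<Longrightarrow> smooth_on k W (\<lambda>z. snd_coord m z j)"
  by (simp add: snd_coord_def smooth_on_coord)

lemma smooth_on_pair_coord:
  "openE k W \<Longrightarrow> (\<And>j. j < m \<Longrightarrow> smooth_on k W (\<lambda>x. F x j)) \<Longrightarrow> (\<And>j. j < n \<Longrightarrow> smooth_on k W (\<lambda>x. G x j)) \<Longrightarrow>
    i < m + n \<Longrightarrow> smooth_on k W (\<lambda>x. pair_coord m (F x) (G x) i)"
  by (cases "i < m") (simp_all add: pair_coord_def)

lemma continuous_fst_coord: "continuous_on S (fst_coord m)"
proof (rule continuous_on_coordinatewise_then_product)
  fix i show "continuous_on S (\<lambda>z. fst_coord m z i)"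
    using continuous_on_subset[OF continuous_on_product_coordinates[of i] subset_UNIV]
    by (cases "i < m") (simp_all add: fst_coord_def)
qed

lemma continuous_snd_coord: "continuous_on S (snd_coord m)"
proof (rule continuous_on_coordinatewise_then_product)
  fix i show "continuous_on S (\<lambda>z. snd_coord m z i)"
    using continuous_on_subset[OF continuous_on_product_coordinates[of "i + m"] subset_UNIV]
    by (simp add: snd_coord_def)
qed

text \<open>The image of a product of chart domains under \<open>prod_chart\<close>, in a form that
  shows it to be open.\<close>

definition coord_prod :: "nat \<Rightarrow> nat \<Rightarrow> (nat \<Rightarrow> real) set \<Rightarrow> (nat \<Rightarrow> real) set \<Rightarrow> (nat \<Rightarrow> real) set" where
  "coord_prod m n A B = {z. (\<forall>i\<ge>m + n. z i = 0) \<and> fst_coord m z \<in> A \<and> snd_coord m z \<in> B}"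

lemma openE_coord_prod:
  assumes "openE m A" "openE n B" shows "openE (m + n) (coord_prod m n A B)"
proof -
  obtain S where S: "open S" "A = {x. \<forall>i\<ge>m. x i = 0} \<inter> S" using assms(1) unfolding openE_open by blast
  obtain T where T: "open T" "B = {x. \<forall>i\<ge>n. x i = 0} \<inter> T" using assms(2) unfolding openE_open by blast
  have "open (fst_coord m -` S \<inter> snd_coord m -` T)"
    using S(1) T(1) by (intro open_Int open_vimage continuous_fst_coord continuous_snd_coord)
  moreover have "coord_prod m n A B = {x. \<forall>i\<ge>m + n. x i = 0} \<inter> (fst_coord m -` S \<inter> snd_coord m -` T)"
    unfolding coord_prod_def S(2) T(2) by (auto simp: fst_coord_def snd_coord_def)
  ultimately show ?thesis unfolding openE_open by blast
qed

lemma prod_chart_image: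
  assumes A: "\<And>x i. x \<in> A \<Longrightarrow> m \<le> i \<Longrightarrow> \<phi> x i = 0" and B: "\<And>y i. y \<in> B \<Longrightarrow> n \<le> i \<Longrightarrow> \<psi> y i = 0"
  shows "prod_chart m \<phi> \<psi> ` (A \<times> B) = coord_prod m n (\<phi> ` A) (\<psi> ` B)"
proof
  show "prod_chart m \<phi> \<psi> ` (A \<times> B) \<subseteq> coord_prod m n (\<phi> ` A) (\<psi> ` B)"
    using A B by (auto simp: prod_chart_def coord_prod_def fst_pair_coord) (auto simp: pair_coord_def)
  show "coord_prod m n (\<phi> ` A) (\<psi> ` B) \<subseteq> prod_chart m \<phi> \<psi> ` (A \<times> B)"
  proof
    fix z assume "z \<in> coord_prod m n (\<phi> ` A) (\<psi> ` B)"
    then obtain x y where xy: "x \<in> A" "y \<in> B" "fst_coord m z = \<phi> x" "snd_coord m z = \<psi> y"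
      unfolding coord_prod_def by blast
    then have "z = prod_chart m \<phi> \<psi> (x, y)" using pair_fst_snd_coord[of m z] by (simp add: prod_chart_def)
    then show "z \<in> prod_chart m \<phi> \<psi> ` (A \<times> B)" using xy by blast
  qed
qed

context
  fixes M :: "'a::{t2_space, second_countable_topology} smooth_structure"
    and N :: "'b::{t2_space, second_countable_topology} smooth_structure"
  assumes M: "smooth_manifold M" and N: "smooth_manifold N"
begin

lemma prod_chart_img:
  assumes U: "(U, \<phi>) \<in> charts M" and V: "(V, \<psi>) \<in> charts N" and AB: "A \<subseteq> U" "B \<subseteq> V"
  shows "prod_chart (mdim M) \<phi> \<psi> ` (A \<times> B) = coord_prod (mdim M) (mdim N) (\<phi> ` A) (\<psi> ` B)"
  by (rule prod_chart_image) (use AB chart_zero[OF M U] chart_zero[OF N V] in auto)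

lemma openE_prod_chart:
  assumes U: "(U, \<phi>) \<in> charts M" and V: "(V, \<psi>) \<in> charts N" and AB: "A \<subseteq> U" "B \<subseteq> V" "open A" "open B"
  shows "openE (mdim M + mdim N) (prod_chart (mdim M) \<phi> \<psi> ` (A \<times> B))"
  unfolding prod_chart_img[OF U V AB(1,2)]
  by (rule openE_coord_prod[OF chart_openE[OF M U AB(3,1)] chart_openE[OF N V AB(4,2)]])

lemma fst_prod_chart: "(U, \<phi>) \<in> charts M \<Longrightarrow> x \<in> U \<Longrightarrow> fst_coord (mdim M) (prod_chart (mdim M) \<phi> \<psi> (x, y)) = \<phi> x"
  by (simp add: prod_chart_def fst_pair_coord chart_zero[OF M])

lemma snd_prod_chart: "snd_coord (mdim M) (prod_chart (mdim M) \<phi> \<psi> (x, y)) = \<psi> y"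
  by (simp add: prod_chart_def)

lemma inj_prod_chart:
  assumes U: "(U, \<phi>) \<in> charts M" and V: "(V, \<psi>) \<in> charts N"
  shows "inj_on (prod_chart (mdim M) \<phi> \<psi>) (U \<times> V)"
proof (rule inj_onI, clarify)
  fix x y x' y' assume *: "x \<in> U" "y \<in> V" "x' \<in> U" "y' \<in> V"
    "prod_chart (mdim M) \<phi> \<psi> (x, y) = prod_chart (mdim M) \<phi> \<psi> (x', y')"
  then have "\<phi> x = \<phi> x'" "\<psi> y = \<psi> y'"
    using fst_prod_chart[OF U, of x \<psi> y] fst_prod_chart[OF U, of x' \<psi> y'] snd_prod_chart[of \<phi> \<psi>] by metis+
  then show "x = x' \<and> y = y'" using * chart_inj[OF M U] chart_inj[OF N V] by (simp add: inj_on_def)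
qed

lemma inv_prod_chart:
  assumes U: "(U, \<phi>) \<in> charts M" and V: "(V, \<psi>) \<in> charts N" and z: "z \<in> prod_chart (mdim M) \<phi> \<psi> ` (U \<times> V)"
  shows "inv_into (U \<times> V) (prod_chart (mdim M) \<phi> \<psi>) z =
    (inv_into U \<phi> (fst_coord (mdim M) z), inv_into V \<psi> (snd_coord (mdim M) z))"
proof -
  obtain x y where xy: "x \<in> U" "y \<in> V" "z = prod_chart (mdim M) \<phi> \<psi> (x, y)" using z by blast
  then show ?thesis
    using inv_into_f_f[OF inj_prod_chart[OF U V], of "(x, y)"]
    by (simp add: fst_prod_chart[OF U] snd_prod_chart chart_inv[OF M U] chart_inv[OF N V])
qed

lemma smooth_manifold_prod: "smooth_manifold (prod_manifold M N)"
proof -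
  let ?m = "mdim M" and ?n = "mdim N"
  have cov: "(\<Union>(W, \<theta>)\<in>charts (prod_manifold M N). W) = UNIV"
  proof -
    have "z \<in> (\<Union>(W, \<theta>)\<in>charts (prod_manifold M N). W)" for z
    proof -
      obtain x y where z: "z = (x, y)" by fastforce
      obtain U \<phi> where U: "(U, \<phi>) \<in> charts M" "x \<in> U" using chart_cover[OF M] by blast
      obtain V \<psi> where V: "(V, \<psi>) \<in> charts N" "y \<in> V" using chart_cover[OF N] by blast
      show ?thesis by (rule UN_I[OF prod_chartI[OF U(1) V(1)]]) (use z U V in simp)
    qed
    then show ?thesis by blast
  qed
  have loc: "open W \<and> openE (?m + ?n) (\<theta> ` W) \<and>
      homeomorphic_map (top_of_set W) (subtopology (Euclidean_space (?m + ?n)) (\<theta> ` W)) \<theta>"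
    if "(W, \<theta>) \<in> charts (prod_manifold M N)" for W \<theta>
  proof -
    from that obtain U \<phi> V \<psi> where U: "(U, \<phi>) \<in> charts M" and V: "(V, \<psi>) \<in> charts N" and W: "W = U \<times> V"
      and \<theta>: "\<theta> = prod_chart ?m \<phi> \<psi>" by (rule prod_chartE)
    have o: "open W" unfolding W by (intro open_Times chart_open[OF M U] chart_open[OF N V])
    have oE: "openE (?m + ?n) (\<theta> ` W)" unfolding \<theta> W
      by (rule openE_prod_chart[OF U V order_refl order_refl chart_open[OF M U] chart_open[OF N V]])
    note hU = chart_homeomorphism[OF M U] and hV = chart_homeomorphism[OF N V]
    have "continuous_on W \<theta>"
    proof (rule continuous_on_coordinatewise_then_product)
      fix i
      have "continuous_on W (\<lambda>z. \<phi> (fst z))" unfolding W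
        by (rule continuous_on_compose2[OF homeomorphism_cont1[OF hU] continuous_on_fst[OF continuous_on_id]]) auto
      moreover have "continuous_on W (\<lambda>z. \<psi> (snd z))" unfolding W
        by (rule continuous_on_compose2[OF homeomorphism_cont1[OF hV] continuous_on_snd[OF continuous_on_id]]) auto
      ultimately have "continuous_on W (\<lambda>z. \<phi> (fst z) i)" "continuous_on W (\<lambda>z. \<psi> (snd z) (i - ?m))"
        using continuous_on_product_then_coordinatewise[of W "\<lambda>z. \<phi> (fst z)"]
          continuous_on_product_then_coordinatewise[of W "\<lambda>z. \<psi> (snd z)"] by blast+
      then show "continuous_on W (\<lambda>z. \<theta> z i)"
        by (cases "i < ?m") (simp_all add: \<theta> prod_chart_def pair_coord_def case_prod_beta)
    qed
    moreover have "continuous_on (\<theta> ` W) (\<lambda>z. (inv_into U \<phi> (fst_coord ?m z), inv_into V \<psi> (snd_coord ?m z)))"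
    proof (rule continuous_on_Pair)
      show "continuous_on (\<theta> ` W) (\<lambda>z. inv_into U \<phi> (fst_coord ?m z))"
        by (rule continuous_on_compose2[OF homeomorphism_cont2[OF hU] continuous_fst_coord])
          (auto simp: \<theta> W fst_prod_chart[OF U])
      show "continuous_on (\<theta> ` W) (\<lambda>z. inv_into V \<psi> (snd_coord ?m z))"
        by (rule continuous_on_compose2[OF homeomorphism_cont2[OF hV] continuous_snd_coord])
          (auto simp: \<theta> W snd_prod_chart)
    qed
    ultimately have "homeomorphic_maps (top_of_set W) (top_of_set (\<theta> ` W)) \<theta>
        (\<lambda>z. (inv_into U \<phi> (fst_coord ?m z), inv_into V \<psi> (snd_coord ?m z)))"
      unfolding homeomorphic_maps_def continuous_map_in_subtopology
      by (auto simp: \<theta> W fst_prod_chart[OF U] snd_prod_chart chart_inv[OF M U] chart_inv[OF N V])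
    then show ?thesis using o oE unfolding subtopology_openE[OF oE] homeomorphic_map_maps by blast
  qed
  have trans: "smooth_on (?m + ?n) (\<theta> ` (W \<inter> W')) (\<lambda>z. \<theta>' (inv_into W \<theta> z) i)"
    if W1: "(W, \<theta>) \<in> charts (prod_manifold M N)" and W2: "(W', \<theta>') \<in> charts (prod_manifold M N)" and i: "i < ?m + ?n"
    for W \<theta> W' \<theta>' i
  proof -
    from W1 obtain U \<phi> V \<psi> where U: "(U, \<phi>) \<in> charts M" and V: "(V, \<psi>) \<in> charts N" and W: "W = U \<times> V"
      and \<theta>: "\<theta> = prod_chart ?m \<phi> \<psi>" by (rule prod_chartE)
    from W2 obtain U' \<phi>' V' \<psi>' where U': "(U', \<phi>') \<in> charts M" and V': "(V', \<psi>') \<in> charts N" and W': "W' = U' \<times> V'"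
      and \<theta>': "\<theta>' = prod_chart ?m \<phi>' \<psi>'" by (rule prod_chartE)
    have eq: "W \<inter> W' = (U \<inter> U') \<times> (V \<inter> V')" by (auto simp: W W')
    have oU: "open (U \<inter> U')" and oV: "open (V \<inter> V')"
      using chart_open[OF M U] chart_open[OF M U'] chart_open[OF N V] chart_open[OF N V'] by (simp_all add: open_Int)
    have oE: "openE (?m + ?n) (\<theta> ` (W \<inter> W'))" unfolding \<theta> eq
      by (rule openE_prod_chart[OF U V Int_lower1 Int_lower1 oU oV])
    have "smooth_on (?m + ?n) (\<theta> ` (W \<inter> W')) (\<lambda>z. \<phi>' (inv_into U \<phi> (fst_coord ?m z)) j)" if "j < ?m" for j
      by (rule smooth_on_compose[OF oE chart_openE[OF M U oU Int_lower1] _ transition_smooth[OF M U U' that] smooth_on_fst_coord[OF oE]])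
        (auto simp: \<theta> eq fst_prod_chart[OF U])
    moreover have "smooth_on (?m + ?n) (\<theta> ` (W \<inter> W')) (\<lambda>z. \<psi>' (inv_into V \<psi> (snd_coord ?m z)) j)" if "j < ?n" for j
      by (rule smooth_on_compose[OF oE chart_openE[OF N V oV Int_lower1] _ transition_smooth[OF N V V' that] smooth_on_snd_coord[OF oE]])
        (auto simp: \<theta> eq snd_prod_chart)
    ultimately have "smooth_on (?m + ?n) (\<theta> ` (W \<inter> W'))
        (\<lambda>z. pair_coord ?m (\<phi>' (inv_into U \<phi> (fst_coord ?m z))) (\<psi>' (inv_into V \<psi> (snd_coord ?m z))) i)"
      using i by (rule smooth_on_pair_coord[OF oE])
    then show ?thesis
    proof (rule smooth_on_cong[OF oE, rotated])
      fix z assume "z \<in> \<theta> ` (W \<inter> W')"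
      then have "z \<in> prod_chart ?m \<phi> \<psi> ` (U \<times> V)" by (auto simp: \<theta> W)
      then show "pair_coord ?m (\<phi>' (inv_into U \<phi> (fst_coord ?m z))) (\<psi>' (inv_into V \<psi> (snd_coord ?m z))) i
          = \<theta>' (inv_into W \<theta> z) i"
        unfolding \<theta> W \<theta>' inv_prod_chart[OF U V \<open>z \<in> prod_chart ?m \<phi> \<psi> ` (U \<times> V)\<close>] by (simp add: prod_chart_def)
    qed
  qed
  show ?thesis unfolding smooth_manifold_def mdim_prod
    using cov loc trans by (intro conjI) (simp, fast, fast)
qed

end

section \<open>Smooth maps between manifolds\<close>

lemma smooth_map_continuous: "smooth_map M N F \<Longrightarrow> continuous_on UNIV F"
  by (simp add: smooth_map_def)

lemma smooth_map_smooth_on: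
  assumes "smooth_map M N F" "(U, \<phi>) \<in> charts M" "(V, \<psi>) \<in> charts N" "i < mdim N"
  shows "smooth_on (mdim M) (\<phi> ` (U \<inter> F -` V)) (\<lambda>y. \<psi> (F (inv_into U \<phi> y)) i)"
proof -
  note 1 = conjunct2[OF assms(1)[unfolded smooth_map_def]]
  from bspec[OF bspec[OF 1 assms(2), simplified] assms(3)] assms(4) show ?thesis by simp
qed

lemma smooth_mapI:
  assumes "continuous_on UNIV F"
    "\<And>U \<phi> V \<psi> i. (U, \<phi>) \<in> charts M \<Longrightarrow> (V, \<psi>) \<in> charts N \<Longrightarrow> i < mdim N \<Longrightarrow>
      smooth_on (mdim M) (\<phi> ` (U \<inter> F -` V)) (\<lambda>y. \<psi> (F (inv_into U \<phi> y)) i)"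
  shows "smooth_map M N F"
  unfolding smooth_map_def using assms by fast

lemma C_inf_comp:
  assumes M: "smooth_manifold M" and N: "smooth_manifold N" and F: "smooth_map M N F" and f: "f \<in> C_inf N"
  shows "(\<lambda>x. f (F x)) \<in> C_inf M"
proof (rule C_inf_chartI[OF M])
  fix x
  obtain U \<phi> where U: "(U, \<phi>) \<in> charts M" "x \<in> U" using chart_cover[OF M] by blast
  obtain V \<psi> where V: "(V, \<psi>) \<in> charts N" "F x \<in> V" using chart_cover[OF N] by blast
  let ?W = "U \<inter> F -` V"
  have o: "open ?W" using chart_open[OF M U(1)] open_vimage[OF chart_open[OF N V(1)] smooth_map_continuous[OF F]] by auto
  note oE = chart_openE[OF M U(1) o Int_lower1]
  have "smooth_on (mdim M) (\<phi> ` ?W) (\<lambda>y. rep V \<psi> f (\<psi> (F (inv_into U \<phi> y))))"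
    by (rule smooth_on_compose[OF oE chart_image[OF N V(1)] _ C_infD[OF f V(1)] smooth_map_smooth_on[OF F U(1) V(1)]])
      (auto simp: chart_inv[OF M U(1)])
  then have "smooth_on (mdim M) (\<phi> ` ?W) (rep U \<phi> (\<lambda>x. f (F x)))"
    by (rule smooth_on_cong[OF oE, rotated]) (auto simp: chart_inv[OF M U(1)] chart_inv[OF N V(1)])
  then show "\<exists>U \<phi> W. (U, \<phi>) \<in> charts M \<and> open W \<and> x \<in> W \<and> W \<subseteq> U \<and> smooth_on (mdim M) (\<phi> ` W) (rep U \<phi> (\<lambda>x. f (F x)))"
    using U V o by (intro exI[of _ U] exI[of _ \<phi>] exI[of _ ?W]) auto
qed

lemma smooth_map_const:
  assumes M: "smooth_manifold M" shows "smooth_map M N (\<lambda>x. c)"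
proof (rule smooth_mapI)
  fix U \<phi> V \<psi> i assume U: "(U, \<phi>) \<in> charts M"
  have "open (U \<inter> (\<lambda>x. c) -` V)" using chart_open[OF M U] by (cases "c \<in> V") auto
  from chart_openE[OF M U this Int_lower1]
  show "smooth_on (mdim M) (\<phi> ` (U \<inter> (\<lambda>x. c) -` V)) (\<lambda>y. \<psi> c i)" by (rule smooth_on_const)
qed simp

lemma smooth_map_id:
  assumes M: "smooth_manifold M" shows "smooth_map M M (\<lambda>x. x)"
  by (rule smooth_mapI) (simp_all add: vimage_def transition_smooth[OF M] continuous_on_id)

lemma smooth_map_pair:
  assumes A: "smooth_manifold A" and M: "smooth_manifold M" and N: "smooth_manifold N"
    and F: "smooth_map A M F" and G: "smooth_map A N G"
  shows "smooth_map A (prod_manifold M N) (\<lambda>a. (F a, G a))"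
proof (rule smooth_mapI)
  show "continuous_on UNIV (\<lambda>a. (F a, G a))"
    by (rule continuous_on_Pair[OF smooth_map_continuous[OF F] smooth_map_continuous[OF G]])
  fix U \<phi> W \<theta> i assume U: "(U, \<phi>) \<in> charts A" and W: "(W, \<theta>) \<in> charts (prod_manifold M N)" and i: "i < mdim (prod_manifold M N)"
  from W obtain V1 \<psi>1 V2 \<psi>2 where V1: "(V1, \<psi>1) \<in> charts M" and V2: "(V2, \<psi>2) \<in> charts N" and W: "W = V1 \<times> V2"
      and \<theta>: "\<theta> = prod_chart (mdim M) \<psi>1 \<psi>2" by (rule prod_chartE)
  let ?S = "U \<inter> (\<lambda>a. (F a, G a)) -` W"
  have o1: "open (U \<inter> F -` V1)" and o2: "open (U \<inter> G -` V2)"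
    using chart_open[OF A U] open_vimage[OF chart_open[OF M V1] smooth_map_continuous[OF F]]
      open_vimage[OF chart_open[OF N V2] smooth_map_continuous[OF G]] by auto
  have S: "?S = (U \<inter> F -` V1) \<inter> (U \<inter> G -` V2)" by (auto simp: W)
  have o: "open ?S" unfolding S using o1 o2 by (rule open_Int)
  note oE = chart_openE[OF A U o Int_lower1]
  have "smooth_on (mdim A) (\<phi> ` ?S) (\<lambda>y. \<psi>1 (F (inv_into U \<phi> y)) j)" if "j < mdim M" for j
    by (rule smooth_on_subset[OF chart_openE[OF A U o1 Int_lower1] oE _ smooth_map_smooth_on[OF F U V1 that]])
      (unfold S, blast)
  moreover have "smooth_on (mdim A) (\<phi> ` ?S) (\<lambda>y. \<psi>2 (G (inv_into U \<phi> y)) j)" if "j < mdim N" for j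
    by (rule smooth_on_subset[OF chart_openE[OF A U o2 Int_lower1] oE _ smooth_map_smooth_on[OF G U V2 that]])
      (unfold S, blast)
  ultimately show "smooth_on (mdim A) (\<phi> ` ?S) (\<lambda>y. \<theta> (F (inv_into U \<phi> y), G (inv_into U \<phi> y)) i)"
    unfolding \<theta> prod_chart_def prod.case using i by (intro smooth_on_pair_coord[OF oE]) auto
qed

lemma smooth_map_fst:
  assumes M: "smooth_manifold M" and N: "smooth_manifold N"
  shows "smooth_map (prod_manifold M N) M fst"
proof (rule smooth_mapI)
  show "continuous_on UNIV (fst :: _ \<Rightarrow> 'a)" by (intro continuous_intros)
  fix W \<theta> U' \<phi>' i assume W: "(W, \<theta>) \<in> charts (prod_manifold M N)" and U': "(U', \<phi>') \<in> charts M" and i: "i < mdim M"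
  from W obtain U \<phi> V \<psi> where U: "(U, \<phi>) \<in> charts M" and V: "(V, \<psi>) \<in> charts N" and W: "W = U \<times> V"
      and \<theta>: "\<theta> = prod_chart (mdim M) \<phi> \<psi>" by (rule prod_chartE)
  have S: "W \<inter> fst -` U' = (U \<inter> U') \<times> V" by (auto simp: W)
  have oU: "open (U \<inter> U')" using chart_open[OF M U] chart_open[OF M U'] by (rule open_Int)
  have oE: "openE (mdim (prod_manifold M N)) (\<theta> ` (W \<inter> fst -` U'))" unfolding \<theta> S mdim_prod
    by (rule openE_prod_chart[OF M N U V Int_lower1 order_refl oU chart_open[OF N V]])
  have "smooth_on (mdim (prod_manifold M N)) (\<theta> ` (W \<inter> fst -` U')) (\<lambda>z. \<phi>' (inv_into U \<phi> (fst_coord (mdim M) z)) i)"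
    by (rule smooth_on_compose[OF oE chart_openE[OF M U oU Int_lower1] _ transition_smooth[OF M U U' i] smooth_on_fst_coord[OF oE]])
      (auto simp: \<theta> S fst_prod_chart[OF M N U])
  then show "smooth_on (mdim (prod_manifold M N)) (\<theta> ` (W \<inter> fst -` U')) (\<lambda>z. \<phi>' (fst (inv_into W \<theta> z)) i)"
  proof (rule smooth_on_cong[OF oE, rotated])
    fix z assume "z \<in> \<theta> ` (W \<inter> fst -` U')"
    then have z: "z \<in> prod_chart (mdim M) \<phi> \<psi> ` (U \<times> V)" by (auto simp: \<theta> W)
    show "\<phi>' (inv_into U \<phi> (fst_coord (mdim M) z)) i = \<phi>' (fst (inv_into W \<theta> z)) i"
      unfolding \<theta> W inv_prod_chart[OF M N U V z] by simp
  qed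
qed

lemma smooth_map_snd:
  assumes M: "smooth_manifold M" and N: "smooth_manifold N"
  shows "smooth_map (prod_manifold M N) N snd"
proof (rule smooth_mapI)
  show "continuous_on UNIV (snd :: _ \<Rightarrow> 'b)" by (intro continuous_intros)
  fix W \<theta> V' \<psi>' i assume W: "(W, \<theta>) \<in> charts (prod_manifold M N)" and V': "(V', \<psi>') \<in> charts N" and i: "i < mdim N"
  from W obtain U \<phi> V \<psi> where U: "(U, \<phi>) \<in> charts M" and V: "(V, \<psi>) \<in> charts N" and W: "W = U \<times> V"
      and \<theta>: "\<theta> = prod_chart (mdim M) \<phi> \<psi>" by (rule prod_chartE)
  have S: "W \<inter> snd -` V' = U \<times> (V \<inter> V')" by (auto simp: W)
  have oV: "open (V \<inter> V')" using chart_open[OF N V] chart_open[OF N V'] by (rule open_Int)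
  have oE: "openE (mdim (prod_manifold M N)) (\<theta> ` (W \<inter> snd -` V'))" unfolding \<theta> S mdim_prod
    by (rule openE_prod_chart[OF M N U V order_refl Int_lower1 chart_open[OF M U] oV])
  have "smooth_on (mdim (prod_manifold M N)) (\<theta> ` (W \<inter> snd -` V')) (\<lambda>z. \<psi>' (inv_into V \<psi> (snd_coord (mdim M) z)) i)"
    by (rule smooth_on_compose[OF oE chart_openE[OF N V oV Int_lower1] _ transition_smooth[OF N V V' i] smooth_on_snd_coord[OF oE]])
      (auto simp: \<theta> S snd_prod_chart[OF M N])
  then show "smooth_on (mdim (prod_manifold M N)) (\<theta> ` (W \<inter> snd -` V')) (\<lambda>z. \<psi>' (snd (inv_into W \<theta> z)) i)"
  proof (rule smooth_on_cong[OF oE, rotated])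
    fix z assume "z \<in> \<theta> ` (W \<inter> snd -` V')"
    then have z: "z \<in> prod_chart (mdim M) \<phi> \<psi> ` (U \<times> V)" by (auto simp: \<theta> W)
    show "\<psi>' (inv_into V \<psi> (snd_coord (mdim M) z)) i = \<psi>' (snd (inv_into W \<theta> z)) i"
      unfolding \<theta> W inv_prod_chart[OF M N U V z] by simp
  qed
qed

section \<open>Smooth functions of two points\<close>

lemma pd_pair_coord_fst: "i < m \<Longrightarrow> pd i (\<lambda>z. G (pair_coord m z w)) z = pd i G (pair_coord m z w)"
proof -
  assume i: "i < m"
  have "pair_coord m (z(i := t)) w = (pair_coord m z w)(i := t)" for t
    using i by (auto simp: pair_coord_def)
  moreover have "pair_coord m z w i = z i" using i by (simp add: pair_coord_def)
  ultimately show ?thesis unfolding pd_def by simp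
qed

lemma pd_pair_coord_snd: "pd j (\<lambda>w. G (pair_coord m z w)) w = pd (m + j) G (pair_coord m z w)"
proof -
  have "pair_coord m z (w(j := t)) = (pair_coord m z w)(m + j := t)" for t
    by (auto simp: pair_coord_def fun_eq_iff)
  moreover have "pair_coord m z w (m + j) = w j" by (simp add: pair_coord_def)
  ultimately show ?thesis unfolding pd_def by simp
qed

context
  fixes M :: "'a::{t2_space, second_countable_topology} smooth_structure"
    and N :: "'b::{t2_space, second_countable_topology} smooth_structure"
  assumes M: "smooth_manifold M" and N: "smooth_manifold N"
begin

lemma C_inf_slice_fst: "K \<in> C_inf (prod_manifold M N) \<Longrightarrow> (\<lambda>x. K (x, y)) \<in> C_inf M"
  by (rule C_inf_comp[OF M smooth_manifold_prod[OF M N] smooth_map_pair[OF M M N smooth_map_id[OF M] smooth_map_const[OF M]]])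

lemma C_inf_slice_snd: "K \<in> C_inf (prod_manifold M N) \<Longrightarrow> (\<lambda>y. K (x, y)) \<in> C_inf N"
  by (rule C_inf_comp[OF N smooth_manifold_prod[OF M N] smooth_map_pair[OF N M N smooth_map_const[OF N] smooth_map_id[OF N]]])

lemma C_inf_fst: "f \<in> C_inf M \<Longrightarrow> (\<lambda>z. f (fst z)) \<in> C_inf (prod_manifold M N)"
  by (rule C_inf_comp[OF smooth_manifold_prod[OF M N] M smooth_map_fst[OF M N]])

lemma C_inf_snd: "f \<in> C_inf N \<Longrightarrow> (\<lambda>z. f (snd z)) \<in> C_inf (prod_manifold M N)"
  by (rule C_inf_comp[OF smooth_manifold_prod[OF M N] N smooth_map_snd[OF M N]])

lemma C_inf_swap: "K \<in> C_inf (prod_manifold M N) \<Longrightarrow> (\<lambda>z. K (snd z, fst z)) \<in> C_inf (prod_manifold N M)"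
  by (rule C_inf_comp[OF smooth_manifold_prod[OF N M] smooth_manifold_prod[OF M N]
    smooth_map_pair[OF smooth_manifold_prod[OF N M] M N smooth_map_snd[OF N M] smooth_map_fst[OF N M]]])

abbreviation prep :: "'a set \<Rightarrow> ('a \<Rightarrow> nat \<Rightarrow> real) \<Rightarrow> 'b set \<Rightarrow> ('b \<Rightarrow> nat \<Rightarrow> real) \<Rightarrow> ('a \<times> 'b \<Rightarrow> real) \<Rightarrow> (nat \<Rightarrow> real) \<Rightarrow> real" where
  "prep U \<phi> V \<psi> K \<equiv> rep (U \<times> V) (prod_chart (mdim M) \<phi> \<psi>) K"

lemma prep_pair:
  assumes U: "(U, \<phi>) \<in> charts M" and V: "(V, \<psi>) \<in> charts N" and z: "z \<in> \<phi> ` U" and w: "w \<in> \<psi> ` V"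
  shows "prep U \<phi> V \<psi> K (pair_coord (mdim M) z w) = K (inv_into U \<phi> z, inv_into V \<psi> w)"
proof -
  obtain x y where xy: "x \<in> U" "z = \<phi> x" "y \<in> V" "w = \<psi> y" using z w by blast
  then have "pair_coord (mdim M) z w = prod_chart (mdim M) \<phi> \<psi> (x, y)" by (simp add: prod_chart_def)
  then show ?thesis using xy inv_into_f_f[OF inj_prod_chart[OF M N U V], of "(x, y)"]
    by (simp add: chart_inv[OF M U] chart_inv[OF N V])
qed

lemma pd_slice_fst:
  assumes U: "(U, \<phi>) \<in> charts M" and V: "(V, \<psi>) \<in> charts N" and x: "x \<in> U" and y: "y \<in> V" and i: "i < mdim M"
  shows "pd i (rep U \<phi> (\<lambda>x. K (x, y))) (\<phi> x) = pd i (prep U \<phi> V \<psi> K) (pair_coord (mdim M) (\<phi> x) (\<psi> y))"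
proof -
  have "pd i (rep U \<phi> (\<lambda>x. K (x, y))) (\<phi> x) = pd i (\<lambda>z. prep U \<phi> V \<psi> K (pair_coord (mdim M) z (\<psi> y))) (\<phi> x)"
    by (rule pd_cong[OF chart_image[OF M U] imageI[OF x] i]) (simp add: prep_pair[OF U V] y chart_inv[OF N V])
  also have "\<dots> = pd i (prep U \<phi> V \<psi> K) (pair_coord (mdim M) (\<phi> x) (\<psi> y))"
    by (rule pd_pair_coord_fst[where G = "prep U \<phi> V \<psi> K", OF i])
  finally show ?thesis .
qed

lemma pd_slice_snd:
  assumes U: "(U, \<phi>) \<in> charts M" and V: "(V, \<psi>) \<in> charts N" and x: "x \<in> U" and y: "y \<in> V" and j: "j < mdim N"
  shows "pd j (rep V \<psi> (\<lambda>y. K (x, y))) (\<psi> y) = pd (mdim M + j) (prep U \<phi> V \<psi> K) (pair_coord (mdim M) (\<phi> x) (\<psi> y))"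
proof -
  have "pd j (rep V \<psi> (\<lambda>y. K (x, y))) (\<psi> y) = pd j (\<lambda>w. prep U \<phi> V \<psi> K (pair_coord (mdim M) (\<phi> x) w)) (\<psi> y)"
    by (rule pd_cong[OF chart_image[OF N V] imageI[OF y] j]) (simp add: prep_pair[OF U V] x chart_inv[OF M U])
  also have "\<dots> = pd (mdim M + j) (prep U \<phi> V \<psi> K) (pair_coord (mdim M) (\<phi> x) (\<psi> y))"
    by (rule pd_pair_coord_snd[where G = "prep U \<phi> V \<psi> K"])
  finally show ?thesis .
qed

text \<open>In a local frame the coefficients of \<open>X\<close> are the smooth functions
  \<open>X (\<xi> i)\<close>, so in a product chart the function is a sum of these times partial
  derivatives of \<open>K\<close>.\<close>

lemma C_inf_partial_fst:
  assumes K: "K \<in> C_inf (prod_manifold M N)" and X: "vector_field M X"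
  shows "(\<lambda>z. X (fst z) (\<lambda>x. K (x, snd z))) \<in> C_inf (prod_manifold M N)" (is "?f \<in> _")
proof (rule C_inf_chartI[OF smooth_manifold_prod[OF M N]])
  fix z0 :: "'a \<times> 'b"
  let ?m = "mdim M" and ?n = "mdim N"
  obtain x0 y0 where z0: "z0 = (x0, y0)" by fastforce
  obtain U \<phi> where U: "(U, \<phi>) \<in> charts M" "x0 \<in> U" using chart_cover[OF M] by blast
  obtain V \<psi> where V: "(V, \<psi>) \<in> charts N" "y0 \<in> V" using chart_cover[OF N] by blast
  obtain \<xi> E W where f: "open W" "x0 \<in> W" "W \<subseteq> U" "\<And>i. i < mdim M \<Longrightarrow> \<xi> i \<in> C_inf M"
    "\<And>i q f. i < mdim M \<Longrightarrow> q \<in> W \<Longrightarrow> f \<in> C_inf M \<Longrightarrow> E i q f = pd i (rep U \<phi> f) (\<phi> q)"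
    "\<And>q v f. q \<in> W \<Longrightarrow> v \<in> tangent M q \<Longrightarrow> v f = (\<Sum>i<mdim M. v (\<xi> i) * E i q f)"
    by (rule chart_frame[OF M U]) (rule that)
  note PM = smooth_manifold_prod[OF M N]
  note pc = prod_chartI[OF U(1) V(1)]
  let ?pc = "prod_chart ?m \<phi> \<psi>"
  have sub: "W \<times> V \<subseteq> U \<times> V" and o: "open (W \<times> V)" using f(1,3) open_Times chart_open[OF N V(1)] by blast+
  note oE = chart_openE[OF PM pc o sub]
  define H where "H z = (\<Sum>i<?m. rep (U \<times> V) ?pc (\<lambda>z. X (fst z) (\<xi> i)) z * pd i (prep U \<phi> V \<psi> K) z)" for z
  have "smooth_on (?m + ?n) (?pc ` (W \<times> V)) H"
    unfolding H_def
  proof (intro smooth_on_sum smooth_on_mult oE[unfolded mdim_prod])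
    fix i assume "i \<in> {..<?m}"
    then have i: "i < ?m" by simp
    show "smooth_on (?m + ?n) (?pc ` (W \<times> V)) (rep (U \<times> V) ?pc (\<lambda>z. X (fst z) (\<xi> i)))"
      using C_inf_rep_subset[OF PM pc o sub C_inf_fst[OF vector_field_smooth[OF X f(4)[OF i]]]] by simp
    have "smooth_on (?m + ?n) (?pc ` (U \<times> V)) (pd i (prep U \<phi> V \<psi> K))"
      by (rule smooth_on_pd[OF chart_image[OF PM pc, unfolded mdim_prod] C_infD[OF K pc, unfolded mdim_prod]]) (use i in simp)
    then show "smooth_on (?m + ?n) (?pc ` (W \<times> V)) (pd i (prep U \<phi> V \<psi> K))"
      by (rule smooth_on_subset[OF chart_image[OF PM pc, unfolded mdim_prod] oE[unfolded mdim_prod] image_mono[OF sub]])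
  qed simp
  then have "smooth_on (mdim (prod_manifold M N)) (?pc ` (W \<times> V)) (rep (U \<times> V) ?pc ?f)"
    unfolding mdim_prod
  proof (rule smooth_on_cong[OF oE[unfolded mdim_prod], rotated])
    fix z assume "z \<in> ?pc ` (W \<times> V)"
    then obtain x y where xy: "x \<in> W" "y \<in> V" "z = ?pc (x, y)" by blast
    have xU: "x \<in> U" using xy f(3) by blast
    have inv: "inv_into (U \<times> V) ?pc z = (x, y)"
      using inv_into_f_f[OF inj_prod_chart[OF M N U(1) V(1)], of "(x, y)"] xy xU by simp
    have z: "z = pair_coord ?m (\<phi> x) (\<psi> y)" using xy by (simp add: prod_chart_def)
    have "X x (\<lambda>x. K (x, y)) = (\<Sum>i<?m. X x (\<xi> i) * E i x (\<lambda>x. K (x, y)))"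
      by (rule f(6)[OF xy(1) vector_field_tangent[OF X]])
    also have "\<dots> = (\<Sum>i<?m. X x (\<xi> i) * pd i (prep U \<phi> V \<psi> K) z)"
      by (rule sum.cong[OF refl]) (simp add: f(5)[OF _ xy(1) C_inf_slice_fst[OF K]] pd_slice_fst[OF U(1) V(1) xU xy(2)] z)
    finally show "H z = rep (U \<times> V) ?pc ?f z" by (simp add: H_def inv)
  qed
  then show "\<exists>U \<phi> W. (U, \<phi>) \<in> charts (prod_manifold M N) \<and> open W \<and> z0 \<in> W \<and> W \<subseteq> U \<and>
      smooth_on (mdim (prod_manifold M N)) (\<phi> ` W) (rep U \<phi> ?f)"
    using pc o sub z0 f(2) V(2) by (intro exI[of _ "U \<times> V"] exI[of _ ?pc] exI[of _ "W \<times> V"]) simp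
qed

text \<open>Extend \<open>v\<close> to a vector field, where smoothness in both variables is known,
  and restrict to the slice over \<open>p\<close>.\<close>

lemma C_inf_tangent_fst:
  assumes K: "K \<in> C_inf (prod_manifold M N)" and v: "v \<in> tangent M p"
  shows "(\<lambda>y. v (\<lambda>x. K (x, y))) \<in> C_inf N"
proof -
  obtain X where X: "vector_field M X" "X p = v" by (rule tangent_extend[OF M v])
  show ?thesis using C_inf_slice_snd[OF C_inf_partial_fst[OF K X(1)], of p] by (simp add: X(2))
qed

end

context
  fixes M :: "'a::{t2_space, second_countable_topology} smooth_structure"
    and N :: "'b::{t2_space, second_countable_topology} smooth_structure"
  assumes M: "smooth_manifold M" and N: "smooth_manifold N"
begin

lemma C_inf_tangent_snd:
  assumes K: "K \<in> C_inf (prod_manifold M N)" and v: "v \<in> tangent N q"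
  shows "(\<lambda>x. v (\<lambda>y. K (x, y))) \<in> C_inf M"
  using C_inf_tangent_fst[OF N M C_inf_swap[OF M N K] v] by simp

text \<open>Symmetry of second derivatives without coordinates: expanded in charts, each side is a
  sum of mixed derivatives, one index belonging to \<open>M\<close> and the other to
  \<open>N\<close>.\<close>

lemma tangent_commute:
  assumes K: "K \<in> C_inf (prod_manifold M N)" and u: "u \<in> tangent M p" and v: "v \<in> tangent N q"
  shows "u (\<lambda>x. v (\<lambda>y. K (x, y))) = v (\<lambda>y. u (\<lambda>x. K (x, y)))"
proof -
  let ?m = "mdim M" and ?n = "mdim N"
  obtain U \<phi> where U: "(U, \<phi>) \<in> charts M" "p \<in> U" using chart_cover[OF M] by blast
  obtain V \<psi> where V: "(V, \<psi>) \<in> charts N" "q \<in> V" using chart_cover[OF N] by blast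
  obtain c where c: "\<And>f. f \<in> C_inf M \<Longrightarrow> u f = (\<Sum>i<?m. c i * pd i (rep U \<phi> f) (\<phi> p))"
    by (rule tangent_chart[OF M U u]) (rule that)
  obtain d where d: "\<And>f. f \<in> C_inf N \<Longrightarrow> v f = (\<Sum>j<?n. d j * pd j (rep V \<psi> f) (\<psi> q))"
    by (rule tangent_chart[OF N V v]) (rule that)
  note pc = prod_chartI[OF U(1) V(1)]
  define P where "P = rep (U \<times> V) (prod_chart ?m \<phi> \<psi>) K"
  let ?S = "prod_chart ?m \<phi> \<psi> ` (U \<times> V)" and ?c = "pair_coord ?m (\<phi> p) (\<psi> q)"
  have sP: "smooth_on (?m + ?n) ?S P" unfolding P_def using C_infD[OF K pc] by simp
  have oE: "openE (?m + ?n) ?S" using chart_image[OF smooth_manifold_prod[OF M N] pc] by simp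
  have cS: "?c \<in> ?S" using U V by (force simp: prod_chart_def)
  note has = smooth_on_has_pd[OF oE smooth_on_pd[OF oE sP] _ cS]
  have "pd i (rep U \<phi> (\<lambda>x. v (\<lambda>y. K (x, y)))) (\<phi> p) = (\<Sum>j<?n. d j * pd i (pd (?m + j) P) ?c)" if i: "i < ?m" for i
  proof -
    have "v (\<lambda>y. K (x, y)) = (\<Sum>j<?n. d j * pd (?m + j) P (pair_coord ?m (\<phi> x) (\<psi> q)))" if "x \<in> U" for x
      unfolding d[OF C_inf_slice_snd[OF M N K]]
      by (rule sum.cong[OF refl]) (simp add: pd_slice_snd[OF M N U(1) V(1) that V(2)] P_def)
    then have "pd i (rep U \<phi> (\<lambda>x. v (\<lambda>y. K (x, y)))) (\<phi> p) =
        pd i (\<lambda>z. \<Sum>j<?n. d j * pd (?m + j) P (pair_coord ?m z (\<psi> q))) (\<phi> p)"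
      by (intro pd_cong[OF chart_image[OF M U(1)] imageI[OF U(2)] i]) (auto simp: chart_inv[OF M U(1)])
    also have "\<dots> = pd i (\<lambda>z. \<Sum>j<?n. d j * pd (?m + j) P z) ?c" by (rule pd_pair_coord_fst[OF i])
    also have "\<dots> = (\<Sum>j<?n. d j * pd i (pd (?m + j) P) ?c)"
      by (rule pd_eqI, intro DERIV_sum DERIV_cmult has) (use i in simp_all)
    finally show ?thesis .
  qed
  then have ex: "u (\<lambda>x. v (\<lambda>y. K (x, y))) = (\<Sum>i<?m. c i * (\<Sum>j<?n. d j * pd i (pd (?m + j) P) ?c))"
    by (simp add: c[OF C_inf_tangent_snd[OF K v]])
  have "pd j (rep V \<psi> (\<lambda>y. u (\<lambda>x. K (x, y)))) (\<psi> q) = (\<Sum>i<?m. c i * pd (?m + j) (pd i P) ?c)" if j: "j < ?n" for j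
  proof -
    have "u (\<lambda>x. K (x, y)) = (\<Sum>i<?m. c i * pd i P (pair_coord ?m (\<phi> p) (\<psi> y)))" if "y \<in> V" for y
      unfolding c[OF C_inf_slice_fst[OF M N K]]
      by (rule sum.cong[OF refl]) (simp add: pd_slice_fst[OF M N U(1) V(1) U(2) that] P_def)
    then have "pd j (rep V \<psi> (\<lambda>y. u (\<lambda>x. K (x, y)))) (\<psi> q) =
        pd j (\<lambda>w. \<Sum>i<?m. c i * pd i P (pair_coord ?m (\<phi> p) w)) (\<psi> q)"
      by (intro pd_cong[OF chart_image[OF N V(1)] imageI[OF V(2)] j]) (auto simp: chart_inv[OF N V(1)])
    also have "\<dots> = pd (?m + j) (\<lambda>z. \<Sum>i<?m. c i * pd i P z) ?c" by (rule pd_pair_coord_snd)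
    also have "\<dots> = (\<Sum>i<?m. c i * pd (?m + j) (pd i P) ?c)"
      by (rule pd_eqI, intro DERIV_sum DERIV_cmult has) (use j in simp_all)
    finally show ?thesis .
  qed
  then have ey: "v (\<lambda>y. u (\<lambda>x. K (x, y))) = (\<Sum>j<?n. d j * (\<Sum>i<?m. c i * pd (?m + j) (pd i P) ?c))"
    by (simp add: d[OF C_inf_tangent_fst[OF M N K u]])
  have "pd i (pd (?m + j) P) ?c = pd (?m + j) (pd i P) ?c" if "i < ?m" "j < ?n" for i j
    by (rule pd_commute[OF oE smooth_onD[OF sP] _ _ cS]) (use that in simp_all)
  then show ?thesis unfolding ex ey sum_distrib_left
    by (subst sum.swap) (simp add: mult.left_commute)
qed

text \<open>The tangent space of a product is the direct sum of the two factors. In a product chart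
  each partial derivative kills one of the two frozen functions and agrees with \<open>K\<close> on
  the other.\<close>

lemma tangent_prod_split:
  assumes K: "K \<in> C_inf (prod_manifold M N)" and w: "w \<in> tangent (prod_manifold M N) (p, q)"
  shows "w K = w (\<lambda>z. K (fst z, q)) + w (\<lambda>z. K (p, snd z))"
proof -
  let ?m = "mdim M" and ?n = "mdim N" and ?P = "prod_manifold M N"
  obtain U \<phi> where U: "(U, \<phi>) \<in> charts M" "p \<in> U" using chart_cover[OF M] by blast
  obtain V \<psi> where V: "(V, \<psi>) \<in> charts N" "q \<in> V" using chart_cover[OF N] by blast
  let ?pc = "prod_chart ?m \<phi> \<psi>"
  have pq: "(p, q) \<in> U \<times> V" using U V by simp
  obtain c where c: "\<And>f. f \<in> C_inf ?P \<Longrightarrow> w f = (\<Sum>k<mdim ?P. c k * pd k (rep (U \<times> V) ?pc f) (?pc (p, q)))"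
    by (rule tangent_chart[OF smooth_manifold_prod[OF M N] prod_chartI[OF U(1) V(1)] pq w]) (rule that)
  let ?K1 = "\<lambda>z. K (fst z, q)" and ?K2 = "\<lambda>z. K (p, snd z)"
  have K1: "?K1 \<in> C_inf ?P" using C_inf_fst[OF M N C_inf_slice_fst[OF M N K]] by simp
  have K2: "?K2 \<in> C_inf ?P" using C_inf_snd[OF M N C_inf_slice_snd[OF M N K]] by simp
  have pc: "?pc (p, q) = pair_coord ?m (\<phi> p) (\<psi> q)" by (simp add: prod_chart_def)
  have "pd k (rep (U \<times> V) ?pc K) (?pc (p, q)) = pd k (rep (U \<times> V) ?pc ?K1) (?pc (p, q)) + pd k (rep (U \<times> V) ?pc ?K2) (?pc (p, q))"
    if k: "k < mdim ?P" for k
  proof (cases "k < ?m")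
    case True
    note s = pd_slice_fst[OF M N U(1) V(1) U(2) V(2) True, symmetric]
    show ?thesis unfolding pc s[of K] s[of ?K1] s[of ?K2] by (simp add: pd_const)
  next
    case False
    then have j: "k - ?m < ?n" and k': "?m + (k - ?m) = k" using k by auto
    note s = pd_slice_snd[OF M N U(1) V(1) U(2) V(2) j, unfolded k', symmetric]
    show ?thesis unfolding pc s[of K] s[of ?K1] s[of ?K2] by (simp add: pd_const)
  qed
  then show ?thesis unfolding c[OF K] c[OF K1] c[OF K2] by (simp add: sum.distrib[symmetric] algebra_simps)
qed

end

text \<open>The hypothesis speaks of pullbacks of functions instead of \<open>smooth_map\<close>,
  the form in which smoothness of orbit maps is available.\<close>

lemma push_vec_tangent:
  assumes N: "smooth_manifold N" and pull: "\<And>f. f \<in> C_inf N \<Longrightarrow> (\<lambda>x. f (F x)) \<in> C_inf M" and v: "v \<in> tangent M p"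
  shows "push_vec N F v \<in> tangent N (F p)"
proof (rule tangentI)
  fix f g a b assume f: "f \<in> C_inf N" and g: "g \<in> C_inf N"
  note cf = pull[OF f] and cg = pull[OF g]
  have "(\<lambda>y. a * f y + b * g y) \<in> C_inf N" by (intro C_inf_add[OF N] C_inf_cmult[OF N] f g)
  then show "push_vec N F v (\<lambda>y. a * f y + b * g y) = a * push_vec N F v f + b * push_vec N F v g"
    using f g tangent_linear[OF v cf cg] by (simp add: push_vec_def)
  show "push_vec N F v (\<lambda>y. f y * g y) = push_vec N F v f * g (F p) + f (F p) * push_vec N F v g"
    using f g C_inf_mult[OF N f g] tangent_mult[OF v cf cg] by (simp add: push_vec_def)
qed (simp add: push_vec_def)

text \<open>Push \<open>v\<close> forward into the product along the pair of maps and split the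
  result into its two components.\<close>

lemma tangent_diagonal:
  fixes A :: "'c::{t2_space, second_countable_topology} smooth_structure"
    and M :: "'a::{t2_space, second_countable_topology} smooth_structure"
    and N :: "'b::{t2_space, second_countable_topology} smooth_structure"
  assumes A: "smooth_manifold A" and M: "smooth_manifold M" and N: "smooth_manifold N"
    and F: "smooth_map A M F" and G: "smooth_map A N G"
    and K: "K \<in> C_inf (prod_manifold M N)" and v: "v \<in> tangent A p"
  shows "v (\<lambda>a. K (F a, G a)) = v (\<lambda>a. K (F a, G p)) + v (\<lambda>a. K (F p, G a))"
proof -
  let ?P = "prod_manifold M N"
  have w: "push_vec ?P (\<lambda>a. (F a, G a)) v \<in> tangent ?P (F p, G p)"
    using push_vec_tangent[where F = "\<lambda>a. (F a, G a)", OF smooth_manifold_prod[OF M N]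
      C_inf_comp[OF A smooth_manifold_prod[OF M N] smooth_map_pair[OF A M N F G]] v] .
  have K1: "(\<lambda>z. K (fst z, G p)) \<in> C_inf ?P" using C_inf_fst[OF M N C_inf_slice_fst[OF M N K]] by simp
  have K2: "(\<lambda>z. K (F p, snd z)) \<in> C_inf ?P" using C_inf_snd[OF M N C_inf_slice_snd[OF M N K]] by simp
  show ?thesis using tangent_prod_split[OF M N K w] K K1 K2 by (simp add: push_vec_def)
qed

section \<open>Bivector fields and the Schouten bracket\<close>

lemma ext_power_length: "t \<in> ext_power V k \<Longrightarrow> length fs \<noteq> k \<Longrightarrow> t fs = 0"
  unfolding ext_power_def tensor_power_def tensor_prod_def by auto

lemma ext_power_2E:
  assumes "t \<in> ext_power V 2"
  obtains n :: nat and c u v where "\<And>i. i < n \<Longrightarrow> u i \<in> V \<and> v i \<in> V"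
    "\<And>f g. t [f, g] = (\<Sum>i<n. c i * u i f * v i g)"
proof -
  obtain n :: nat and c vs where vs: "\<And>i. i < n \<Longrightarrow> length (vs i) = 2 \<and> set (vs i) \<subseteq> V"
    "t = (\<lambda>fs. \<Sum>i<n. c i * tensor_prod (vs i) fs)"
    using assms unfolding ext_power_def tensor_power_def by blast
  have "vs i ! 0 \<in> V \<and> vs i ! 1 \<in> V" if "i < n" for i
    using vs(1)[OF that] nth_mem[of 0 "vs i"] nth_mem[of 1 "vs i"] by auto
  moreover have "t [f, g] = (\<Sum>i<n. c i * (vs i ! 0) f * (vs i ! 1) g)" for f g
    unfolding vs(2) by (rule sum.cong[OF refl]) (simp add: tensor_prod_def vs(1) numeral_2_eq_2)
  ultimately show ?thesis by (rule that)
qed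

lemma ext_power_2_skew: assumes "t \<in> ext_power V 2" shows "t [g, f] = - t [f, g]"
proof -
  have "Transposition.transpose 0 1 permutes {..<2::nat}" by (rule permutes_swap_id) auto
  then have "t (permute_list (Transposition.transpose 0 1) [f, g]) = of_int (sign (Transposition.transpose 0 (1::nat))) * t [f, g]"
    using assms unfolding ext_power_def by fastforce
  moreover have "permute_list (Transposition.transpose 0 1) [f, g] = [g, f]"
    by (simp add: permute_list_def numeral_2_eq_2)
  ultimately show ?thesis by (simp add: sign_swap_id)
qed

lemma ext_power_2_tangent:
  assumes "t \<in> ext_power (tangent M x) 2"
  shows "(\<lambda>f. t [f, g]) \<in> tangent M x" "(\<lambda>f. t [g, f]) \<in> tangent M x"
proof -
  obtain n :: nat and c u v where uv: "\<And>i. i < n \<Longrightarrow> u i \<in> tangent M x \<and> v i \<in> tangent M x"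
    "\<And>f g. t [f, g] = (\<Sum>i<n. c i * u i f * v i g)" by (rule ext_power_2E[OF assms]) (rule that)
  show "(\<lambda>f. t [f, g]) \<in> tangent M x"
    using tangent_sum_vectors[of "{..<n}" u M x "\<lambda>i. c i * v i g"] uv by (simp add: mult_ac)
  show "(\<lambda>f. t [g, f]) \<in> tangent M x"
    using tangent_sum_vectors[of "{..<n}" v M x "\<lambda>i. c i * u i g"] uv by (simp add: mult_ac)
qed

lemma multivector_field_ext: "multivector_field M k P \<Longrightarrow> P x \<in> ext_power (tangent M x) k"
  and multivector_field_smooth: "multivector_field M k P \<Longrightarrow> length fs = k \<Longrightarrow> set fs \<subseteq> C_inf M \<Longrightarrow> (\<lambda>x. P x fs) \<in> C_inf M"
  unfolding multivector_field_def by blast+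

lemma bivector_smooth: "multivector_field M 2 P \<Longrightarrow> f \<in> C_inf M \<Longrightarrow> g \<in> C_inf M \<Longrightarrow> (\<lambda>x. P x [f, g]) \<in> C_inf M"
  by (rule multivector_field_smooth[where k=2]) simp_all

lemmas bivector_tangent = ext_power_2_tangent[OF multivector_field_ext]
lemmas bivector_skew = ext_power_2_skew[OF multivector_field_ext]

text \<open>Each slot is a tangent vector when the other is fixed and can be expanded in the frame.
  The coefficients are values on global functions, hence smooth.\<close>

lemma bivector_frame:
  assumes M: "smooth_manifold M" and P: "multivector_field M 2 P"
  obtains W \<xi> E and n :: nat where "open W" "p \<in> W" "\<And>i. i < n \<Longrightarrow> \<xi> i \<in> C_inf M" "\<And>i. i < n \<Longrightarrow> vector_field M (E i)"
    "\<And>y f g. y \<in> W \<Longrightarrow> P y [f, g] = (\<Sum>i<n. \<Sum>j<n. P y [\<xi> i, \<xi> j] * E i y f * E j y g)"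
proof -
  obtain U \<phi> where U: "(U, \<phi>) \<in> charts M" "p \<in> U" using chart_cover[OF M] by blast
  obtain \<xi> E W where f: "open W" "p \<in> W" "\<And>i. i < mdim M \<Longrightarrow> \<xi> i \<in> C_inf M" "\<And>i. i < mdim M \<Longrightarrow> vector_field M (E i)"
    "\<And>q v f. q \<in> W \<Longrightarrow> v \<in> tangent M q \<Longrightarrow> v f = (\<Sum>i<mdim M. v (\<xi> i) * E i q f)"
    by (rule chart_frame[OF M U]) (rule that)
  have "P y [f, g] = (\<Sum>i<mdim M. \<Sum>j<mdim M. P y [\<xi> i, \<xi> j] * E i y f * E j y g)" if y: "y \<in> W" for y f g
  proof -
    have "P y [f, g] = (\<Sum>i<mdim M. P y [\<xi> i, g] * E i y f)"
      by (rule f(5)[OF y bivector_tangent(1)[OF P]])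
    also have "\<dots> = (\<Sum>i<mdim M. (\<Sum>j<mdim M. P y [\<xi> i, \<xi> j] * E j y g) * E i y f)"
      by (rule sum.cong[OF refl], rule arg_cong[where f="\<lambda>t. t * _"], rule f(5)[OF y bivector_tangent(2)[OF P]])
    finally show ?thesis by (simp add: sum_distrib_left mult_ac)
  qed
  from f(1-4) this show ?thesis by (rule that)
qed

text \<open>Here the arguments vary along with the base point, which the definition of a multivector
  field does not cover. In \<open>eta\<close> this occurs, as the translated functions depend on the
  group element.\<close>

lemma C_inf_bivector_param:
  fixes M :: "'a::{t2_space, second_countable_topology} smooth_structure"
    and N :: "'b::{t2_space, second_countable_topology} smooth_structure"
  assumes M: "smooth_manifold M" and N: "smooth_manifold N" and P: "multivector_field M 2 P"
    and H: "H1 \<in> C_inf (prod_manifold M N)" "H2 \<in> C_inf (prod_manifold M N)"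
  shows "(\<lambda>z. P (fst z) [\<lambda>x. H1 (x, snd z), \<lambda>x. H2 (x, snd z)]) \<in> C_inf (prod_manifold M N)"
proof (rule C_inf_local[OF smooth_manifold_prod[OF M N]])
  fix z0 :: "'a \<times> 'b"
  let ?P = "prod_manifold M N"
  note PM = smooth_manifold_prod[OF M N]
  obtain W \<xi> E and n :: nat where f: "open W" "fst z0 \<in> W" "\<And>i. i < n \<Longrightarrow> \<xi> i \<in> C_inf M" "\<And>i. i < n \<Longrightarrow> vector_field M (E i)"
    "\<And>y f g. y \<in> W \<Longrightarrow> P y [f, g] = (\<Sum>i<n. \<Sum>j<n. P y [\<xi> i, \<xi> j] * E i y f * E j y g)"
    by (rule bivector_frame[OF M P]) (rule that)
  let ?h = "\<lambda>z. \<Sum>i<n. \<Sum>j<n. P (fst z) [\<xi> i, \<xi> j] * E i (fst z) (\<lambda>x. H1 (x, snd z)) * E j (fst z) (\<lambda>x. H2 (x, snd z))"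
  have "?h \<in> C_inf ?P"
  proof (intro C_inf_sum[OF PM finite_lessThan])
    fix i j assume "i \<in> {..<n}" "j \<in> {..<n}"
    then have i: "i < n" and j: "j < n" by auto
    show "(\<lambda>z. P (fst z) [\<xi> i, \<xi> j] * E i (fst z) (\<lambda>x. H1 (x, snd z)) * E j (fst z) (\<lambda>x. H2 (x, snd z))) \<in> C_inf ?P"
      by (rule C_inf_mult[OF PM C_inf_mult[OF PM C_inf_fst[OF M N bivector_smooth[OF P f(3)[OF i] f(3)[OF j]]]
          C_inf_partial_fst[OF M N H(1) f(4)[OF i]]] C_inf_partial_fst[OF M N H(2) f(4)[OF j]]])
  qed
  moreover have "open (W \<times> UNIV)" using f(1) by (intro open_Times) auto
  moreover have "z0 \<in> W \<times> UNIV" using f(2) by (cases z0) auto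
  moreover have "\<forall>z\<in>W \<times> UNIV. P (fst z) [\<lambda>x. H1 (x, snd z), \<lambda>x. H2 (x, snd z)] = ?h z"
    using f(5) by auto
  ultimately show "\<exists>W h. open W \<and> z0 \<in> W \<and> h \<in> C_inf ?P \<and> (\<forall>z\<in>W. P (fst z) [\<lambda>x. H1 (x, snd z), \<lambda>x. H2 (x, snd z)] = h z)"
    by blast
qed

section \<open>Alternation and wedge products in degrees two and three\<close>

lemma Alt_2: "Alt 2 t [f, g] = t [f, g] - t [g, f]"
proof -
  have l: "{..<2::nat} = {0, 1}" by auto
  have p: "{\<sigma>. \<sigma> permutes {0, 1::nat}} = {id, Transposition.transpose 0 1}" by (auto simp: permutes_doubleton_iff)
  have ne: "id \<noteq> Transposition.transpose 0 (1::nat)" by (metis id_apply transpose_apply_first zero_neq_one)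
  show ?thesis
    unfolding Alt_def l p using ne by (simp add: sign_swap_id permute_list_def numeral_2_eq_2)
qed

lemma Alt_3: "Alt 3 t [f, g, h] = t [f, g, h] - t [g, f, h] - t [f, h, g] - t [h, g, f] + t [g, h, f] + t [h, f, g]"
proof -
  have l: "{..<3::nat} = insert (Suc (Suc 0)) {0, 1}" by auto
  \<comment> \<open>Permutations of three indices factor into a permutation of 0 and 1 followed by
    the exchange of 2 with some index \<open>b\<close>, which is trivial for
    \<open>b = 2\<close>.\<close>
  have S: "(\<Sum>\<sigma> | \<sigma> permutes {..<3::nat}. of_int (sign \<sigma>) * t (permute_list \<sigma> [f, g, h])) =
    (\<Sum>b\<in>{Suc (Suc 0), 0, 1}. \<Sum>q | q permutes {0, 1}. of_int (sign (Transposition.transpose (Suc (Suc 0)) b \<circ> q)) * t (permute_list (Transposition.transpose (Suc (Suc 0)) b \<circ> q) [f, g, h]))"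
    unfolding l by (subst sum_over_permutations_insert) auto
  have p: "{\<sigma>. \<sigma> permutes {0, 1::nat}} = {id, Transposition.transpose 0 1}" by (auto simp: permutes_doubleton_iff)
  have ne: "id \<noteq> Transposition.transpose 0 (1::nat)" by (metis id_apply transpose_apply_first zero_neq_one)
  show ?thesis
    unfolding Alt_def S p using ne
    by (simp add: sign_compose permutation_swap_id sign_swap_id permute_list_def upt_rec transpose_def)
qed

lemma tensor_prod_2: "tensor_prod [u, v] [f, g] = u f * v g"
  by (simp add: tensor_prod_def numeral_2_eq_2)

lemma wedge_2: "wedge [u, v] [f, g] = u f * v g - u g * v f"
  using Alt_2[of "tensor_prod [u, v]" f g] by (simp add: wedge_def tensor_prod_2 numeral_2_eq_2)

lemma tensor_prod_3: "tensor_prod [u, v, w] [f, g, h] = u f * v g * w h"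
  by (simp add: tensor_prod_def numeral_3_eq_3 mult_ac)

lemma wedge_3: "wedge [u, v, w] [f, g, h] =
    u f * v g * w h - u g * v f * w h - u f * v h * w g - u h * v g * w f + u g * v h * w f + u h * v f * w g"
  using Alt_3[of "tensor_prod [u, v, w]" f g h] by (simp add: wedge_def tensor_prod_3 numeral_3_eq_3)

lemma wedge_length: "length fs \<noteq> length vs \<Longrightarrow> wedge vs fs = 0"
  by (simp add: wedge_def Alt_def)

text \<open>Whatever the permutation, each product has a factor evaluated at
  \<open>f\<close>.\<close>

lemma wedge_outside:
  assumes "f \<in> set fs" "\<And>v. v \<in> set vs \<Longrightarrow> v f = 0"
  shows "wedge vs fs = 0"
proof (cases "length fs = length vs")
  case True
  have "tensor_prod vs (permute_list \<sigma> fs) = 0" if s: "\<sigma> permutes {..<length vs}" for \<sigma>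
  proof -
    have "f \<in> set (permute_list \<sigma> fs)" using assms(1) s True by simp
    then obtain i where i: "i < length vs" "permute_list \<sigma> fs ! i = f" using True by (auto simp: in_set_conv_nth)
    then have "(vs ! i) (permute_list \<sigma> fs ! i) = 0" using assms(2) by simp
    then show ?thesis using i unfolding tensor_prod_def by (auto intro!: prod_zero)
  qed
  then show ?thesis unfolding wedge_def Alt_def by (auto intro!: sum.neutral)
qed (rule wedge_length)

text \<open>A polarised Jacobiator: \<open>jac P P\<close> is the Jacobiator of the bracket given by
  \<open>P\<close>, and \<open>jac P Q + jac Q P\<close> is the Schouten bracket of \<open>P\<close>
  and \<open>Q\<close> evaluated on functions.\<close>

definition jac :: "('a \<Rightarrow> 'a tensor) \<Rightarrow> ('a \<Rightarrow> 'a tensor) \<Rightarrow> 'a \<Rightarrow> ('a \<Rightarrow> real) \<Rightarrow> ('a \<Rightarrow> real) \<Rightarrow> ('a \<Rightarrow> real) \<Rightarrow> real" where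
  "jac P Q x f g h = P x [f, \<lambda>y. Q y [g, h]] + P x [g, \<lambda>y. Q y [h, f]] + P x [h, \<lambda>y. Q y [f, g]]"

lemma wedge_vector_fields_derivative:
  assumes M: "smooth_manifold M" and vf: "vector_field M c" "vector_field M d" and a: "a \<in> tangent M x"
    and f: "f \<in> C_inf M" "g \<in> C_inf M"
  shows "a (\<lambda>y. c y f * d y g - c y g * d y f) = a (\<lambda>y. c y f) * d x g + c x f * a (\<lambda>y. d y g)
    - a (\<lambda>y. c y g) * d x f - c x g * a (\<lambda>y. d y f)"
proof -
  note s = vector_field_smooth[OF vf(1)] vector_field_smooth[OF vf(2)]
  show ?thesis
    using tangent_diff[OF a C_inf_mult[OF M s(1)[OF f(1)] s(2)[OF f(2)]] C_inf_mult[OF M s(1)[OF f(2)] s(2)[OF f(1)]]]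
      tangent_mult[OF a s(1)[OF f(1)] s(2)[OF f(2)]] tangent_mult[OF a s(1)[OF f(2)] s(2)[OF f(1)]]
    by simp
qed

text \<open>Of the two halves of a Lie bracket, \<open>a (c f)\<close> comes from the first
  \<open>jac\<close> and \<open>c (a f)\<close> from the second; after the product rule the two
  sides agree term by term.\<close>

lemma schouten_wedge_jac:
  assumes M: "smooth_manifold M" and vf: "vector_field M a" "vector_field M b" "vector_field M c" "vector_field M d"
    and f: "f \<in> C_inf M" "g \<in> C_inf M" "h \<in> C_inf M"
  shows "schouten_wedge [a, b] [c, d] x [f, g, h] =
    jac (\<lambda>y. wedge [a y, b y]) (\<lambda>y. wedge [c y, d y]) x f g h + jac (\<lambda>y. wedge [c y, d y]) (\<lambda>y. wedge [a y, b y]) x f g h"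
proof -
  note t = vector_field_tangent[OF vf(1), of x] vector_field_tangent[OF vf(2), of x]
    vector_field_tangent[OF vf(3), of x] vector_field_tangent[OF vf(4), of x]
  note w = wedge_vector_fields_derivative[OF M]
  note 1 = w[OF vf(3,4) t(1) f(1,2)] w[OF vf(3,4) t(1) f(2,3)] w[OF vf(3,4) t(1) f(3,1)]
    w[OF vf(3,4) t(2) f(1,2)] w[OF vf(3,4) t(2) f(2,3)] w[OF vf(3,4) t(2) f(3,1)]
    w[OF vf(1,2) t(3) f(1,2)] w[OF vf(1,2) t(3) f(2,3)] w[OF vf(1,2) t(3) f(3,1)]
    w[OF vf(1,2) t(4) f(1,2)] w[OF vf(1,2) t(4) f(2,3)] w[OF vf(1,2) t(4) f(3,1)]
  show ?thesis
    unfolding schouten_wedge_2_2 wedge_3 jac_def wedge_2 1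
    unfolding lie_bracket_def by (simp add: algebra_simps)
qed

lemma sum_list_swap:
  fixes F :: "'a \<Rightarrow> 'b \<Rightarrow> real"
  shows "(\<Sum>x\<leftarrow>xs. \<Sum>y\<leftarrow>ys. F x y) = (\<Sum>y\<leftarrow>ys. \<Sum>x\<leftarrow>xs. F x y)"
  by (induction xs) (simp_all add: sum_list_addf)

lemma C_inf_sum_list:
  "smooth_manifold M \<Longrightarrow> (\<And>z. z \<in> set zs \<Longrightarrow> F z \<in> C_inf M) \<Longrightarrow> (\<lambda>y. \<Sum>z\<leftarrow>zs. F z y) \<in> C_inf M"
  by (induction zs) (simp_all add: C_inf_const C_inf_add)

lemma tangent_sum_list:
  assumes M: "smooth_manifold M" and v: "v \<in> tangent M x"
  shows "(\<And>z. z \<in> set zs \<Longrightarrow> F z \<in> C_inf M) \<Longrightarrow> v (\<lambda>y. \<Sum>z\<leftarrow>zs. F z y) = (\<Sum>z\<leftarrow>zs. v (F z))"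
proof (induction zs)
  case Nil then show ?case by (simp add: tangent_zero[OF M v])
next
  case (Cons z zs)
  then show ?case using tangent_add[OF v, of "F z" "\<lambda>y. \<Sum>z\<leftarrow>zs. F z y"] C_inf_sum_list[OF M, of zs F] by simp
qed

abbreviation wedge_at :: "('a \<Rightarrow> 'a vec) list \<Rightarrow> 'a \<Rightarrow> 'a tensor" where
  "wedge_at Xs \<equiv> \<lambda>y. wedge (map (\<lambda>X. X y) Xs)"

lemma bivector_wedge_decomposition:
  assumes M: "smooth_manifold M" and P: "multivector_field M 2 P"
  shows "\<exists>Xss. wedge_decomposition M 2 P p Xss"
proof -
  obtain W \<xi> E and n :: nat where f: "open W" "p \<in> W" "\<And>i. i < n \<Longrightarrow> \<xi> i \<in> C_inf M" "\<And>i. i < n \<Longrightarrow> vector_field M (E i)"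
    "\<And>y f g. y \<in> W \<Longrightarrow> P y [f, g] = (\<Sum>i<n. \<Sum>j<n. P y [\<xi> i, \<xi> j] * E i y f * E j y g)"
    by (rule bivector_frame[OF M P]) (rule that)
  \<comment> \<open>The wedge of two vectors is already antisymmetrised and the sum runs over all
    ordered pairs, so each component of the skew matrix is counted twice; hence the factor
    1/2.\<close>
  define X where "X i j y f = (1 / 2 * P y [\<xi> i, \<xi> j]) * E i y f" for i j y f
  define Xss where "Xss = map (\<lambda>(i, j). [X i j, E j]) (List.product [0..<n] [0..<n])"
  have X: "vector_field M (X i j)" if "i < n" "j < n" for i j
    unfolding X_def[abs_def]
    by (rule vector_field_scale[OF M C_inf_cmult[OF M bivector_smooth[OF P f(3)[OF that(1)] f(3)[OF that(2)]]] f(4)[OF that(1)]])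
  have eq: "P y fs = (\<Sum>Xs\<leftarrow>Xss. wedge_at Xs y fs)" if y: "y \<in> W" for y fs
  proof -
    have S: "(\<Sum>Xs\<leftarrow>Xss. wedge_at Xs y fs) = (\<Sum>i<n. \<Sum>j<n. wedge [X i j y, E j y] fs)"
    proof -
      have "(\<Sum>Xs\<leftarrow>Xss. wedge_at Xs y fs) = (\<Sum>p\<leftarrow>List.product [0..<n] [0..<n]. wedge [X (fst p) (snd p) y, E (snd p) y] fs)"
        by (simp add: Xss_def o_def case_prod_beta)
      also have "\<dots> = (\<Sum>p\<in>{..<n} \<times> {..<n}. wedge [X (fst p) (snd p) y, E (snd p) y] fs)"
        by (subst sum_list_distinct_conv_sum_set) (simp_all add: distinct_product atLeast0LessThan)
      finally show ?thesis by (simp add: sum.cartesian_product case_prod_beta)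
    qed
    show ?thesis
    proof (cases "length fs = 2")
      case False
      then show ?thesis unfolding S using ext_power_length[OF multivector_field_ext[OF P], of fs y] by (simp add: wedge_length)
    next
      case True
      then obtain f g where fs: "fs = [f, g]" by (auto simp: length_Suc_conv numeral_2_eq_2)
      have "(\<Sum>i<n. \<Sum>j<n. wedge [X i j y, E j y] fs) =
          (\<Sum>i<n. \<Sum>j<n. 1 / 2 * (P y [\<xi> i, \<xi> j] * E i y f * E j y g) - 1 / 2 * (P y [\<xi> i, \<xi> j] * E i y g * E j y f))"
        unfolding fs wedge_2 X_def by (simp add: algebra_simps)
      also have "\<dots> = 1 / 2 * P y [f, g] - 1 / 2 * P y [g, f]"
        unfolding f(5)[OF y, of f g] f(5)[OF y, of g f] by (simp only: sum_subtractf sum_distrib_left)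
      also have "\<dots> = P y fs" unfolding fs using bivector_skew[OF P, of y g f] by simp
      finally show ?thesis unfolding S by simp
    qed
  qed
  have "\<forall>Xs\<in>set Xss. length Xs = 2 \<and> (\<forall>X\<in>set Xs. vector_field M X)"
    using X f(4) by (auto simp: Xss_def)
  moreover have "\<exists>U. open U \<and> p \<in> U \<and> (\<forall>y\<in>U. P y = (\<lambda>fs. \<Sum>Xs\<leftarrow>Xss. wedge_at Xs y fs))"
    using f(1,2) eq by blast
  ultimately have "wedge_decomposition M 2 P p Xss" unfolding wedge_decomposition_def by (rule conjI)
  then show ?thesis by (rule exI)
qed

lemma wedge_decomposition_2:
  assumes "wedge_decomposition M 2 P p Xss" "Xs \<in> set Xss"
  obtains a b where "Xs = [a, b]" "vector_field M a" "vector_field M b"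
proof -
  have "length Xs = 2" "\<forall>X\<in>set Xs. vector_field M X" using assms unfolding wedge_decomposition_def by blast+
  then show ?thesis using that by (auto simp: length_Suc_conv numeral_2_eq_2)
qed

text \<open>\<open>P\<close> enters only by its value at \<open>x\<close>, but \<open>Q\<close> is
  differentiated there. Its decomposition is used on a whole neighbourhood, and locality of tangent
  vectors allows the substitution.\<close>

lemma jac_wedge_decomposition:
  assumes M: "smooth_manifold M" and P: "multivector_field M 2 P" and Q: "multivector_field M 2 Q"
    and X: "wedge_decomposition M 2 P x Xss" and Y: "wedge_decomposition M 2 Q x Yss"
    and f: "f \<in> C_inf M" "g \<in> C_inf M" "h \<in> C_inf M"
  shows "jac P Q x f g h = (\<Sum>Xs\<leftarrow>Xss. \<Sum>Ys\<leftarrow>Yss. jac (wedge_at Xs) (wedge_at Ys) x f g h)"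
proof -
  have key: "P x [f, \<lambda>y. Q y [g, h]] = (\<Sum>Xs\<leftarrow>Xss. \<Sum>Ys\<leftarrow>Yss. wedge_at Xs x [f, \<lambda>y. wedge_at Ys y [g, h]])"
    if f: "f \<in> C_inf M" "g \<in> C_inf M" "h \<in> C_inf M" for f g h
  proof -
    have sm: "(\<lambda>y. wedge_at Ys y [g, h]) \<in> C_inf M" if Ys: "Ys \<in> set Yss" for Ys
    proof -
      obtain c d where cd: "Ys = [c, d]" "vector_field M c" "vector_field M d" by (rule wedge_decomposition_2[OF Y Ys])
      show ?thesis unfolding cd(1) list.map wedge_2
        by (intro C_inf_diff[OF M] C_inf_mult[OF M] vector_field_smooth[OF cd(2)] vector_field_smooth[OF cd(3)] f)
    qed
    obtain U where U: "open U" "x \<in> U" "\<And>y. y \<in> U \<Longrightarrow> Q y = (\<lambda>fs. \<Sum>Ys\<leftarrow>Yss. wedge_at Ys y fs)"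
      using Y unfolding wedge_decomposition_def by blast
    obtain U' where U': "x \<in> U'" "\<And>y. y \<in> U' \<Longrightarrow> P y = (\<lambda>fs. \<Sum>Xs\<leftarrow>Xss. wedge_at Xs y fs)"
      using X unfolding wedge_decomposition_def by blast
    have t: "(\<lambda>G. P x [f, G]) \<in> tangent M x" by (rule bivector_tangent(2)[OF P])
    have "P x [f, \<lambda>y. Q y [g, h]] = P x [f, \<lambda>y. \<Sum>Ys\<leftarrow>Yss. wedge_at Ys y [g, h]]"
      by (rule tangent_local[OF M t bivector_smooth[OF Q f(2,3)] C_inf_sum_list[OF M sm] U(1,2)]) (simp_all add: U(3))
    also have "\<dots> = (\<Sum>Ys\<leftarrow>Yss. P x [f, \<lambda>y. wedge_at Ys y [g, h]])"
      by (rule tangent_sum_list[OF M t sm])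
    also have "\<dots> = (\<Sum>Ys\<leftarrow>Yss. \<Sum>Xs\<leftarrow>Xss. wedge_at Xs x [f, \<lambda>y. wedge_at Ys y [g, h]])"
      unfolding U'(2)[OF U'(1)] ..
    finally show ?thesis by (subst sum_list_swap)
  qed
  show ?thesis unfolding jac_def key[OF f] key[OF f(2,3,1)] key[OF f(3,1,2)] by (simp add: sum_list_addf)
qed

text \<open>The two decompositions picked by the choice operator may differ from each other, but
  both orders of pairing them sum to \<open>jac P P\<close>. The second claim fixes the value on all
  remaining lists.\<close>

lemma schouten_bivector:
  assumes M: "smooth_manifold M" and P: "multivector_field M 2 P"
  shows "\<And>f g h. f \<in> C_inf M \<Longrightarrow> g \<in> C_inf M \<Longrightarrow> h \<in> C_inf M \<Longrightarrow> schouten M 2 2 P P x [f, g, h] = 2 * jac P P x f g h"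
    and "\<And>fs. length fs \<noteq> 3 \<or> \<not> set fs \<subseteq> C_inf M \<Longrightarrow> schouten M 2 2 P P x fs = 0"
proof -
  obtain Zss where Z: "wedge_decomposition M 2 P x Zss" using bivector_wedge_decomposition[OF M P] by blast
  have "\<exists>T Xss Yss. wedge_decomposition M 2 P x Xss \<and> wedge_decomposition M 2 P x Yss \<and>
      T = (\<lambda>fs. \<Sum>Xs\<leftarrow>Xss. \<Sum>Ys\<leftarrow>Yss. schouten_wedge Xs Ys x fs)" using Z by blast
  from someI_ex[OF this] obtain Xss Yss where X: "wedge_decomposition M 2 P x Xss" and Y: "wedge_decomposition M 2 P x Yss"
    and S: "schouten M 2 2 P P x = (\<lambda>fs. \<Sum>Xs\<leftarrow>Xss. \<Sum>Ys\<leftarrow>Yss. schouten_wedge Xs Ys x fs)"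
    unfolding schouten_def by blast
  show "schouten M 2 2 P P x [f, g, h] = 2 * jac P P x f g h" if f: "f \<in> C_inf M" "g \<in> C_inf M" "h \<in> C_inf M" for f g h
  proof -
    have "schouten_wedge Xs Ys x [f, g, h] = jac (wedge_at Xs) (wedge_at Ys) x f g h + jac (wedge_at Ys) (wedge_at Xs) x f g h"
      if XY: "Xs \<in> set Xss" "Ys \<in> set Yss" for Xs Ys
    proof -
      obtain a b where ab: "Xs = [a, b]" "vector_field M a" "vector_field M b" by (rule wedge_decomposition_2[OF X XY(1)])
      obtain c d where cd: "Ys = [c, d]" "vector_field M c" "vector_field M d" by (rule wedge_decomposition_2[OF Y XY(2)])
      show ?thesis using schouten_wedge_jac[OF M ab(2,3) cd(2,3) f] unfolding ab(1) cd(1) by simp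
    qed
    then have "schouten M 2 2 P P x [f, g, h] = (\<Sum>Xs\<leftarrow>Xss. \<Sum>Ys\<leftarrow>Yss.
        jac (wedge_at Xs) (wedge_at Ys) x f g h + jac (wedge_at Ys) (wedge_at Xs) x f g h)"
      unfolding S by (simp cong: map_cong)
    also have "\<dots> = (\<Sum>Xs\<leftarrow>Xss. \<Sum>Ys\<leftarrow>Yss. jac (wedge_at Xs) (wedge_at Ys) x f g h)
        + (\<Sum>Ys\<leftarrow>Yss. \<Sum>Xs\<leftarrow>Xss. jac (wedge_at Ys) (wedge_at Xs) x f g h)"
      by (simp add: sum_list_addf sum_list_swap[of _ Yss Xss])
    finally show ?thesis
      using jac_wedge_decomposition[OF M P P X Y f] jac_wedge_decomposition[OF M P P Y X f] by simp
  qed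
  show "schouten M 2 2 P P x fs = 0" if fs: "length fs \<noteq> 3 \<or> \<not> set fs \<subseteq> C_inf M" for fs
  proof -
    have "schouten_wedge Xs Ys x fs = 0" if XY: "Xs \<in> set Xss" "Ys \<in> set Yss" for Xs Ys
    proof -
      obtain a b where ab: "Xs = [a, b]" "vector_field M a" "vector_field M b" by (rule wedge_decomposition_2[OF X XY(1)])
      obtain c d where cd: "Ys = [c, d]" "vector_field M c" "vector_field M d" by (rule wedge_decomposition_2[OF Y XY(2)])
      have t0: "v x f = 0" if "vector_field M v" "f \<notin> C_inf M" for v f x
        using tangent_outside[OF vector_field_tangent[OF that(1)] that(2)] .
      \<comment> \<open>For nonsmooth \<open>f\<close> the inner function is constantly 0, and a
        derivation kills it.\<close>
      have br: "lie_bracket u v x f = 0" if "vector_field M u" "vector_field M v" "f \<notin> C_inf M" for u v f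
        using that by (simp add: lie_bracket_def t0 tangent_zero[OF M vector_field_tangent])
      have w: "wedge [lie_bracket u v x, p x, q x] fs = 0"
        if "vector_field M u" "vector_field M v" "vector_field M p" "vector_field M q" for u v p q
      proof (cases "length fs = 3")
        case True
        then obtain f where "f \<in> set fs" "f \<notin> C_inf M" using fs by blast
        then show ?thesis using that br t0 by (intro wedge_outside[of f]) auto
      qed (simp add: wedge_length)
      show ?thesis unfolding ab(1) cd(1) schouten_wedge_2_2 using w ab cd by simp
    qed
    then show ?thesis unfolding S by (simp cong: map_cong)
  qed
qed

section \<open>Actions of Lie groups\<close>

lemma push_tensor_prod:
  "push N F (tensor_prod vs) fs = tensor_prod (map (push_vec N F) vs) fs"
proof (cases "set fs \<subseteq> C_inf N \<or> length fs \<noteq> length vs")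
  case True
  have "push_vec N F (vs ! i) (fs ! i) = (vs ! i) (\<lambda>x. (fs ! i) (F x))"
    if "length fs = length vs" "set fs \<subseteq> C_inf N" "i < length vs" for i
    using that nth_mem[of i fs] by (simp add: push_vec_def subset_iff)
  then show ?thesis using True by (auto simp: push_def tensor_prod_def)
next
  case False
  then obtain i where i: "i < length vs" "fs ! i \<notin> C_inf N" by (auto simp: subset_iff in_set_conv_nth)
  then have "(\<Prod>i<length vs. (map (push_vec N F) vs ! i) (fs ! i)) = 0"
    by (intro prod_zero) (auto simp: push_vec_def)
  then show ?thesis using False by (simp add: push_def tensor_prod_def)
qed

lemma push_ext_power:
  assumes N: "smooth_manifold N" and pull: "\<And>f. f \<in> C_inf N \<Longrightarrow> (\<lambda>x. f (F x)) \<in> C_inf M"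
    and t: "t \<in> ext_power (tangent M p) k"
  shows "push N F t \<in> ext_power (tangent N (F p)) k"
proof -
  obtain n :: nat and c vs where vs: "\<And>i. i < n \<Longrightarrow> length (vs i) = k \<and> set (vs i) \<subseteq> tangent M p"
    "t = (\<lambda>fs. \<Sum>i<n. c i * tensor_prod (vs i) fs)"
    using t unfolding ext_power_def tensor_power_def by blast
  have "push N F t = (\<lambda>fs. \<Sum>i<n. c i * tensor_prod (map (push_vec N F) (vs i)) fs)"
    unfolding push_tensor_prod[symmetric] vs(2) by (simp add: push_def fun_eq_iff)
  moreover have "\<forall>i<n. length (map (push_vec N F) (vs i)) = k \<and> set (map (push_vec N F) (vs i)) \<subseteq> tangent N (F p)"
    using vs(1) by (simp add: image_subset_iff) (blast intro: push_vec_tangent[where F = F, OF N pull])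
  ultimately have "push N F t \<in> tensor_power (tangent N (F p)) k"
    unfolding tensor_power_def mem_Collect_eq
    by (intro exI[of _ n] exI[of _ c] exI[of _ "\<lambda>i. map (push_vec N F) (vs i)"] conjI)
  moreover have "push N F t (permute_list \<sigma> fs) = of_int (sign \<sigma>) * push N F t fs"
    if s: "\<sigma> permutes {..<k}" "length fs = k" for \<sigma> fs
  proof -
    have "t (permute_list \<sigma> (map (\<lambda>f x. f (F x)) fs)) = of_int (sign \<sigma>) * t (map (\<lambda>f x. f (F x)) fs)"
      using t s unfolding ext_power_def by simp
    then show ?thesis using s by (simp add: push_def permute_list_map)
  qed
  ultimately show ?thesis unfolding ext_power_def by blast
qed

lemma sum_lessThan_add: "(\<Sum>i<m + n. f i) = (\<Sum>i<m. f i) + (\<Sum>i<n. f (m + i) :: real)" for m n :: nat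
  by (induction n) (simp_all add: add.assoc)

lemma ext_power_lincomb:
  assumes t: "t \<in> ext_power V k" and s: "s \<in> ext_power V k"
  shows "(\<lambda>fs. \<alpha> * t fs + \<beta> * s fs) \<in> ext_power V k"
proof -
  obtain n :: nat and c vs where vs: "\<And>i. i < n \<Longrightarrow> length (vs i) = k \<and> set (vs i) \<subseteq> V"
    "t = (\<lambda>fs. \<Sum>i<n. c i * tensor_prod (vs i) fs)"
    using t unfolding ext_power_def tensor_power_def by blast
  obtain m :: nat and d ws where ws: "\<And>i. i < m \<Longrightarrow> length (ws i) = k \<and> set (ws i) \<subseteq> V"
    "s = (\<lambda>fs. \<Sum>i<m. d i * tensor_prod (ws i) fs)"
    using s unfolding ext_power_def tensor_power_def by blast
  have "\<forall>i<n + m. length (if i < n then vs i else ws (i - n)) = k \<and> set (if i < n then vs i else ws (i - n)) \<subseteq> V"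
    using vs(1) ws(1) by auto
  moreover have "(\<lambda>fs. \<alpha> * t fs + \<beta> * s fs) =
    (\<lambda>fs. \<Sum>i<n + m. (if i < n then \<alpha> * c i else \<beta> * d (i - n)) * tensor_prod (if i < n then vs i else ws (i - n)) fs)"
    unfolding sum_lessThan_add vs(2) ws(2) by (simp add: sum_distrib_left mult.assoc)
  ultimately have "(\<lambda>fs. \<alpha> * t fs + \<beta> * s fs) \<in> tensor_power V k"
    unfolding tensor_power_def mem_Collect_eq
    by (intro exI[of _ "n + m"] exI[of _ "\<lambda>i. if i < n then \<alpha> * c i else \<beta> * d (i - n)"]
      exI[of _ "\<lambda>i. if i < n then vs i else ws (i - n)"] conjI)
  moreover have "t (permute_list \<sigma> fs) = of_int (sign \<sigma>) * t fs" "s (permute_list \<sigma> fs) = of_int (sign \<sigma>) * s fs"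
    if "\<sigma> permutes {..<k}" "length fs = k" for \<sigma> fs
    using t s that unfolding ext_power_def by simp_all
  ultimately show ?thesis unfolding ext_power_def by (simp add: algebra_simps)
qed

lemma multivector_field_lincomb:
  assumes M: "smooth_manifold M" and P: "multivector_field M k P" and Q: "multivector_field M k Q"
  shows "multivector_field M k (\<lambda>x fs. \<alpha> * P x fs + \<beta> * Q x fs)"
  unfolding multivector_field_def
  by (intro conjI allI impI ext_power_lincomb multivector_field_ext[OF P] multivector_field_ext[OF Q]
    C_inf_add[OF M] C_inf_cmult[OF M] multivector_field_smooth[OF P] multivector_field_smooth[OF Q])

lemma jac_diff:
  assumes M: "smooth_manifold M" and P: "multivector_field M 2 P" and Q: "multivector_field M 2 Q"
    and f: "f \<in> C_inf M" "g \<in> C_inf M" "h \<in> C_inf M"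
  shows "jac (\<lambda>x fs. P x fs - Q x fs) (\<lambda>x fs. P x fs - Q x fs) x f g h =
    jac P P x f g h - (jac P Q x f g h + jac Q P x f g h) + jac Q Q x f g h"
proof -
  have d: "T x [f, \<lambda>y. P y [g, h] - Q y [g, h]] = T x [f, \<lambda>y. P y [g, h]] - T x [f, \<lambda>y. Q y [g, h]]"
    if "multivector_field M 2 T" "g \<in> C_inf M" "h \<in> C_inf M" for T f g h
    using tangent_diff[OF bivector_tangent(2)[OF that(1)] bivector_smooth[OF P that(2,3)] bivector_smooth[OF Q that(2,3)]] .
  show ?thesis unfolding jac_def d[OF P f(2,3)] d[OF P f(3,1)] d[OF P f(1,2)] d[OF Q f(2,3)] d[OF Q f(3,1)] d[OF Q f(1,2)]
    by simp
qed

section \<open>The infinitesimal action of the Lie algebra\<close>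

locale lie_action =
  fixes MG :: "'g::{t2_space, second_countable_topology} smooth_structure"
    and G :: "'g monoid" (structure)
    and MX :: "'x::{t2_space, second_countable_topology} smooth_structure"
    and act :: "'g \<Rightarrow> 'x \<Rightarrow> 'x"
  assumes lie: "lie_group MG G" and action: "smooth_action MG G MX act"
begin

abbreviation LA :: "'g vec set" where "LA \<equiv> lie_algebra MG G"

lemma MG: "smooth_manifold MG" and MX: "smooth_manifold MX"
  using lie action by (simp_all add: lie_group_def smooth_action_def)

lemma group_G: "group G" and carrier_G: "carrier G = UNIV"
  using lie by (simp_all add: lie_group_def)

lemma one_mult [simp]: "\<one> \<otimes> g = g" and mult_one [simp]: "g \<otimes> \<one> = g" and inv_one [simp]: "inv \<one> = \<one>"
  using group.is_monoid[OF group_G] carrier_G monoid.inv_one[of G]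
  by (simp_all add: monoid.l_one monoid.r_one)

lemma act_mult: "act (g \<otimes> h) x = act g (act h x)"
  using action group_action.composition_rule[of G UNIV act x g h] carrier_G by (simp add: smooth_action_def)

lemma act_one [simp]: "act \<one> x = x"
proof -
  have "(\<lambda>x\<in>UNIV. x) = act \<one>" using action group_action.id_eq_one[of G UNIV act] by (simp add: smooth_action_def)
  then show ?thesis by (metis UNIV_I restrict_apply)
qed

lemma LA_tangent: "a \<in> LA \<Longrightarrow> a \<in> tangent MG \<one>"
  by (simp add: lie_algebra_def)

lemma C_inf_act: "f \<in> C_inf MX \<Longrightarrow> (\<lambda>z. f (act (fst z) (snd z))) \<in> C_inf (prod_manifold MG MX)"
  using C_inf_comp[OF smooth_manifold_prod[OF MG MX] MX, of "\<lambda>(g, x). act g x" f] action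
  by (simp add: smooth_action_def case_prod_beta)

lemma C_inf_orbit: "f \<in> C_inf MX \<Longrightarrow> (\<lambda>g. f (act g x)) \<in> C_inf MG"
  using C_inf_slice_fst[OF MG MX C_inf_act] by simp

lemma C_inf_translate: "f \<in> C_inf MX \<Longrightarrow> (\<lambda>x. f (act g x)) \<in> C_inf MX"
  using C_inf_slice_snd[OF MG MX C_inf_act] by simp

lemma C_inf_group_mult: "f \<in> C_inf MG \<Longrightarrow> (\<lambda>z. f (fst z \<otimes> snd z)) \<in> C_inf (prod_manifold MG MG)"
  using C_inf_comp[OF smooth_manifold_prod[OF MG MG] MG, of "\<lambda>(g, h). g \<otimes> h" f] lie
  by (simp add: lie_group_def case_prod_beta)

lemma C_inf_right_translate: "f \<in> C_inf MG \<Longrightarrow> (\<lambda>h. f (h \<otimes> g)) \<in> C_inf MG"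
  using C_inf_slice_fst[OF MG MG C_inf_group_mult] by simp

text \<open>The derivative of \<open>f\<close> along the fundamental field of \<open>a\<close>, with
  the point as last argument so that \<open>dact a f\<close> is again a function on the
  space.\<close>

definition dact :: "'g vec \<Rightarrow> ('x \<Rightarrow> real) \<Rightarrow> 'x \<Rightarrow> real" where
  "dact a f x = a (\<lambda>g. f (act g x))"

lemma C_inf_dact: "a \<in> LA \<Longrightarrow> f \<in> C_inf MX \<Longrightarrow> dact a f \<in> C_inf MX"
  using C_inf_tangent_fst[OF MG MX C_inf_act LA_tangent] by (simp add: dact_def[abs_def])

lemma dact_tangent_commute:
  assumes "a \<in> LA" "v \<in> tangent MX x" "f \<in> C_inf MX"
  shows "a (\<lambda>k. v (\<lambda>y. f (act k y))) = v (dact a f)"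
  using tangent_commute[OF MG MX C_inf_act[OF assms(3)] LA_tangent[OF assms(1)] assms(2)]
  by (simp add: dact_def[abs_def])

text \<open>Left invariant fields make \<open>u\<close> act on the left factor of
  \<open>f ((g h) x) = f (g (h x))\<close> and \<open>v\<close> on the right one. On the space,
  however, the right factor is met first, so after \<open>tangent_commute\<close> the derivation
  \<open>v\<close> stands outside and the bracket changes sign.\<close>

lemma alg_bracket_orbit:
  assumes u: "u \<in> LA" and v: "v \<in> LA" and f: "f \<in> C_inf MX"
  shows "alg_bracket MG G u v (\<lambda>g. f (act g x)) = dact v (dact u f) x - dact u (dact v f) x"
proof -
  let ?F = "\<lambda>g. f (act g x)"
  note F = C_inf_orbit[OF f, of x]
  note t = C_inf_tangent_snd[OF MG MG C_inf_group_mult[OF F]]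
  have c: "a (\<lambda>g. b (\<lambda>h. ?F (g \<otimes> h))) = dact b (dact a f) x" if a: "a \<in> LA" and b: "b \<in> LA" for a b
    using tangent_commute[OF MG MG C_inf_group_mult[OF F] LA_tangent[OF a] LA_tangent[OF b]]
    by (simp add: dact_def[abs_def] act_mult)
  show ?thesis
    using F t[OF LA_tangent[OF u]] t[OF LA_tangent[OF v]] c[OF u v] c[OF v u]
    by (simp add: alg_bracket_def lie_bracket_def push_vec_def)
qed

end

section \<open>Twisting\<close>

lemma tensor_decomposition_exists:
  assumes r: "r \<in> ext_power (tangent M p) 2"
  shows "\<exists>ps. tensor_decomposition (tangent M p) r ps"
proof -
  obtain n :: nat and c vs where vs: "\<And>i. i < n \<Longrightarrow> length (vs i) = 2 \<and> set (vs i) \<subseteq> tangent M p"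
    "r = (\<lambda>fs. \<Sum>i<n. c i * tensor_prod (vs i) fs)"
    using r unfolding ext_power_def tensor_power_def by blast
  \<comment> \<open>A presentation carries no coefficients, so \<open>c i\<close> is absorbed into
    the first factor.\<close>
  define ps where "ps = map (\<lambda>i. (\<lambda>f. c i * (vs i ! 0) f, vs i ! 1)) [0..<n]"
  have "(\<lambda>f. c i * (vs i ! 0) f) \<in> tangent M p \<and> vs i ! 1 \<in> tangent M p" if i: "i < n" for i
  proof -
    have v: "vs i ! 0 \<in> tangent M p" "vs i ! 1 \<in> tangent M p"
      using vs(1)[OF i] nth_mem[of 0 "vs i"] nth_mem[of 1 "vs i"] by auto
    show ?thesis using tangent_lincomb[OF v(1) v(1), of "c i" 0] v(2) by simp
  qed
  moreover have "c i * tensor_prod (vs i) fs = tensor_prod [\<lambda>f. c i * (vs i ! 0) f, vs i ! 1] fs" if "i < n" for i fs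
    using vs(1)[OF that] by (simp add: tensor_prod_def numeral_2_eq_2)
  then have "r = (\<lambda>fs. \<Sum>(a, b)\<leftarrow>ps. tensor_prod [a, b] fs)"
    unfolding vs(2) ps_def by (simp add: o_def interv_sum_list_conv_sum_set_nat atLeast0LessThan)
  ultimately show ?thesis
    unfolding tensor_decomposition_def by (intro exI[of _ ps] conjI) (auto simp: ps_def)
qed

lemma sum_list_pairs: "(\<Sum>(a, b)\<leftarrow>ps. F a b) = (\<Sum>i<length ps. F (fst (ps ! i)) (snd (ps ! i)) :: real)"
  by (simp add: sum_list_sum_nth atLeast0LessThan case_prod_beta)

context lie_action
begin

lemma push_orbit_tangent: "a \<in> LA \<Longrightarrow> push_vec MX (\<lambda>g. act g x) a \<in> tangent MX x"
  using push_vec_tangent[where F = "\<lambda>g. act g x", OF MX C_inf_orbit LA_tangent, of a] by simp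

lemma fundamental_ext_power: "t \<in> ext_power LA k \<Longrightarrow> fundamental MX act t x \<in> ext_power (tangent MX x) k"
  using push_ext_power[where F = "\<lambda>g. act g x", OF MX C_inf_orbit, of t \<one> k]
  by (simp add: fundamental_def lie_algebra_def)

text \<open>The compatibility condition of a quasi-Poisson action, separated from the Schouten
  identity because twisting changes the two for different reasons.\<close>

definition multiplicative_field :: "('g \<Rightarrow> 'g tensor) \<Rightarrow> ('x \<Rightarrow> 'x tensor) \<Rightarrow> bool" where
  "multiplicative_field PG P \<longleftrightarrow> (\<forall>g x fs. P (act g x) fs =
     push MX (act g) (P x) fs + push MX (\<lambda>h. act h x) (PG g) fs)"

lemma quasi_poisson_action_iff:
  "quasi_poisson_action MG G PG \<phi> MX act P \<longleftrightarrow> multivector_field MX 2 P \<and> multiplicative_field PG P \<and>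
    (\<forall>x fs. 1 / 2 * schouten MX 2 2 P P x fs = fundamental MX act \<phi> x fs)"
  using action by (simp add: quasi_poisson_action_def multiplicative_field_def)

lemma multiplicative_field_eval:
  assumes "multiplicative_field PG P" "f \<in> C_inf MX" "g \<in> C_inf MX"
  shows "P (act k x) [f, g] = P x [\<lambda>y. f (act k y), \<lambda>y. g (act k y)] + PG k [\<lambda>h. f (act h x), \<lambda>h. g (act h x)]"
  using assms by (simp add: multiplicative_field_def push_def)

section \<open>The differential of eta and Lie derivatives along fundamental fields\<close>

context
  fixes PG :: "'g \<Rightarrow> 'g tensor"
  assumes PG: "multivector_field MG 2 PG"
    and PG_mult: "\<And>g h fs. PG (g \<otimes> h) fs = push MG (\<lambda>k. g \<otimes> k) (PG h) fs + push MG (\<lambda>k. k \<otimes> h) (PG g) fs"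
begin

text \<open>At the unit, multiplicativity reads \<open>P = P + P\<close>.\<close>

lemma PG_one: "f \<in> C_inf MG \<Longrightarrow> g \<in> C_inf MG \<Longrightarrow> PG \<one> [f, g] = 0"
  using PG_mult[of \<one> \<one> "[f, g]"] by (simp add: push_def)

abbreviation eta_pair :: "('g \<Rightarrow> real) \<Rightarrow> ('g \<Rightarrow> real) \<Rightarrow> 'g \<times> 'g \<Rightarrow> real" where
  "eta_pair f g \<equiv> \<lambda>z. PG (fst z) [\<lambda>h. f (h \<otimes> snd z), \<lambda>h. g (h \<otimes> snd z)]"

lemma C_inf_eta_pair: "f \<in> C_inf MG \<Longrightarrow> g \<in> C_inf MG \<Longrightarrow> eta_pair f g \<in> C_inf (prod_manifold MG MG)"
  using C_inf_bivector_param[OF MG MG PG C_inf_group_mult C_inf_group_mult, of f g] by simp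

lemma eta_eq: "f \<in> C_inf MG \<Longrightarrow> g \<in> C_inf MG \<Longrightarrow> eta MG G PG k [f, g] = eta_pair f g (k, inv k)"
  by (simp add: eta_def push_def)

text \<open>\<open>eta k\<close> is the value of \<open>eta_pair\<close> at \<open>(k, inv k)\<close>; the derivative in the second argument drops out, as
  \<open>PG\<close> vanishes at the unit.\<close>

lemma delta_eq:
  assumes a: "a \<in> LA" and f: "f \<in> C_inf MG" and g: "g \<in> C_inf MG"
  shows "delta MG G PG a [f, g] = a (\<lambda>k. PG k [f, g])"
proof -
  have inv: "smooth_map MG MG (\<lambda>g. inv g)" using lie by (simp add: lie_group_def)
  have "a (\<lambda>k. eta_pair f g (k, inv k)) = a (\<lambda>k. eta_pair f g (k, inv \<one>)) + a (\<lambda>k. eta_pair f g (\<one>, inv k))"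
    by (rule tangent_diagonal[where K = "eta_pair f g" and F = "\<lambda>k. k" and G = "\<lambda>k. inv k",
      OF MG MG MG smooth_map_id[OF MG] inv C_inf_eta_pair[OF f g] LA_tangent[OF a]])
  also have "(\<lambda>k. eta_pair f g (\<one>, inv k)) = (\<lambda>k. 0)"
    using PG_one[OF C_inf_right_translate[OF f] C_inf_right_translate[OF g]] by simp
  also have "a (\<lambda>k. 0) = 0" by (rule tangent_zero[OF MG LA_tangent[OF a]])
  finally show ?thesis unfolding delta_def eta_eq[OF f g] by simp
qed

lemma delta_skew:
  assumes "a \<in> LA" "f \<in> C_inf MG" "g \<in> C_inf MG"
  shows "delta MG G PG a [g, f] = - delta MG G PG a [f, g]"
  using tangent_cmult[OF LA_tangent[OF assms(1)] bivector_smooth[OF PG assms(2,3)], of "-1"]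
  by (simp add: delta_eq assms bivector_skew[OF PG, of _ g f])

lemma lie_derivative_delta:
  assumes P: "multivector_field MX 2 P" and mult: "multiplicative_field PG P"
    and a: "a \<in> LA" and f: "f \<in> C_inf MX" and g: "g \<in> C_inf MX"
  shows "dact a (\<lambda>y. P y [f, g]) x - P x [dact a f, g] - P x [f, dact a g] =
    delta MG G PG a [\<lambda>h. f (act h x), \<lambda>h. g (act h x)]"
proof -
  obtain n :: nat and c u v where uv: "\<And>i. i < n \<Longrightarrow> u i \<in> tangent MX x \<and> v i \<in> tangent MX x"
    "\<And>f g. P x [f, g] = (\<Sum>i<n. c i * u i f * v i g)"
    by (rule ext_power_2E[OF multivector_field_ext[OF P]]) (rule that)
  \<comment> \<open>The term of \<open>P (act k x)\<close> pushed forward from \<open>x\<close>. Its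
    vectors \<open>u i\<close>, \<open>v i\<close> stay at \<open>x\<close> while only the functions
    move with \<open>k\<close>, so \<open>a\<close> acts by the product rule and then passes inside
    \<open>u i\<close> and \<open>v i\<close>.\<close>
  let ?A = "\<lambda>k. \<Sum>i<n. c i * (u i (\<lambda>y. f (act k y)) * v i (\<lambda>y. g (act k y)))"
  have sm: "(\<lambda>k. w (\<lambda>y. q (act k y))) \<in> C_inf MG" if "w \<in> tangent MX x" "q \<in> C_inf MX" for w q
    using C_inf_tangent_snd[OF MG MX C_inf_act[OF that(2)] that(1)] by simp
  have tA: "(\<lambda>k. c i * (u i (\<lambda>y. f (act k y)) * v i (\<lambda>y. g (act k y)))) \<in> C_inf MG" if "i \<in> {..<n}" for i
    using that uv(1) by (intro C_inf_cmult[OF MG] C_inf_mult[OF MG] sm f g) auto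
  have sA: "?A \<in> C_inf MG" by (rule C_inf_sum[OF MG finite_lessThan]) (rule tA)
  have "a ?A = (\<Sum>i<n. a (\<lambda>k. c i * (u i (\<lambda>y. f (act k y)) * v i (\<lambda>y. g (act k y)))))"
    by (rule tangent_sum[OF MG LA_tangent[OF a] finite_lessThan]) (rule tA)
  also have "\<dots> = (\<Sum>i<n. c i * (u i (dact a f) * v i g + u i f * v i (dact a g)))"
  proof (rule sum.cong[OF refl])
    fix i assume "i \<in> {..<n}"
    then have t: "u i \<in> tangent MX x" "v i \<in> tangent MX x" using uv(1) by auto
    show "a (\<lambda>k. c i * (u i (\<lambda>y. f (act k y)) * v i (\<lambda>y. g (act k y)))) =
        c i * (u i (dact a f) * v i g + u i f * v i (dact a g))"
      using tangent_cmult[OF LA_tangent[OF a] C_inf_mult[OF MG sm[OF t(1) f] sm[OF t(2) g]], of "c i"]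
        tangent_mult[OF LA_tangent[OF a] sm[OF t(1) f] sm[OF t(2) g]]
        dact_tangent_commute[OF a t(1) f] dact_tangent_commute[OF a t(2) g] by simp
  qed
  also have "\<dots> = P x [dact a f, g] + P x [f, dact a g]"
    by (simp add: uv(2) sum.distrib algebra_simps)
  finally have aA: "a ?A = P x [dact a f, g] + P x [f, dact a g]" .
  have "dact a (\<lambda>y. P y [f, g]) x = a (\<lambda>k. ?A k + PG k [\<lambda>h. f (act h x), \<lambda>h. g (act h x)])"
    unfolding dact_def multiplicative_field_eval[OF mult f g] uv(2) by (simp add: mult.assoc)
  also have "\<dots> = a ?A + a (\<lambda>k. PG k [\<lambda>h. f (act h x), \<lambda>h. g (act h x)])"
    by (rule tangent_add[OF LA_tangent[OF a] sA bivector_smooth[OF PG C_inf_orbit[OF f] C_inf_orbit[OF g]]])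
  finally show ?thesis using aA by (simp add: delta_eq a C_inf_orbit f g)
qed

end

end

section \<open>The twist element and its bivector field\<close>

locale lie_action_twist = lie_action MG G MX act
  for MG :: "'g::{t2_space, second_countable_topology} smooth_structure"
    and G :: "'g monoid" (structure)
    and MX :: "'x::{t2_space, second_countable_topology} smooth_structure"
    and act :: "'g \<Rightarrow> 'x \<Rightarrow> 'x" +
  fixes r :: "'g tensor"
  assumes r: "r \<in> ext_power LA 2"
begin

text \<open>The presentation \<open>r = \<Sum>\<^sub>i A i \<otimes> B i\<close> that \<^const>\<open>CYB\<close> and \<^const>\<open>tensor_map_id\<close> choose.\<close>

definition "ps = (SOME ps. tensor_decomposition LA r ps)"
definition "n = length ps"
definition "A i = fst (ps ! i)"
definition "B i = snd (ps ! i)"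

lemma ps_decomposition: "tensor_decomposition LA r ps"
  unfolding ps_def
  by (rule someI_ex) (use tensor_decomposition_exists[of r MG \<one>] r in \<open>simp add: lie_algebra_def\<close>)

lemma A_LA: "i < n \<Longrightarrow> A i \<in> LA" and B_LA: "i < n \<Longrightarrow> B i \<in> LA"
  using ps_decomposition nth_mem[of i ps] unfolding tensor_decomposition_def n_def A_def B_def
  by (auto simp: case_prod_beta)

lemma r_eval: "r [F, F'] = (\<Sum>i<n. A i F * B i F')"
proof -
  have "r = (\<lambda>fs. \<Sum>(a, b)\<leftarrow>ps. tensor_prod [a, b] fs)"
    using ps_decomposition unfolding tensor_decomposition_def by (rule conjunct2)
  from fun_cong[OF this, of "[F, F']"] show ?thesis
    by (simp add: sum_list_pairs n_def A_def B_def tensor_prod_2)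
qed

text \<open>In terms of a presentation, skew-symmetry says that exchanging \<open>A\<close> and
  \<open>B\<close> costs a sign. Keeping \<open>F\<close> and \<open>F'\<close> arbitrary lets it be
  applied to functions on the group that arise from further differentiation.\<close>

lemma r_skew: "(\<Sum>i<n. A i F * B i F') = - (\<Sum>i<n. B i F * A i F')"
  using ext_power_2_skew[OF r, of F F'] unfolding r_eval by (simp add: mult.commute)

abbreviation R :: "'x \<Rightarrow> 'x tensor" where "R \<equiv> fundamental MX act r"

lemma R_eval: "f \<in> C_inf MX \<Longrightarrow> g \<in> C_inf MX \<Longrightarrow> R x [f, g] = (\<Sum>i<n. dact (A i) f x * dact (B i) g x)"
  by (simp add: fundamental_def push_def r_eval dact_def)

lemma R_bivector: "multivector_field MX 2 R"
  unfolding multivector_field_def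
proof (intro conjI allI impI fundamental_ext_power r)
  fix fs :: "('x \<Rightarrow> real) list" assume fs: "length fs = 2" "set fs \<subseteq> C_inf MX"
  then obtain f g where fg: "fs = [f, g]" "f \<in> C_inf MX" "g \<in> C_inf MX" by (auto simp: length_Suc_conv numeral_2_eq_2)
  have "(\<lambda>x. \<Sum>i<n. dact (A i) f x * dact (B i) g x) \<in> C_inf MX"
    by (intro C_inf_sum[OF MX finite_lessThan] C_inf_mult[OF MX] C_inf_dact fg A_LA B_LA) simp_all
  then show "(\<lambda>x. R x fs) \<in> C_inf MX" by (simp add: fg R_eval)
qed

text \<open>The exchange of \<open>A\<close> and \<open>B\<close> underneath another derivation
  \<open>w\<close>: commuting past \<open>w\<close> reduces it to \<open>r_skew\<close> for the
  function on the group that sends \<open>k\<close> to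
  \<open>w (\<lambda>y. f (act k y))\<close>.\<close>

lemma twist_skew_tangent:
  assumes w: "w \<in> tangent MX x" and f: "f \<in> C_inf MX"
  shows "(\<Sum>i<n. A i F * w (dact (B i) f)) = - (\<Sum>i<n. B i F * w (dact (A i) f))"
  using r_skew[of F "\<lambda>k. w (\<lambda>y. f (act k y))"] dact_tangent_commute[OF A_LA w f] dact_tangent_commute[OF B_LA w f]
  by simp

lemma tangent_R:
  assumes w: "w \<in> tangent MX x" and f: "f \<in> C_inf MX" and g: "g \<in> C_inf MX"
  shows "w (\<lambda>y. R y [f, g]) = (\<Sum>i<n. w (dact (A i) f) * dact (B i) g x + dact (A i) f x * w (dact (B i) g))"
proof -
  have "w (\<lambda>y. R y [f, g]) = w (\<lambda>y. \<Sum>i<n. dact (A i) f y * dact (B i) g y)" by (simp add: R_eval f g)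
  also have "\<dots> = (\<Sum>i<n. w (\<lambda>y. dact (A i) f y * dact (B i) g y))"
    by (rule tangent_sum[OF MX w finite_lessThan]) (intro C_inf_mult[OF MX] C_inf_dact A_LA B_LA f g; simp)
  also have "\<dots> = (\<Sum>i<n. w (dact (A i) f) * dact (B i) g x + dact (A i) f x * w (dact (B i) g))"
    by (rule sum.cong[OF refl], rule tangent_mult[OF w]) (simp_all add: C_inf_dact A_LA B_LA f g)
  finally show ?thesis .
qed

text \<open>The skew-symmetry of \<open>r\<close> moves all derivatives to the factors \<open>A i\<close>; the terms that share the factor
  \<open>B i h\<close> then form the Lie derivative of \<open>P\<close> along the field of \<open>A i\<close>.\<close>

lemma jac_mixed:
  fixes x :: 'x
  assumes P: "multivector_field MX 2 P" and f: "f \<in> C_inf MX" "g \<in> C_inf MX" "h \<in> C_inf MX"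
  defines "L \<equiv> \<lambda>i f g. dact (A i) (\<lambda>y. P y [f, g]) x - P x [dact (A i) f, g] - P x [f, dact (A i) g]"
  shows "jac P R x f g h + jac R P x f g h =
    - (\<Sum>i<n. L i f g * dact (B i) h x + L i g h * dact (B i) f x + L i h f * dact (B i) g x)"
proof -
  have PR: "P x [f, \<lambda>y. R y [g, h]] =
      (\<Sum>i<n. P x [f, dact (A i) g] * dact (B i) h x - dact (B i) g x * P x [f, dact (A i) h])"
    if "g \<in> C_inf MX" "h \<in> C_inf MX" for f g h
    using tangent_R[OF bivector_tangent(2)[OF P] that, of x f]
      twist_skew_tangent[OF bivector_tangent(2)[OF P] that(2), of "\<lambda>k. g (act k x)" x f]
    by (simp add: sum.distrib sum_subtractf dact_def)
  have RP: "R x [f, \<lambda>y. P y [g, h]] = - (\<Sum>i<n. dact (B i) f x * dact (A i) (\<lambda>y. P y [g, h]) x)"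
    if "f \<in> C_inf MX" "g \<in> C_inf MX" "h \<in> C_inf MX" for f g h
    using r_skew[of "\<lambda>k. f (act k x)" "\<lambda>k. P (act k x) [g, h]"]
    by (simp add: R_eval that bivector_smooth[OF P] dact_def)
  have sk: "P x [dact a u, v] = - P x [v, dact a u]" for a u v by (rule bivector_skew[OF P])
  show ?thesis
    unfolding jac_def PR[OF f(2,3)] PR[OF f(3,1)] PR[OF f(1,2)] RP[OF f] RP[OF f(2,3,1)] RP[OF f(3,1,2)] L_def
    by (simp add: sk sum.distrib sum_subtractf sum_negf algebra_simps)
qed

text \<open>Each of the three cyclic terms gives two double sums. Those of the first already have
  the shape of halves of summands of \<open>CYB\<close>; skew-symmetry brings the other four,
  \<open>e3\<close> to \<open>e6\<close>, to that shape as well, and the six pair into three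
  commutators. The bracket reversal accounts for the minus sign.\<close>

lemma jac_R:
  assumes f: "f \<in> C_inf MX" "g \<in> C_inf MX" "h \<in> C_inf MX"
  shows "jac R R x f g h = - CYB MG G r [\<lambda>k. f (act k x), \<lambda>k. g (act k x), \<lambda>k. h (act k x)]"
proof -
  define a where "a i f = dact (A i) f x" for i f
  define b where "b i f = dact (B i) f x" for i f
  define t where "t u v f = dact u (dact v f) x" for u v f
  have RR: "R x [f, \<lambda>y. R y [g, h]] = (\<Sum>i<n. \<Sum>j<n. a i f * t (B i) (A j) g * b j h)
      + (\<Sum>i<n. \<Sum>j<n. a i f * a j g * t (B i) (B j) h)"
    if "f \<in> C_inf MX" "g \<in> C_inf MX" "h \<in> C_inf MX" for f g h
  proof -
    have "R x [f, \<lambda>y. R y [g, h]] = (\<Sum>i<n. dact (A i) f x * dact (B i) (\<lambda>y. R y [g, h]) x)"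
      by (rule R_eval[OF that(1) bivector_smooth[OF R_bivector that(2,3)]])
    also have "\<dots> = (\<Sum>i<n. dact (A i) f x * (\<Sum>j<n. t (B i) (A j) g * dact (B j) h x + dact (A j) g x * t (B i) (B j) h))"
    proof (rule sum.cong[OF refl])
      fix i assume "i \<in> {..<n}"
      then have i: "B i \<in> LA" by (simp add: B_LA)
      show "dact (A i) f x * dact (B i) (\<lambda>y. R y [g, h]) x =
          dact (A i) f x * (\<Sum>j<n. t (B i) (A j) g * dact (B j) h x + dact (A j) g x * t (B i) (B j) h)"
        using tangent_R[OF push_orbit_tangent[OF i, of x] that(2,3)] bivector_smooth[OF R_bivector that(2,3)]
          dact_def[of "B i" "\<lambda>y. R y [g, h]" x]
        by (simp add: push_vec_def dact_def[symmetric] t_def C_inf_dact A_LA B_LA that)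
    qed
    finally show ?thesis by (simp add: a_def b_def sum.distrib sum_distrib_left algebra_simps)
  qed
  \<comment> \<open>\<open>sk1\<close> exchanges \<open>A\<close> and \<open>B\<close> in the outer
    derivation, \<open>sk2\<close> in the inner one, which is itself being differentiated and so
    requires commutation.\<close>
  have sk1: "(\<Sum>i<n. a i f * t (B i) v g) = - (\<Sum>i<n. b i f * t (A i) v g)" for v f g
    unfolding t_def a_def b_def using r_skew[of "\<lambda>k. f (act k x)" "\<lambda>k. dact v g (act k x)"] by (simp add: dact_def)
  have sk2: "(\<Sum>i<n. a i f * t u (B i) g) = - (\<Sum>i<n. b i f * t u (A i) g)"
    if "u \<in> LA" "g \<in> C_inf MX" for u f g
    using twist_skew_tangent[OF push_orbit_tangent[OF that(1), of x] that(2), of "\<lambda>k. f (act k x)"]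
    by (simp add: a_def b_def push_vec_def dact_def[symmetric] t_def C_inf_dact A_LA B_LA that)
  have br: "dact (alg_bracket MG G u v) f x = t v u f - t u v f" if "u \<in> LA" "v \<in> LA" "f \<in> C_inf MX" for u v f
    unfolding t_def dact_def[of "alg_bracket MG G u v"] by (rule alg_bracket_orbit[OF that])
  \<comment> \<open>Two exchanges, one inner and one outer, so the sign stays positive.\<close>
  have e4: "(\<Sum>i<n. \<Sum>j<n. a i g * a j h * t (B i) (B j) f) =
      (\<Sum>i<n. \<Sum>j<n. t (A i) (A j) f * b i g * b j h)"
  proof -
    have "(\<Sum>i<n. \<Sum>j<n. a i g * a j h * t (B i) (B j) f) =
        (\<Sum>i<n. a i g * (\<Sum>j<n. a j h * t (B i) (B j) f))"
      by (simp add: sum_distrib_left mult.assoc)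
    also have "\<dots> = (\<Sum>i<n. \<Sum>j<n. - (b j h * (a i g * t (B i) (A j) f)))"
      by (rule sum.cong[OF refl]) (simp add: sk2 B_LA f sum_distrib_left sum_negf mult_ac)
    also have "\<dots> = - (\<Sum>j<n. b j h * (\<Sum>i<n. a i g * t (B i) (A j) f))"
      by (subst sum.swap) (simp add: sum_distrib_left sum_negf)
    also have "\<dots> = (\<Sum>j<n. \<Sum>i<n. t (A i) (A j) f * b i g * b j h)"
      by (simp add: sk1 sum_distrib_left sum_negf mult_ac)
    finally show ?thesis by (subst sum.swap)
  qed
  have e5: "(\<Sum>i<n. \<Sum>j<n. a i h * t (B i) (A j) f * b j g) =
      - (\<Sum>i<n. \<Sum>j<n. t (A j) (A i) f * b i g * b j h)"
  proof -
    have "(\<Sum>i<n. \<Sum>j<n. a i h * t (B i) (A j) f * b j g) =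
        (\<Sum>j<n. (\<Sum>i<n. a i h * t (B i) (A j) f) * b j g)"
      by (subst sum.swap) (simp add: sum_distrib_right)
    then show ?thesis by (simp add: sk1 sum_distrib_left sum_distrib_right sum_negf mult_ac)
  qed
  have e6: "(\<Sum>i<n. \<Sum>j<n. a i h * a j f * t (B i) (B j) g) =
      - (\<Sum>i<n. \<Sum>j<n. a i f * t (A j) (B i) g * b j h)"
  proof -
    have "(\<Sum>i<n. \<Sum>j<n. a i h * a j f * t (B i) (B j) g) =
        (\<Sum>j<n. a j f * (\<Sum>i<n. a i h * t (B i) (B j) g))"
      by (subst sum.swap) (simp add: sum_distrib_left mult_ac)
    then show ?thesis by (simp add: sk1 sum_distrib_left sum_negf mult_ac)
  qed
  have e3: "(\<Sum>i<n. \<Sum>j<n. a i g * t (B i) (A j) h * b j f) =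
      - (\<Sum>i<n. \<Sum>j<n. a i f * a j g * t (B j) (B i) h)"
  proof -
    have "(\<Sum>i<n. \<Sum>j<n. a i g * t (B i) (A j) h * b j f) =
        (\<Sum>i<n. - (a i g * (\<Sum>j<n. a j f * t (B i) (B j) h)))"
      by (rule sum.cong[OF refl]) (simp add: sk2 B_LA f sum_distrib_left sum_negf mult_ac)
    also have "\<dots> = - (\<Sum>i<n. \<Sum>j<n. a j f * a i g * t (B i) (B j) h)"
      by (simp add: sum_distrib_left sum_negf mult_ac)
    finally show ?thesis by (subst (asm) sum.swap)
  qed
  have C: "CYB MG G r [\<lambda>k. f (act k x), \<lambda>k. g (act k x), \<lambda>k. h (act k x)] =
      (\<Sum>i<n. \<Sum>j<n. (t (A j) (A i) f - t (A i) (A j) f) * b i g * b j h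
        + a i f * (t (A j) (B i) g - t (B i) (A j) g) * b j h
        + a i f * a j g * (t (B j) (B i) h - t (B i) (B j) h))"
    unfolding CYB_def Let_def ps_def[symmetric] sum_list_pairs n_def[symmetric] A_def[symmetric] B_def[symmetric] tensor_prod_3
    by (intro sum.cong refl) (simp add: br A_LA B_LA f dact_def[symmetric] a_def b_def)
  show ?thesis
    unfolding jac_def RR[OF f] RR[OF f(2,3,1)] RR[OF f(3,1,2)] e3 e4 e5 e6 C
    by (simp add: sum.distrib sum_subtractf algebra_simps)
qed

section \<open>Effect of twisting on the Jacobiator and the Schouten square\<close>

context
  fixes PG :: "'g \<Rightarrow> 'g tensor"
  assumes PG: "multivector_field MG 2 PG"
    and PG_mult: "\<And>g h fs. PG (g \<otimes> h) fs = push MG (\<lambda>k. g \<otimes> k) (PG h) fs + push MG (\<lambda>k. k \<otimes> h) (PG g) fs"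
begin

text \<open>Values of \<open>delta\<close> are skew, so the six terms of the alternation coincide in
  pairs; the factor 1/2 leaves the cyclic sum that \<open>jac_mixed\<close> produces.\<close>

lemma half_Alt_delta:
  assumes F: "F1 \<in> C_inf MG" "F2 \<in> C_inf MG" "F3 \<in> C_inf MG"
  defines "d \<equiv> delta MG G PG"
  shows "1 / 2 * Alt 3 (tensor_map_id LA 2 d r) [F1, F2, F3] =
    (\<Sum>i<n. d (A i) [F1, F2] * B i F3 + d (A i) [F2, F3] * B i F1 + d (A i) [F3, F1] * B i F2)"
proof -
  have t: "tensor_map_id LA 2 d r [f, g, h] = (\<Sum>i<n. d (A i) [f, g] * B i h)" for f g h
    unfolding tensor_map_id_def Let_def ps_def[symmetric] sum_list_pairs n_def[symmetric] A_def[symmetric] B_def[symmetric]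
    by (simp add: numeral_2_eq_2)
  have s: "d (A i) [g, f] = - d (A i) [f, g]" if "i < n" "f \<in> C_inf MG" "g \<in> C_inf MG" for i f g
    unfolding d_def by (rule delta_skew[OF PG PG_mult A_LA[OF that(1)] that(2,3)])
  have "(\<Sum>i<n. d (A i) [g, f] * B i h) = - (\<Sum>i<n. d (A i) [f, g] * B i h)"
    if "f \<in> C_inf MG" "g \<in> C_inf MG" for f g h
    unfolding sum_negf[symmetric] by (rule sum.cong[OF refl]) (simp add: s[OF _ that])
  from this[OF F(1,2)] this[OF F(2,3)] this[OF F(3,1)] show ?thesis
    unfolding Alt_3 t by (simp add: sum.distrib)
qed

lemma jac_twist:
  assumes P: "multivector_field MX 2 P" and mult: "multiplicative_field PG P"
    and f: "f \<in> C_inf MX" "g \<in> C_inf MX" "h \<in> C_inf MX"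
  shows "jac (\<lambda>x fs. P x fs - R x fs) (\<lambda>x fs. P x fs - R x fs) x f g h = jac P P x f g h +
    (1 / 2 * Alt 3 (tensor_map_id LA 2 (delta MG G PG) r) [\<lambda>k. f (act k x), \<lambda>k. g (act k x), \<lambda>k. h (act k x)]
      - CYB MG G r [\<lambda>k. f (act k x), \<lambda>k. g (act k x), \<lambda>k. h (act k x)])"
proof -
  have B: "B i (\<lambda>k. q (act k x)) = dact (B i) q x" for i q by (simp add: dact_def)
  show ?thesis
    unfolding jac_diff[OF MX P R_bivector f] jac_mixed[OF P f] jac_R[OF f]
      half_Alt_delta[OF C_inf_orbit[OF f(1)] C_inf_orbit[OF f(2)] C_inf_orbit[OF f(3)]] B
    by (simp add: lie_derivative_delta[OF PG PG_mult P mult A_LA] f)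
qed

text \<open>Phrased as equality of the defects of the two Schouten identities, so that one identity
  holds exactly when the other does.\<close>

lemma schouten_twist:
  assumes P: "multivector_field MX 2 P" and mult: "multiplicative_field PG P"
    and twist: "\<And>fs. \<phi>' fs = \<phi> fs + 1 / 2 * Alt 3 (tensor_map_id LA 2 (delta MG G PG) r) fs - CYB MG G r fs"
  defines "P' \<equiv> \<lambda>x fs. P x fs - R x fs"
  shows "1 / 2 * schouten MX 2 2 P' P' x fs - fundamental MX act \<phi>' x fs =
    1 / 2 * schouten MX 2 2 P P x fs - fundamental MX act \<phi> x fs"
proof -
  have P': "multivector_field MX 2 P'"
    using multivector_field_lincomb[OF MX P R_bivector, of 1 "-1"] by (simp add: P'_def)
  show ?thesis
  proof (cases "length fs = 3 \<and> set fs \<subseteq> C_inf MX")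
    case True
    then obtain f g h where fs: "fs = [f, g, h]" and f: "f \<in> C_inf MX" "g \<in> C_inf MX" "h \<in> C_inf MX"
      by (auto simp: length_Suc_conv numeral_3_eq_3)
    show ?thesis
      using jac_twist[OF P mult f, of x, folded P'_def]
      unfolding fs schouten_bivector(1)[OF MX P f] schouten_bivector(1)[OF MX P' f] fundamental_def push_def
      by (simp add: f twist add_divide_distrib diff_divide_distrib)
  next
    case False
    \<comment> \<open>On a list of wrong length the alternation and \<open>CYB\<close> take the
      default value 0, and a nonsmooth entry makes both push-forwards 0.\<close>
    have "fundamental MX act \<phi>' x fs = fundamental MX act \<phi> x fs"
    proof (cases "set fs \<subseteq> C_inf MX")
      case True
      then have "length fs \<noteq> 3" using False by simp
      then have "Alt 3 (tensor_map_id LA 2 (delta MG G PG) r) (map (\<lambda>f k. f (act k x)) fs) = 0"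
        "CYB MG G r (map (\<lambda>f k. f (act k x)) fs) = 0"
        by (simp_all add: Alt_def CYB_def Let_def tensor_prod_def sum_list_pairs numeral_3_eq_3)
      then show ?thesis by (simp add: fundamental_def push_def twist)
    qed (simp add: fundamental_def push_def)
    moreover have "length fs \<noteq> 3 \<or> \<not> set fs \<subseteq> C_inf MX" using False by blast
    ultimately show ?thesis by (simp add: schouten_bivector(2)[OF MX P] schouten_bivector(2)[OF MX P'])
  qed
qed

end

text \<open>The orbit map of \<open>x\<close> carries the left invariant field of \<open>r\<close>
  at \<open>g\<close> to the image of \<open>R x\<close> under \<open>act g\<close>, since
  \<open>(g h) x = g (h x)\<close>, and the right invariant one to \<open>R (act g x)\<close>, since
  \<open>(h g) x = h (g x)\<close>. These are precisely the terms by which subtracting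
  \<open>R\<close> changes the two sides.\<close>

lemma multiplicative_twist:
  assumes PG': "\<And>g fs. PG' g fs = PG g fs + left_inv MG G r g fs - right_inv MG G r g fs"
  shows "multiplicative_field PG' (\<lambda>x fs. P x fs - R x fs) \<longleftrightarrow> multiplicative_field PG P"
proof -
  have "P (act g x) fs - R (act g x) fs =
      push MX (act g) (\<lambda>fs. P x fs - R x fs) fs + push MX (\<lambda>h. act h x) (PG' g) fs \<longleftrightarrow>
    P (act g x) fs = push MX (act g) (P x) fs + push MX (\<lambda>h. act h x) (PG g) fs" for g x fs
  proof (cases "set fs \<subseteq> C_inf MX")
    case True
    let ?ms = "map (\<lambda>f h. f (act h x)) fs"
    have ms: "set ?ms \<subseteq> C_inf MG" and ns: "set (map (\<lambda>f y. f (act g y)) fs) \<subseteq> C_inf MX"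
      using True C_inf_orbit C_inf_translate by (auto simp del: image_subset_iff)
    have "left_inv MG G r g ?ms = push MX (act g) (R x) fs"
      using True ms ns by (simp add: left_inv_def fundamental_def push_def o_def act_mult)
    moreover have "right_inv MG G r g ?ms = R (act g x) fs"
      using True ms by (simp add: right_inv_def fundamental_def push_def o_def act_mult)
    moreover have "push MX (\<lambda>h. act h x) T fs = T ?ms" for T using True by (simp add: push_def)
    ultimately have "push MX (\<lambda>h. act h x) (PG' g) fs = push MX (\<lambda>h. act h x) (PG g) fs + push MX (act g) (R x) fs - R (act g x) fs"
      by (simp add: PG')
    moreover have "push MX (act g) (\<lambda>fs. P x fs - R x fs) fs = push MX (act g) (P x) fs - push MX (act g) (R x) fs"
      by (simp add: push_def)
    ultimately show ?thesis by simp
  qed (simp add: push_def fundamental_def)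
  then show ?thesis unfolding multiplicative_field_def by simp
qed

lemma quasi_poisson_action_twist:
  assumes PG: "quasi_poisson_lie_group MG G PG \<phi>" and tw: "obtained_by_twisting MG G r PG \<phi> PG' \<phi>'"
  shows "quasi_poisson_action MG G PG' \<phi>' MX act (\<lambda>x fs. P x fs - R x fs) \<longleftrightarrow> quasi_poisson_action MG G PG \<phi> MX act P"
proof -
  have PG1: "multivector_field MG 2 PG"
    and PG2: "\<And>g h fs. PG (g \<otimes> h) fs = push MG (\<lambda>k. g \<otimes> k) (PG h) fs + push MG (\<lambda>k. k \<otimes> h) (PG g) fs"
    using PG unfolding quasi_poisson_lie_group_def by simp_all
  have PG': "\<And>g fs. PG' g fs = PG g fs + left_inv MG G r g fs - right_inv MG G r g fs"
    and \<phi>': "\<And>fs. \<phi>' fs = \<phi> fs + 1 / 2 * Alt 3 (tensor_map_id LA 2 (delta MG G PG) r) fs - CYB MG G r fs"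
    using tw unfolding obtained_by_twisting_def by simp_all
  \<comment> \<open>Adding \<open>R\<close> back undoes the subtraction, so one closure lemma serves
    both directions.\<close>
  have biv: "multivector_field MX 2 (\<lambda>x fs. P x fs - R x fs) \<longleftrightarrow> multivector_field MX 2 P"
    using multivector_field_lincomb[OF MX _ R_bivector, of P 1 "-1"]
      multivector_field_lincomb[OF MX _ R_bivector, of "\<lambda>x fs. P x fs - R x fs" 1 1] by auto
  have "(1 / 2 * schouten MX 2 2 (\<lambda>x fs. P x fs - R x fs) (\<lambda>x fs. P x fs - R x fs) x fs = fundamental MX act \<phi>' x fs) \<longleftrightarrow>
      (1 / 2 * schouten MX 2 2 P P x fs = fundamental MX act \<phi> x fs)"
    if "multivector_field MX 2 P" "multiplicative_field PG P" for x fs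
    using schouten_twist[OF PG1 PG2 that \<phi>', of x fs] by linarith
  then show ?thesis
    unfolding quasi_poisson_action_iff biv multiplicative_twist[OF PG'] by auto
qed

end

theorem theorem11:
  fixes MG :: "'g::{t2_space, second_countable_topology} smooth_structure"
    and G :: "'g monoid"
    and PG PG' :: "'g \<Rightarrow> 'g tensor"
    and \<phi> \<phi>' r :: "'g tensor"
    and MX :: "'x::{t2_space, second_countable_topology} smooth_structure"
    and act :: "'g \<Rightarrow> 'x \<Rightarrow> 'x"
  assumes "quasi_poisson_lie_group MG G PG \<phi>"
    and "quasi_poisson_lie_group MG G PG' \<phi>'"
    and "r \<in> ext_power (lie_algebra MG G) 2"
    and "obtained_by_twisting MG G r PG \<phi> PG' \<phi>'"
    and "homogeneous_space MG G MX act"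
  shows "(\<forall>PX. homogeneous_quasi_poisson_space MG G PG \<phi> MX act PX \<longrightarrow>
            homogeneous_quasi_poisson_space MG G PG' \<phi>' MX act
              (\<lambda>x fs. PX x fs - fundamental MX act r x fs)) \<and>
         bij_betw (\<lambda>PX x fs. PX x fs - fundamental MX act r x fs)
           (quasi_poisson_structures MG G PG \<phi> MX act)
           (quasi_poisson_structures MG G PG' \<phi>' MX act)"
proof
  have "lie_group MG G" using assms(1) unfolding quasi_poisson_lie_group_def by (rule conjunct1)
  moreover have "smooth_action MG G MX act" using assms(5) unfolding homogeneous_space_def by (rule conjunct1)
  ultimately have "lie_action_twist MG G MX act r"
    using assms(3) unfolding lie_action_twist_def lie_action_twist_axioms_def lie_action_def by simp
  note twist = lie_action_twist.quasi_poisson_action_twist[OF this assms(1,4)]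
  show "\<forall>PX. homogeneous_quasi_poisson_space MG G PG \<phi> MX act PX \<longrightarrow>
      homogeneous_quasi_poisson_space MG G PG' \<phi>' MX act (\<lambda>x fs. PX x fs - fundamental MX act r x fs)"
    unfolding homogeneous_quasi_poisson_space_def twist by simp
  show "bij_betw (\<lambda>PX x fs. PX x fs - fundamental MX act r x fs)
      (quasi_poisson_structures MG G PG \<phi> MX act) (quasi_poisson_structures MG G PG' \<phi>' MX act)"
  proof (rule bij_betw_byWitness[where f' = "\<lambda>PX x fs. PX x fs + fundamental MX act r x fs"])
    show "(\<lambda>PX x fs. PX x fs - fundamental MX act r x fs) ` quasi_poisson_structures MG G PG \<phi> MX act
        \<subseteq> quasi_poisson_structures MG G PG' \<phi>' MX act"
      unfolding quasi_poisson_structures_def image_subset_iff mem_Collect_eq twist by simp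
    \<comment> \<open>The equivalence is read backwards at the sum, whose difference with the field
      of \<open>r\<close> is \<open>PX\<close> itself.\<close>
    have "quasi_poisson_action MG G PG \<phi> MX act (\<lambda>x fs. PX x fs + fundamental MX act r x fs)"
      if "quasi_poisson_action MG G PG' \<phi>' MX act PX" for PX
      using twist[of "\<lambda>x fs. PX x fs + fundamental MX act r x fs"] that by simp
    then show "(\<lambda>PX x fs. PX x fs + fundamental MX act r x fs) ` quasi_poisson_structures MG G PG' \<phi>' MX act
        \<subseteq> quasi_poisson_structures MG G PG \<phi> MX act"
      unfolding quasi_poisson_structures_def by blast
  qed simp_all
qed

end
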